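(* Let $p\ge 1$ be an integer and let $T$ be a tree. Let $G$ be a graph such that every prime induced subgraph of $G$ has linear rank-width at most $p$. If $\operatorname{lrw}(G)\ge 40(p+2)|V(T)|$, then $G$ contains a vertex-minor isomorphic to $T$.
   Context: All graphs are finite, simple and undirected. For a graph $G$ and $X\subseteq V(G)$, the cut-rank $\operatorname{cutrk}_G(X)$ is the rank over the binary field of the submatrix of the adjacency matrix of $G$ with rows indexed by $X$ and columns indexed by $V(G)\setminus X$. A linear layout of $G$ is an ordering $(x_1,\dots,x_n)$ of $V(G)$; if $n\ge 2$ its width is $\max_{1\le i\le n-1}\operatorname{cutrk}_G(\{x_1,\dots,x_i\})$. The linear rank-width $\operatorname{lrw}(G)$ is the minimum width of a linear layout of $G$ if $|V(G)|\ge 2$, and $0$ otherwise. A split of a connected graph $G$ is a partition $(X,Y)$ of $V(G)$ with $|X|,|Y|\ge 2$ such that the binary adjacency submatrix with rows $X$ and columns $Y$ has rank $1$ (equivalently, the edges between $X$ and $Y$ form a complete bipartite graph between some nonempty $X'\subseteq X$ and $Y'\subseteq Y$). A connected graph is prime if it has no split. The local complementation at a vertex $x$ replaces the subgraph induced on the neighbourhood of $x$ by its complement; a graph $H$ is a vertex-minor of $G$ if $H$ can be obtained from $G$ by a sequence of local complementations and vertex deletions. *)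

theory Defs
  imports
    "Jordan_Normal_Form.DL_Rank"
    "HOL-Library.Z2"
    "HOL-Combinatorics.Multiset_Permutations"
    "Graph_Theory.Graph_Theory"
begin

text \<open>
  A finite simple undirected graph is a \<open>pair_graph\<close>: a finite vertex set \<open>pverts G\<close> together with
  an irreflexive symmetric relation \<open>parcs G\<close> on it, each edge being represented by its two
  orientations. Library notions defined for \<open>pre_digraph\<close> are applied through \<open>with_proj\<close>.
\<close>

text \<open>
  The matrix type is indexed by natural numbers, so the rows and columns have to be enumerated;
  the rank does not depend on the enumerations chosen (lemma \<open>adj_rank_eq\<close> below).
\<close>

definition adjacency_mat :: "'a pair_pre_digraph \<Rightarrow> 'a list \<Rightarrow> 'a list \<Rightarrow> bit mat" where
  "adjacency_mat G xs ys =
     mat (length xs) (length ys) (\<lambda>(i, j). if (xs ! i, ys ! j) \<in> parcs G then 1 else 0)"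

definition vertex_enum :: "'a set \<Rightarrow> 'a list" where
  "vertex_enum X = (SOME xs. xs \<in> permutations_of_set X)"

definition adj_rank :: "'a pair_pre_digraph \<Rightarrow> 'a set \<Rightarrow> 'a set \<Rightarrow> nat" where
  "adj_rank G X Y = vec_space.rank (card X) (adjacency_mat G (vertex_enum X) (vertex_enum Y))"

lemma (in vec_space) rank_reindex_rows_le:
  assumes A: "A \<in> carrier_mat n nc" and B: "B \<in> carrier_mat n nc'"
    and \<pi>: "bij_betw \<pi> {..<n} {..<n}"
    and cols: "(\<lambda>v. vec n (\<lambda>j. v $ \<pi> j)) ` set (cols A) \<subseteq> set (cols B)"
  shows "rank A \<le> rank B"
proof -
  define \<phi> where "\<phi> v = vec n (\<lambda>j. v $ \<pi> j)" for v :: "'a vec"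
  have \<pi>_less: "\<pi> j < n" if "j < n" for j
    using \<pi> that by (auto simp: bij_betw_def)
  have \<pi>_surj: "\<exists>j<n. i = \<pi> j" if "i < n" for i
  proof -
    have "i \<in> \<pi> ` {..<n}" using \<pi> that by (simp add: bij_betw_def)
    then show ?thesis by auto
  qed
  have inj: "inj_on \<phi> (carrier_vec n)"
  proof (rule inj_onI)
    fix u v assume uv: "u \<in> carrier_vec n" "v \<in> carrier_vec n" "\<phi> u = \<phi> v"
    have "u $ i = v $ i" if i: "i < n" for i
    proof -
      obtain j where "j < n" "i = \<pi> j" using \<pi>_surj i by blast
      then show ?thesis using arg_cong[OF uv(3), of "\<lambda>w. w $ j"] by (simp add: \<phi>_def)
    qed
    then show "u = v" using uv by auto
  qed
  obtain S where S: "maximal S (\<lambda>T. T \<subseteq> set (cols A) \<and> lin_indpt T)" "{} \<subseteq> S"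
    using maximal_exists_superset[of "set (cols A)" "\<lambda>T. T \<subseteq> set (cols A) \<and> lin_indpt T" "{}"]
    by (auto simp: lin_dep_def)
  then have SA: "S \<subseteq> set (cols A)" and li: "lin_indpt S"
    by (auto simp: maximal_def)
  have SC: "S \<subseteq> carrier_vec n" using SA A cols_dim by blast
  have finS: "finite S" using SA finite_subset by blast
  have im: "\<phi> ` S \<subseteq> carrier_vec n" by (auto simp: \<phi>_def)
  have "lin_indpt (\<phi> ` S)"
  proof (rule finite_lin_indpt2)
    fix a assume 0: "lincomb a (\<phi> ` S) = 0\<^sub>v n"
    have "lincomb (a \<circ> \<phi>) S = 0\<^sub>v n"
    proof (rule eq_vecI)
      fix i assume "i < dim_vec (0\<^sub>v n :: 'a vec)"
      then have i: "i < n" by simp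
      obtain j where j: "j < n" "i = \<pi> j" using \<pi>_surj i by blast
      have "lincomb (a \<circ> \<phi>) S $ i = (\<Sum>v\<in>S. a (\<phi> v) * \<phi> v $ j)"
        using i j SC by (simp add: lincomb_index \<phi>_def)
      also have "\<dots> = (\<Sum>w\<in>\<phi> ` S. a w * w $ j)"
        using inj_on_subset[OF inj SC] by (simp add: sum.reindex)
      also have "\<dots> = lincomb a (\<phi> ` S) $ j" using j im by (simp add: lincomb_index)
      finally show "lincomb (a \<circ> \<phi>) S $ i = 0\<^sub>v n $ i" using 0 i j by simp
    qed (use SC finS lincomb_dim in auto)
    then have "\<forall>v\<in>S. (a \<circ> \<phi>) v = 0"
      using li lin_dep_crit[OF finS subset_refl, where a = "a \<circ> \<phi>"] by auto
    then show "\<forall>v\<in>\<phi> ` S. a v = 0" by auto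
  qed (use finS im in auto)
  moreover have "\<phi> ` S \<subseteq> set (cols B)" using SA cols by (auto simp: \<phi>_def)
  ultimately have "card (\<phi> ` S) \<le> rank B" using rank_ge_card_indpt B by blast
  then show ?thesis
    using rank_card_indpt[OF A S(1)] card_image[OF inj_on_subset[OF inj SC]] by simp
qed

lemma rank_adjacency_mat_le:
  assumes xs: "xs \<in> permutations_of_set X" "xs' \<in> permutations_of_set X"
    and ys: "ys \<in> permutations_of_set Y" "ys' \<in> permutations_of_set Y"
  shows "vec_space.rank (card X) (adjacency_mat G xs ys) \<le> vec_space.rank (card X) (adjacency_mat G xs' ys')"
proof -
  let ?n = "card X"
  have len: "length xs = ?n" "length xs' = ?n"
    using xs by (simp_all add: length_finite_permutations_of_set)
  have xsD: "distinct xs" "set xs = X" "distinct xs'" "set xs' = X"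
    using xs by (auto simp: permutations_of_set_def)
  have ysD: "set ys = Y" "set ys' = Y"
    using ys by (auto simp: permutations_of_set_def)
  have b1: "bij_betw ((!) xs) {..<?n} X"
    by (rule bij_betw_nth) (simp_all add: xsD len)
  have b2: "bij_betw ((!) xs') {..<?n} X"
    by (rule bij_betw_nth) (simp_all add: xsD len)
  define \<pi> where "\<pi> = inv_into {..<?n} ((!) xs) \<circ> (!) xs'"
  have \<pi>: "bij_betw \<pi> {..<?n} {..<?n}"
    unfolding \<pi>_def using b1 b2 by (meson bij_betw_inv_into bij_betw_trans)
  have \<pi>_nth: "\<pi> j < ?n \<and> xs ! \<pi> j = xs' ! j" if "j < ?n" for j
  proof -
    have "xs' ! j \<in> X" using that b2 by (auto simp: bij_betw_def)
    then have "xs' ! j \<in> (!) xs ` {..<?n}" using b1 by (simp add: bij_betw_def)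
    then have "xs ! \<pi> j = xs' ! j" unfolding \<pi>_def o_def by (rule f_inv_into_f)
    moreover have "\<pi> j \<in> {..<?n}" using \<pi> that by (auto simp: bij_betw_def)
    ultimately show ?thesis by simp
  qed
  have col: "cols (adjacency_mat G zs ws) =
      map (\<lambda>y. vec (length zs) (\<lambda>i. if (zs ! i, y) \<in> parcs G then 1 else 0)) ws"
    for zs ws by (rule nth_equalityI) (auto simp: adjacency_mat_def)
  show ?thesis
  proof (rule vec_space.rank_reindex_rows_le[OF _ _ \<pi>])
    show "adjacency_mat G xs ys \<in> carrier_mat ?n (length ys)"
      "adjacency_mat G xs' ys' \<in> carrier_mat ?n (length ys')"
      by (simp_all add: adjacency_mat_def len)
    show "(\<lambda>v. vec ?n (\<lambda>j. v $ \<pi> j)) ` set (cols (adjacency_mat G xs ys))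
        \<subseteq> set (cols (adjacency_mat G xs' ys'))"
      unfolding col set_map ysD len image_image
    proof (rule image_mono[OF subset_refl, THEN subset_trans], rule equalityD1, rule image_cong)
    qed (auto simp: \<pi>_nth)
  qed
qed

lemma adj_rank_eq:
  assumes "xs \<in> permutations_of_set X" "ys \<in> permutations_of_set Y"
  shows "adj_rank G X Y = vec_space.rank (card X) (adjacency_mat G xs ys)"
proof -
  have "vertex_enum X \<in> permutations_of_set X" "vertex_enum Y \<in> permutations_of_set Y"
    unfolding vertex_enum_def using assms by (auto intro: someI)
  then show ?thesis unfolding adj_rank_def using assms by (intro antisym rank_adjacency_mat_le)
qed

definition cutrk :: "'a pair_pre_digraph \<Rightarrow> 'a set \<Rightarrow> nat" where
  "cutrk G X = adj_rank G X (pverts G - X)"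

definition layout_width :: "'a pair_pre_digraph \<Rightarrow> 'a list \<Rightarrow> nat" where
  "layout_width G xs = Max ((\<lambda>i. cutrk G (set (take i xs))) ` {1..length xs - 1})"

definition lrw :: "'a pair_pre_digraph \<Rightarrow> nat" where
  "lrw G = (if card (pverts G) \<ge> 2
            then Min (layout_width G ` permutations_of_set (pverts G)) else 0)"

definition is_split :: "'a pair_pre_digraph \<Rightarrow> 'a set \<Rightarrow> 'a set \<Rightarrow> bool" where
  "is_split G X Y \<longleftrightarrow> X \<union> Y = pverts G \<and> X \<inter> Y = {} \<and> card X \<ge> 2 \<and> card Y \<ge> 2 \<and>
     adj_rank G X Y = 1"

definition prime_graph :: "'a pair_pre_digraph \<Rightarrow> bool" where
  "prime_graph G \<longleftrightarrow>
     Digraph_Component.connected (with_proj G) \<and> \<not> (\<exists>X Y. is_split G X Y)"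

text \<open>
  The library's \<open>tree\<close> is not suitable here: in a symmetric digraph the two orientations of an
  edge form a directed cycle of length 2. The cycles of the undirected graph are the directed
  cycles of length at least 3.
\<close>

definition tree_graph :: "'a pair_pre_digraph \<Rightarrow> bool" where
  "tree_graph T \<longleftrightarrow> pair_graph T \<and> Digraph_Component.connected (with_proj T) \<and>
     \<not> (\<exists>c. pre_digraph.cycle (with_proj T) c \<and> length c \<ge> 3)"

definition neighbourhood :: "'a pair_pre_digraph \<Rightarrow> 'a \<Rightarrow> 'a set" where
  "neighbourhood G x = {v. (x, v) \<in> parcs G}"

definition local_complement :: "'a pair_pre_digraph \<Rightarrow> 'a \<Rightarrow> 'a pair_pre_digraph" where
  "local_complement G x =
     (let N = neighbourhood G x; K = {(u, v). u \<in> N \<and> v \<in> N \<and> u \<noteq> v}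
      in \<lparr> pverts = pverts G, parcs = (parcs G - K) \<union> (K - parcs G) \<rparr>)"

definition delete_vertex :: "'a pair_pre_digraph \<Rightarrow> 'a \<Rightarrow> 'a pair_pre_digraph" where
  "delete_vertex G x =
     \<lparr> pverts = pverts G - {x}, parcs = {(u, v) \<in> parcs G. u \<noteq> x \<and> v \<noteq> x} \<rparr>"

inductive has_vertex_minor :: "'a pair_pre_digraph \<Rightarrow> 'a pair_pre_digraph \<Rightarrow> bool" for G where
  refl: "has_vertex_minor G G"
| local_complement:
    "has_vertex_minor G H \<Longrightarrow> x \<in> pverts H \<Longrightarrow> has_vertex_minor G (local_complement H x)"
| delete_vertex:
    "has_vertex_minor G H \<Longrightarrow> x \<in> pverts H \<Longrightarrow> has_vertex_minor G (delete_vertex H x)"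

end

theory Submission
  imports Defs
begin

text \<open>
  Let \<open>n\<close> be the number of vertices of \<open>T\<close>. Sets of cut-rank 1 in a connected graph are closed under
  unions of overlapping sets, and this replaces the canonical split decomposition. Say that such a
  set branches \<open>k + 1\<close> times if it contains two disjoint sets that branch \<open>k\<close> times and whose union
  has cut-rank 2.

  If no set branches \<open>k\<close> times, then a maximal chain of sets of cut-rank 1 cuts the graph into layers.
  Contracting the maximal sets of cut-rank 1 inside a layer yields a prime induced subgraph, which has
  a layout of width \<open>p\<close>; substituting layouts of the contracted sets costs \<open>2 (p + 2)\<close> for every level,
  so that the linear rank-width is at most \<open>2 (p + 2) k\<close>.

  If some set branches \<open>4 n\<close> times, then \<open>T\<close> is grown from its root \<open>a\<close>: local complementations at
  vertices of a set \<open>Y\<close> attached only to \<open>a\<close> change nothing outside \<open>insert a Y\<close>, one level of branching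
  suffices to put a new vertex between \<open>a\<close> and a subset of \<open>Y\<close>, and four levels suffice to replace \<open>Y\<close>
  by two non-adjacent subsets attached to \<open>a\<close>. As \<open>8 (p + 2) n < 40 (p + 2) n\<close>, the theorem follows.
\<close>

section \<open>Sets of cut-rank 1\<close>

text \<open>The obstacle is that a local complementation may spoil what has been built before. Two
  invariants meet it. The set in which the search goes on hangs on the rest by the single vertex
  \<open>a\<close>, so operations inside it cannot reach beyond \<open>a\<close>. And
  \<open>branching\<close> consists of cut-rank conditions only, which local complementations do not
  alter and which survive the deletion of vertices outside a set as long as some edge still leaves
  that set. The factor 4 in \<open>4 n\<close> comes from a root with several branches: three levels
  lay out a path, the fourth yields two limbs, and since the two subtrees share the root and have
  two vertices or more, each has at most \<open>n - 1\<close> vertices. The factor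
  \<open>2 (p + 2)\<close> arises because a layout of width \<open>p\<close> of the prime graph of a
  layer is rearranged so that the vertices standing for the two ends of the layer come first and
  last, which costs 2. The resulting \<open>p + 2\<close> is paid once inside a minimal branching
  set and once more when such sets are put together.\<close>

definition connected_on :: "('a \<Rightarrow> 'a \<Rightarrow> bool) \<Rightarrow> 'a set \<Rightarrow> bool" where
  "connected_on E X \<longleftrightarrow>
     X \<noteq> {} \<and> (\<forall>S. S \<subseteq> X \<and> S \<noteq> {} \<and> S \<noteq> X \<longrightarrow> (\<exists>u\<in>S. \<exists>v\<in>X - S. E u v))"

text \<open>Rank exactly 1 over the binary field without matrices: there is a nonzero row, and all
  nonzero rows are equal. Sizes are not bounded below, so that singletons can start a chain and can
  occur as parts.\<close>

definition rank1_set :: "('a \<Rightarrow> 'a \<Rightarrow> bool) \<Rightarrow> 'a set \<Rightarrow> 'a set \<Rightarrow> bool" where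
  "rank1_set E V Y \<longleftrightarrow> Y \<subseteq> V \<and> (\<exists>u\<in>Y. \<exists>v\<in>V - Y. E u v) \<and>
     (\<forall>u\<in>Y. \<forall>u'\<in>Y. \<forall>v\<in>V - Y. \<forall>v'\<in>V - Y. E u v \<longrightarrow> E u' v' \<longrightarrow> E u v')"

text \<open>An exclusive or on all pairs of the type. No vertex set is involved, so deletions need
  not restrict the relation.\<close>

definition locomp :: "('a \<Rightarrow> 'a \<Rightarrow> bool) \<Rightarrow> 'a \<Rightarrow> 'a \<Rightarrow> 'a \<Rightarrow> bool" where
  "locomp E x u v \<longleftrightarrow> E u v \<noteq> (E x u \<and> E x v \<and> u \<noteq> v)"

lemma connected_onD:
  assumes "connected_on E X" "S \<subseteq> X" "S \<noteq> {}" "S \<noteq> X"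
  obtains u v where "u \<in> S" "v \<in> X - S" "E u v"
  using assms unfolding connected_on_def by blast

lemma not_connected_onE:
  assumes "\<not> connected_on E X" "X \<noteq> {}"
  obtains S where "S \<subseteq> X" "S \<noteq> {}" "S \<noteq> X" "\<And>u v. u \<in> S \<Longrightarrow> v \<in> X - S \<Longrightarrow> \<not> E u v"
proof -
  have "\<exists>S. S \<subseteq> X \<and> S \<noteq> {} \<and> S \<noteq> X \<and> (\<forall>u\<in>S. \<forall>v\<in>X - S. \<not> E u v)"
    using assms unfolding connected_on_def by blast
  then show thesis using that by metis
qed

lemma connected_on_singleton: "connected_on E {x}"
  by (auto simp: connected_on_def)

lemma rank1_set_subset: "rank1_set E V Y \<Longrightarrow> Y \<subseteq> V"
  by (simp add: rank1_set_def)

lemma rank1_setD: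
  assumes "rank1_set E V Y" "u \<in> Y" "u' \<in> Y" "v \<in> V - Y" "v' \<in> V - Y" "E u v" "E u' v'"
  shows "E u v'"
  using assms unfolding rank1_set_def by blast

lemma rank1_set_edge:
  assumes "rank1_set E V Y"
  obtains u v where "u \<in> Y" "v \<in> V" "v \<notin> Y" "E u v"
  using assms unfolding rank1_set_def by blast

lemma rank1_set_nonempty: "rank1_set E V Y \<Longrightarrow> Y \<noteq> {} \<and> Y \<noteq> V"
  by (auto simp: rank1_set_def)

lemma rank1_set_complement:
  assumes "symp E" "rank1_set E V Y"
  shows "rank1_set E V (V - Y)"
  unfolding rank1_set_def
proof (intro conjI ballI impI)
  obtain u v where "u \<in> Y" "v \<in> V" "v \<notin> Y" "E u v" using assms(2) by (rule rank1_set_edge)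
  then show "\<exists>u\<in>V - Y. \<exists>v\<in>V - (V - Y). E u v"
    using rank1_set_subset[OF assms(2)] sympD[OF assms(1)] by blast
next
  fix u u' v v'
  assume a: "u \<in> V - Y" "u' \<in> V - Y" "v \<in> V - (V - Y)" "v' \<in> V - (V - Y)" "E u v" "E u' v'"
  have "E v' u"
    using rank1_setD[OF assms(2) _ _ a(2,1) sympD[OF assms(1) a(6)] sympD[OF assms(1) a(5)]] a(3,4)
    by blast
  then show "E u v'" by (rule sympD[OF assms(1)])
qed auto

lemma rank1_set_singleton:
  assumes "symp E" "connected_on E V" "v \<in> V" "V \<noteq> {v}"
  shows "rank1_set E V {v}"
proof -
  obtain w where "w \<in> V - {v}" "E v w"
    using connected_onD[OF assms(2), of "{v}"] assms(3,4) by blast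
  then show ?thesis using assms by (auto simp: rank1_set_def)
qed

text \<open>Submodularity of the cut-rank: the ranks of \<open>Y \<inter> Z\<close> and
  \<open>Y \<union> Z\<close> add up to at most 2, and by connectedness neither is 0. The proof
  argues with edges instead.\<close>

lemma rank1_set_Un:
  assumes sym: "symp E" and con: "connected_on E V"
    and 1: "rank1_set E V Y" and 2: "rank1_set E V Z"
    and int: "Y \<inter> Z \<noteq> {}" and ne: "Y \<union> Z \<noteq> V"
  shows "rank1_set E V (Y \<union> Z)"
proof -
  note s = sympD[OF sym]
  have sub: "Y \<subseteq> V" "Z \<subseteq> V" using 1 2 by (auto simp: rank1_set_subset)
  have "\<exists>u\<in>Y \<union> Z. \<exists>v\<in>V - (Y \<union> Z). E u v"
    using connected_onD[OF con, of "Y \<union> Z"] sub int ne by (metis Int_Un_eq(2) Un_least inf_bot_right sup_bot.right_neutral sup_eq_bot_iff)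
  \<comment> \<open>Only vertices of different sets need an argument. By connectedness an edge
    leaves \<open>A \<inter> B\<close>. If it stays inside one of the two sets, the rank condition
    of the other replaces its end by \<open>v\<close> or \<open>v'\<close>, which lie outside both.
    Thus a vertex of \<open>A \<inter> B\<close> has a neighbour outside both and links the rows of
    \<open>u\<close> and \<open>u'\<close>.\<close>
  moreover have mixed: "E u v'"
    if uv: "u \<in> A" "v \<in> V - (A \<union> B)" "E u v" "u' \<in> B" "v' \<in> V - (A \<union> B)" "E u' v'"
      and A: "rank1_set E V A" and B: "rank1_set E V B" and AB: "A \<inter> B \<noteq> {}" for A B u v u' v'
  proof -
    have subs: "A \<subseteq> V" "B \<subseteq> V" using A B by (auto simp: rank1_set_subset)
    have mem: "v \<in> V - A" "v \<in> V - B" "v' \<in> V - A" "v' \<in> V - B" using uv by blast+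
    have key: "E u v'" if x: "x \<in> A" "x \<in> B" "w \<in> V - B" "E x w" "w \<in> V - A" for x w
    proof -
      have "E x v'" using rank1_setD[OF B x(2) uv(4) x(3) mem(4) x(4) uv(6)] .
      then show ?thesis using rank1_setD[OF A uv(1) x(1) mem(1,3) uv(3)] by blast
    qed
    obtain x w where xw: "x \<in> A \<inter> B" "w \<in> V - (A \<inter> B)" "E x w"
    proof (rule connected_onD[OF con, of "A \<inter> B"])
      show "A \<inter> B \<subseteq> V" "A \<inter> B \<noteq> V" using subs uv(2) by blast+
    qed (use AB in blast)+
    consider "w \<in> V - (A \<union> B)" | "w \<in> B - A" | "w \<in> A - B" using xw by blast
    then show ?thesis
    proof cases
      case 1
      then show ?thesis using key[of x w] xw by blast
    next
      case 2
      then have "E x v" using rank1_setD[OF A _ uv(1) _ mem(1) xw(3) uv(3)] xw(1,2) by blast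
      then show ?thesis using key[of x v] xw(1) mem by blast
    next
      case 3
      then have "E x v'" using rank1_setD[OF B _ uv(4) _ mem(4) xw(3) uv(6)] xw(1,2) by blast
      then show ?thesis using key[of x v'] xw(1) mem by blast
    qed
  qed
  have "E u v'" if uv: "u \<in> Y \<union> Z" "v \<in> V - (Y \<union> Z)" "E u v" "u' \<in> Y \<union> Z" "v' \<in> V - (Y \<union> Z)" "E u' v'"
    for u v u' v'
  proof -
    consider "u \<in> Y" "u' \<in> Y" | "u \<in> Z" "u' \<in> Z" | "u \<in> Y" "u' \<in> Z" | "u \<in> Z" "u' \<in> Y" using uv(1,4) by blast
    then show ?thesis
    proof cases
      case 1 then show ?thesis using rank1_setD[OF assms(3), of u u' v v'] uv by blast
    next
      case 2 then show ?thesis using rank1_setD[OF assms(4), of u u' v v'] uv by blast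
    next
      case 3 then show ?thesis using mixed[of u Y v Z u' v'] uv 1 2 int by blast
    next
      case 4 then show ?thesis using mixed[of u Z v Y u' v'] uv 1 2 int by blast
    qed
  qed
  ultimately show ?thesis unfolding rank1_set_def using sub by blast
qed

section \<open>Invariance under local complementation\<close>

lemma symp_locomp: "symp E \<Longrightarrow> symp (locomp E x)"
  unfolding symp_def locomp_def by blast

lemma irreflp_locomp: "irreflp E \<Longrightarrow> irreflp (locomp E x)"
  unfolding irreflp_def locomp_def by blast

lemma locomp_at [simp]: "irreflp E \<Longrightarrow> locomp E x x u = E x u" "irreflp E \<Longrightarrow> locomp E x u x = E u x"
  unfolding irreflp_def locomp_def by blast+

text \<open>Across the cut, the row of \<open>x\<close> is added to the rows of the neighbours of
  \<open>x\<close> in \<open>Y\<close>. If the row of \<open>x\<close> is zero, nothing changes;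
  otherwise every row is zero or equal to that of \<open>x\<close>, before and after.\<close>

lemma rank1_set_locomp_inside:
  assumes sym: "symp E" and irr: "irreflp E" and r: "rank1_set E V Y" and x: "x \<in> Y"
  shows "rank1_set (locomp E x) V Y"
proof (cases "\<exists>w\<in>V - Y. E x w")
  case False
  then have eq: "locomp E x u v = E u v" if "u \<in> Y" "v \<in> V - Y" for u v
    using that unfolding locomp_def by blast
  show ?thesis using r eq unfolding rank1_set_def by (metis (no_types, lifting))
next
  case True
  then obtain w where w: "w \<in> V - Y" "E x w" by blast
  have bd: "E u v \<longleftrightarrow> E x v" if "u \<in> Y" "v \<in> V - Y" "E u v0" "v0 \<in> V - Y" for u v v0
    using that rank1_setD[OF r, of u x v0 v] rank1_setD[OF r, of x u w v] x w by blast
  have in': "locomp E x u v' \<longleftrightarrow> E x v'" if "u \<in> Y" "v \<in> V - Y" "v' \<in> V - Y" "locomp E x u v" for u v v'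
    using that bd[of u v v] bd[of u v' v] bd[of u v v'] bd[of u v' v'] unfolding locomp_def by (smt (verit) DiffD2)
  have "locomp E x x w" using w irr by simp
  then show ?thesis
    unfolding rank1_set_def using rank1_set_subset[OF r] in' w x by blast
qed

lemma rank1_set_locomp:
  assumes sym: "symp E" and irr: "irreflp E" and r: "rank1_set E V Y" and x: "x \<in> V"
  shows "rank1_set (locomp E x) V Y"
proof (cases "x \<in> Y")
  case False
  have "rank1_set (locomp E x) V (V - Y)"
    using rank1_set_locomp_inside[OF sym irr rank1_set_complement[OF sym r]] x False by blast
  from rank1_set_complement[OF symp_locomp[OF sym] this]
  show ?thesis using rank1_set_subset[OF r] by (simp add: double_diff)
qed (use assms in \<open>blast intro: rank1_set_locomp_inside\<close>)

lemma locomp_locomp [simp]: "irreflp E \<Longrightarrow> locomp (locomp E x) x = E"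
  unfolding irreflp_def locomp_def fun_eq_iff by metis

lemma rank1_set_locomp_iff:
  assumes "symp E" "irreflp E" "x \<in> V"
  shows "rank1_set (locomp E x) V Y \<longleftrightarrow> rank1_set E V Y"
  using rank1_set_locomp[OF assms(1,2) _ assms(3), of Y]
    rank1_set_locomp[OF symp_locomp[OF assms(1), of x] irreflp_locomp[OF assms(2), of x] _ assms(3), of Y] assms
  by auto

lemma connected_on_locomp:
  assumes sym: "symp E" and irr: "irreflp E" and c: "connected_on E X" and x: "x \<in> X"
  shows "connected_on (locomp E x) X"
  unfolding connected_on_def
proof (intro conjI allI impI)
  show "X \<noteq> {}" using x by blast
  fix S assume S: "S \<subseteq> X \<and> S \<noteq> {} \<and> S \<noteq> X"
  then obtain u v where uv: "u \<in> S" "v \<in> X - S" "E u v"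
    using connected_onD[OF c] by metis
  show "\<exists>u\<in>S. \<exists>v\<in>X - S. locomp E x u v"
  \<comment> \<open>A crossing edge is lost only if both its ends are adjacent to \<open>x\<close>.
    Edges at \<open>x\<close> are never toggled, and one of the two now crosses instead.\<close>
  proof (cases "E x u \<and> E x v")
    case True
    show ?thesis
    proof (cases "x \<in> S")
      case True
      then show ?thesis using uv \<open>E x u \<and> E x v\<close> irr by (metis locomp_at(1))
    next
      case False
      then show ?thesis using uv \<open>E x u \<and> E x v\<close> irr x sym by (metis DiffI locomp_at(2) sympD)
    qed
  next
    case False
    then show ?thesis using uv by (auto simp: locomp_def)
  qed
qed

text \<open>Suppose that \<open>S\<close> disconnects the first graph and \<open>R\<close> the
  second. By \<open>cross\<close>, the edges of \<open>E\<close> across \<open>R\<close> are exactly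
  the pairs of neighbours of \<open>x\<close>. Neighbours of \<open>x\<close> on different sides of
  \<open>S\<close> are not adjacent, so they lie on the same side of \<open>R\<close>, and hence all
  neighbours of \<open>x\<close> do. But \<open>X\<close> is connected, so each side of
  \<open>R\<close> contains one.\<close>

lemma connected_on_eliminate:
  assumes sym: "symp E" and irr: "irreflp E" and c: "connected_on E X" and x: "x \<in> X"
    and ne: "X \<noteq> {x}"
  shows "connected_on E (X - {x}) \<or> connected_on (locomp E x) (X - {x})"
proof (rule ccontr)
  assume not: "\<not> (connected_on E (X - {x}) \<or> connected_on (locomp E x) (X - {x}))"
  note s = sympD[OF sym]
  have X: "X - {x} \<noteq> {}" using x ne by blast
  obtain S where S: "S \<subseteq> X - {x}" "S \<noteq> {}" "S \<noteq> X - {x}" "\<And>u v. u \<in> S \<Longrightarrow> v \<in> X - {x} - S \<Longrightarrow> \<not> E u v"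
    using not_connected_onE[OF _ X, of E] not by metis
  obtain R where R: "R \<subseteq> X - {x}" "R \<noteq> {}" "R \<noteq> X - {x}"
      "\<And>u v. u \<in> R \<Longrightarrow> v \<in> X - {x} - R \<Longrightarrow> \<not> locomp E x u v"
    using not_connected_onE[OF _ X, of "locomp E x"] not by metis
  have cross: "E u v \<longleftrightarrow> E x u \<and> E x v" if "u \<in> R" "v \<in> X - {x} - R" for u v
    using R(4)[OF that] that unfolding locomp_def by blast
  have nbr: "\<exists>u\<in>Q. E x u" if Q: "Q \<subseteq> X - {x}" "Q \<noteq> {}" "\<And>u v. u \<in> Q \<Longrightarrow> v \<in> X - {x} - Q \<Longrightarrow> E u v \<Longrightarrow> E x u" for Q
  proof -
    have "Q \<subseteq> X" "Q \<noteq> X" using Q(1) x by blast+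
    then obtain u v where uv: "u \<in> Q" "v \<in> X - Q" "E u v"
      using connected_onD[OF c _ Q(2)] by metis
    then have "E x u" using Q(3)[of u v] s[OF uv(3)] by (cases "v = x") auto
    then show ?thesis using uv(1) by blast
  qed
  obtain s1 where s1: "s1 \<in> S" "E x s1" using nbr[OF S(1,2)] S(4) by blast
  obtain s2 where s2: "s2 \<in> X - {x} - S" "E x s2" using nbr[of "X - {x} - S"] S(1-3) S(4)[OF _ _] s by (metis Diff_eq_empty_iff Diff_iff Diff_subset subset_antisym)
  obtain r1 where r1: "r1 \<in> R" "E x r1" using nbr[OF R(1,2)] cross by blast
  obtain r2 where r2: "r2 \<in> X - {x} - R" "E x r2"
    using nbr[of "X - {x} - R"] R(1-3) cross s by (metis Diff_eq_empty_iff Diff_iff Diff_subset subset_antisym)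
  have same: "a \<in> R \<longleftrightarrow> b \<in> R" if "a \<in> S" "E x a" "b \<in> X - {x} - S" "E x b" for a b
  proof -
    have n: "\<not> E a b" "\<not> E b a" using S(4)[OF that(1,3)] s by blast+
    have "a \<in> X - {x}" "b \<in> X - {x}" using that(1,3) S(1) by blast+
    then show ?thesis using n cross[of a b] cross[of b a] that(2,4) by blast
  qed
  have "s1 \<in> R \<longleftrightarrow> n \<in> R" if "n \<in> X - {x}" "E x n" for n
    using that same[OF s1 s2] same[OF s1, of n] same[OF _ _ s2, of n] by blast
  then show False using r1 r2 R(1) by blast
qed

text \<open>All vertices of \<open>Y\<close> with a neighbour outside \<open>Y\<close> are adjacent
  to \<open>b\<close>, so \<open>b\<close> can stand for the whole of \<open>V - Y\<close>.\<close>

lemma connected_on_rank1_set: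
  assumes sym: "symp E" and c: "connected_on E V" and r: "rank1_set E V Y"
    and b: "b \<in> V - Y" "y \<in> Y" "E y b"
  shows "connected_on E (insert b Y)"
  unfolding connected_on_def
proof (intro conjI allI impI)
  fix S assume S: "S \<subseteq> insert b Y \<and> S \<noteq> {} \<and> S \<noteq> insert b Y"
  \<comment> \<open>The side of the cut that avoids \<open>b\<close>. It lies in \<open>Y\<close>,
    so an edge of \<open>V\<close> leaving it either stays in \<open>Y\<close> or can be redirected
    to \<open>b\<close>.\<close>
  define Q where "Q = (if b \<in> S then insert b Y - S else S)"
  have Q: "Q \<subseteq> Y" "Q \<noteq> {}" using S by (auto simp: Q_def)
  have "Q \<noteq> V" "Q \<subseteq> V" using Q b rank1_set_subset[OF r] by auto
  then obtain u v where uv: "u \<in> Q" "v \<in> V - Q" "E u v" using connected_onD[OF c] Q(2) by metis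
  have "\<exists>v\<in>insert b Y - Q. E u v"
  proof (cases "v \<in> Y")
    case False
    then have "E u b" using rank1_setD[OF r, of u y v b] uv b Q by blast
    then show ?thesis using Q b by blast
  qed (use uv in blast)
  then obtain v where v: "v \<in> insert b Y - Q" "E u v" by blast
  show "\<exists>u\<in>S. \<exists>v\<in>insert b Y - S. E u v"
  proof (cases "b \<in> S")
    case True
    then have "v \<in> S" "u \<in> insert b Y - S" using uv(1) v(1) by (auto simp: Q_def)
    then show ?thesis using sympD[OF sym v(2)] by blast
  next
    case False
    then have "u \<in> S" "v \<in> insert b Y - S" using uv(1) v(1) by (auto simp: Q_def)
    then show ?thesis using v(2) by blast
  qed
qed auto

lemma connected_on_insert:
  assumes "symp E" "connected_on E X" "y \<in> X" "E x y"
  shows "connected_on E (insert x X)"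
  unfolding connected_on_def
proof (intro conjI allI impI)
  fix S assume S: "S \<subseteq> insert x X \<and> S \<noteq> {} \<and> S \<noteq> insert x X"
  show "\<exists>u\<in>S. \<exists>v\<in>insert x X - S. E u v"
  proof (cases "S \<inter> X = {} \<or> X \<subseteq> S")
    case True
    then have "S = {x} \<and> y \<notin> S \<or> y \<in> S \<and> x \<notin> S" using S assms(3) by blast
    then show ?thesis using assms(3,4) sympD[OF assms(1,4)] S by blast
  next
    case False
    then obtain u v where "u \<in> S \<inter> X" "v \<in> X - S \<inter> X" "E u v"
      using connected_onD[OF assms(2), of "S \<inter> X"] by blast
    then show ?thesis by blast
  qed
qed simp

lemma connected_on_Union:
  assumes "symp E" "\<And>S. S \<in> \<F> \<Longrightarrow> connected_on E S \<and> s \<in> S" "\<F> \<noteq> {}"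
  shows "connected_on E (\<Union>\<F>)"
proof (rule ccontr)
  assume n: "\<not> connected_on E (\<Union>\<F>)"
  have ne: "\<Union>\<F> \<noteq> {}" using assms(2,3) by blast
  obtain Q where Q: "Q \<subseteq> \<Union>\<F>" "Q \<noteq> {}" "Q \<noteq> \<Union>\<F>" "\<And>u v. u \<in> Q \<Longrightarrow> v \<in> \<Union>\<F> - Q \<Longrightarrow> \<not> E u v"
    using not_connected_onE[OF n ne] by metis
  have side: "S \<subseteq> R" if S: "S \<in> \<F>" and R: "s \<in> R" "\<And>u v. u \<in> R \<Longrightarrow> v \<in> \<Union>\<F> - R \<Longrightarrow> \<not> E u v" for S R
  proof (rule ccontr)
    assume "\<not> S \<subseteq> R"
    then have "S \<inter> R \<noteq> {}" "S \<inter> R \<noteq> S" "S \<inter> R \<subseteq> S" using S R(1) assms(2) by blast+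
    then obtain u v where "u \<in> S \<inter> R" "v \<in> S - S \<inter> R" "E u v"
      using connected_onD[of E S "S \<inter> R"] assms(2)[OF S] by metis
    then show False using R(2)[of u v] S by blast
  qed
  show False
  proof (cases "s \<in> Q")
    case True
    then have "S \<subseteq> Q" if "S \<in> \<F>" for S using side[OF that True] Q(4) by blast
    then show False using Q(1,3) by blast
  next
    case False
    have "S \<subseteq> \<Union>\<F> - Q" if "S \<in> \<F>" for S
    proof (rule side[OF that])
      show "s \<in> \<Union>\<F> - Q" using False that assms(2) by blast
      show "\<not> E u v" if "u \<in> \<Union>\<F> - Q" "v \<in> \<Union>\<F> - (\<Union>\<F> - Q)" for u v
        using Q(4)[of v u] that sympD[OF assms(1)] by blast
    qed
    then show False using Q(1,2) by blast
  qed
qed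

text \<open>\<open>branching k E V Y\<close>: a complete binary tree of depth \<open>k\<close> of nested sets of cut-rank 1. The
  last condition says that the union of the two children has cut-rank 2; it rules out the trees
  that are found in stars and complete graphs.\<close>

fun branching :: "nat \<Rightarrow> ('a \<Rightarrow> 'a \<Rightarrow> bool) \<Rightarrow> 'a set \<Rightarrow> 'a set \<Rightarrow> bool" where
  "branching 0 E V Y \<longleftrightarrow> rank1_set E V Y"
| "branching (Suc k) E V Y \<longleftrightarrow> rank1_set E V Y \<and>
     (\<exists>Y1 Y2. Y1 \<subseteq> Y \<and> Y2 \<subseteq> Y \<and> Y1 \<inter> Y2 = {} \<and> branching k E V Y1 \<and> branching k E V Y2 \<and>
        \<not> rank1_set E V (Y1 \<union> Y2))"

lemma branching_SucI:
  assumes "rank1_set E V Y" "Y1 \<subseteq> Y" "Y2 \<subseteq> Y" "Y1 \<inter> Y2 = {}"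
    "branching k E V Y1" "branching k E V Y2" "\<not> rank1_set E V (Y1 \<union> Y2)"
  shows "branching (Suc k) E V Y"
  unfolding branching.simps by (intro conjI exI) (fact assms)+

lemma branching_SucE:
  assumes "branching (Suc k) E V Y"
  obtains Y1 Y2 where "rank1_set E V Y" "Y1 \<subseteq> Y" "Y2 \<subseteq> Y" "Y1 \<inter> Y2 = {}"
    "branching k E V Y1" "branching k E V Y2" "\<not> rank1_set E V (Y1 \<union> Y2)"
  using assms unfolding branching.simps by (elim conjE exE)

lemma branching_rank1: "branching k E V Y \<Longrightarrow> rank1_set E V Y"
  by (cases k) auto

lemma branching_SucD: "branching (Suc k) E V Y \<Longrightarrow> branching k E V Y"
proof (induction k arbitrary: Y)
  case (Suc k)
  obtain Y1 Y2 where Y: "rank1_set E V Y" "Y1 \<subseteq> Y" "Y2 \<subseteq> Y" "Y1 \<inter> Y2 = {}"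
      "branching (Suc k) E V Y1" "branching (Suc k) E V Y2" "\<not> rank1_set E V (Y1 \<union> Y2)"
    by (rule branching_SucE[OF Suc.prems])
  show ?case by (rule branching_SucI[OF Y(1-4) Suc.IH[OF Y(5)] Suc.IH[OF Y(6)] Y(7)])
qed simp

lemma branching_mono:
  assumes "branching m E V Y" "k \<le> m"
  shows "branching k E V Y"
  using assms(2,1) by (induction rule: inc_induct) (auto intro: branching_SucD simp del: branching.simps)

text \<open>The whole tree of nested sets survives unchanged, because its definition mentions the
  edges only through cut-rank conditions.\<close>

lemma branching_locomp_iff:
  assumes "symp E" "irreflp E" "x \<in> V"
  shows "branching k (locomp E x) V Y \<longleftrightarrow> branching k E V Y"
  by (induction k arbitrary: Y) (simp_all add: rank1_set_locomp_iff[OF assms])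

lemma rank1_set_cong:
  assumes "\<And>u v. u \<in> V \<Longrightarrow> v \<in> V \<Longrightarrow> E u v = E' u v"
  shows "rank1_set E V Y = rank1_set E' V Y"
proof -
  have "E u v = E' u v" if "Y \<subseteq> V" "u \<in> Y" "v \<in> V - Y" for u v
    using assms[of u v] that by blast
  then show ?thesis unfolding rank1_set_def by (smt (verit, ccfv_SIG))
qed

lemma branching_cong:
  assumes "\<And>u v. u \<in> V \<Longrightarrow> v \<in> V \<Longrightarrow> E u v = E' u v"
  shows "branching k E V Y = branching k E' V Y"
proof (induction k arbitrary: Y)
  case 0 then show ?case using rank1_set_cong[OF assms] by simp
next
  case (Suc k)
  have eq: "rank1_set E V = rank1_set E' V" by (intro ext rank1_set_cong assms)
  show ?case unfolding branching.simps Suc eq ..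
qed

text \<open>Every nonzero column outside \<open>Y\<close> agrees on \<open>Y\<close> with that of
  \<open>b\<close>. For subsets of \<open>Y\<close>, keeping \<open>b\<close> and deleting other
  vertices outside \<open>Y\<close> therefore neither creates nor destroys cut-rank 1.\<close>

lemma rank1_set_restrict:
  assumes Y: "rank1_set E V Y" "Z \<subseteq> Y" and V': "Y \<subseteq> V'" "V' \<subseteq> V"
    and e: "y \<in> Y" "b \<in> V'" "b \<notin> Y" "E y b"
  shows "rank1_set E V' Z = rank1_set E V Z"
proof -
  have b: "E u b" if "u \<in> Z" "v \<in> V - Y" "E u v" for u v
    using rank1_setD[OF Y(1), of u y v b] that e Y(2) V' by blast
  have b': "E u v" if "u' \<in> Z" "v \<in> V - Y" "E u' v" "E u b" "u \<in> Z" for u u' v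
    using rank1_setD[OF Y(1), of u u' b v] that e Y(2) V' by blast
  show ?thesis
  proof
    assume 1: "rank1_set E V' Z"
    have "E u v'" if "u \<in> Z" "u' \<in> Z" "v \<in> V - Z" "v' \<in> V - Z" "E u v" "E u' v'" for u u' v v'
    proof -
      have "\<exists>w. w \<in> V' - Z \<and> E u w"
      proof (cases "v \<in> Y")
        case True then show ?thesis using that(3,5) V'(1) by blast
      next
        case False
        then have "E u b" using b[OF that(1) _ that(5)] that(3) by blast
        then show ?thesis using e(2,3) Y(2) by blast
      qed
      then obtain w where w: "w \<in> V' - Z" "E u w" by blast
      show ?thesis
      proof (cases "v' \<in> Y")
        case True
        then have "v' \<in> V' - Z" using that(4) V'(1) by blast
        then show ?thesis using rank1_setD[OF 1 that(1,2) w(1) _ w(2) that(6)] by blast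
      next
        case False
        then have "E u' b" using b[OF that(2) _ that(6)] that(4) by blast
        moreover have "b \<in> V' - Z" using e Y(2) by blast
        ultimately have "E u b" using rank1_setD[OF 1 that(1,2) w(1) _ w(2)] by blast
        then show ?thesis using b'[OF that(2) _ that(6) _ that(1)] that(4) False by blast
      qed
    qed
    moreover have "\<exists>u\<in>Z. \<exists>v\<in>V - Z. E u v"
      using rank1_set_edge[OF 1] V'(2) by (metis DiffI subsetD)
    moreover have "Z \<subseteq> V" using Y(2) V' by blast
    ultimately show "rank1_set E V Z" unfolding rank1_set_def by metis
  next
    assume 1: "rank1_set E V Z"
    then obtain u v where uv: "u \<in> Z" "v \<in> V" "v \<notin> Z" "E u v" by (rule rank1_set_edge)
    have "\<exists>u \<in> Z. \<exists>v \<in> V' - Z. E u v"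
    proof (cases "v \<in> Y")
      case True then show ?thesis using uv V' by blast
    next
      case False then show ?thesis using uv b[OF uv(1) _ uv(4)] e(2,3) Y(2) by blast
    qed
    moreover have "E u v'" if "u \<in> Z" "u' \<in> Z" "v \<in> V' - Z" "v' \<in> V' - Z" "E u v" "E u' v'" for u u' v v'
      using rank1_setD[OF 1, of u u' v v'] that V'(2) by blast
    moreover have "Z \<subseteq> V'" using Y(2) V' by blast
    ultimately show "rank1_set E V' Z" unfolding rank1_set_def by metis
  qed
qed

lemma branching_restrict:
  assumes Y: "rank1_set E V Y" and V': "Y \<subseteq> V'" "V' \<subseteq> V"
    and e: "y \<in> Y" "b \<in> V'" "b \<notin> Y" "E y b" and Z: "Z \<subseteq> Y"
  shows "branching k E V' Z = branching k E V Z"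
  using Z
proof (induction k arbitrary: Z)
  case 0 then show ?case using rank1_set_restrict[OF Y _ V' e] by simp
next
  case (Suc k)
  have r: "rank1_set E V' Q = rank1_set E V Q" if "Q \<subseteq> Z" for Q
    using that Suc.prems by (intro rank1_set_restrict[OF Y _ V' e]) blast
  have b: "branching k E V' Q = branching k E V Q" if "Q \<subseteq> Z" for Q
    using that Suc.prems by (intro Suc.IH) blast
  show ?case
    unfolding branching.simps by (intro conj_cong ex_cong1 refl arg_cong[of _ _ Not] r b; blast)
qed

section \<open>Cut-rank as the length of a factorisation\<close>

lemma (in vec_space) rank_le_factorisation:
  fixes f g :: "nat \<Rightarrow> nat \<Rightarrow> 'a"
  assumes "A \<in> carrier_mat n nc"
    and "\<And>r c. r < n \<Longrightarrow> c < nc \<Longrightarrow> A $$ (r, c) = (\<Sum>i<k. f i r * g i c)"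
  shows "rank A \<le> k"
  using assms
proof (induction k arbitrary: A)
  case 0
  have "A = 0\<^sub>m n nc" using 0 by (intro eq_matI) auto
  then show ?case using rank_0I by simp
next
  case (Suc k)
  define B where "B = mat n nc (\<lambda>(r, c). \<Sum>i<k. f i r * g i c)"
  define C where "C = mat n nc (\<lambda>(r, c). f k r * g k c)"
  have BC: "B \<in> carrier_mat n nc" "C \<in> carrier_mat n nc" unfolding B_def C_def by auto
  have "A = B + C" using Suc.prems by (intro eq_matI) (auto simp: B_def C_def)
  moreover have "rank B \<le> k" by (rule Suc.IH[OF BC(1)]) (simp add: B_def)
  moreover have "rank C \<le> 1"
    by (rule rank_le_1_product_entries[OF BC(2), of "f k" "g k"]) (simp add: C_def)
  ultimately show ?case using rank_subadditive[OF BC] by simp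
qed

text \<open>All columns are combinations of a maximal independent set \<open>S\<close> of columns:
  \<open>f\<close> lists the entries of \<open>S\<close>, padded with zeros up to length
  \<open>k\<close>, and \<open>g\<close> the coefficients.\<close>

lemma (in vec_space) factorisation_rank_le:
  assumes A: "A \<in> carrier_mat n nc" and k: "rank A \<le> k"
  shows "\<exists>f g :: nat \<Rightarrow> nat \<Rightarrow> 'a. \<forall>r<n. \<forall>c<nc. A $$ (r, c) = (\<Sum>i<k. f i r * g i c)"
proof -
  have cA: "set (cols A) \<subseteq> carrier_vec n" using A cols_dim by blast
  obtain S where S: "maximal S (\<lambda>T. T \<subseteq> set (cols A) \<and> lin_indpt T)"
    using maximal_exists_superset[of "set (cols A)" "\<lambda>T. T \<subseteq> set (cols A) \<and> lin_indpt T" "{}"]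
    by (auto simp: lin_dep_def)
  then have SA: "S \<subseteq> set (cols A)" and li: "lin_indpt S" by (auto simp: maximal_def)
  have SC: "S \<subseteq> carrier_vec n" using SA cA by blast
  have finS: "finite S" using SA finite_subset by blast
  have "\<exists>a. v = lincomb a S" if v: "v \<in> set (cols A)" for v
  proof -
    have "v \<in> span S"
    proof (rule ccontr)
      assume n: "v \<notin> span S"
      then have "lin_indpt (S \<union> {v})"
        using lin_dep_iff_in_span[of S v] SC li v cA by (metis in_own_span module_vec_simps(3) subsetD)
      moreover have "v \<notin> S" using n SC in_own_span by auto
      ultimately show False using S SA v unfolding maximal_def by blast
    qed
    then show ?thesis using finite_in_span[OF finS] SC by (metis module_vec_simps(3))
  qed
  then obtain a where a: "v \<in> set (cols A) \<Longrightarrow> v = lincomb (a v) S" for v by metis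
  obtain h where h: "bij_betw h {..<card S} S" using ex_bij_betw_nat_finite[OF finS] by (auto simp: atLeast0LessThan)
  have cS: "card S \<le> k" using rank_card_indpt[OF A S] k by simp
  define f where "f i r = (if i < card S then h i $ r else 0)" for i r
  define g where "g i c = a (col A c) (h i)" for i c
  have "A $$ (r, c) = (\<Sum>i<k. f i r * g i c)" if "r < n" "c < nc" for r c
  proof -
    have col: "col A c \<in> set (cols A)" using that A by (auto simp: cols_def)
    have "A $$ (r, c) = col A c $ r" using that A by auto
    also have "\<dots> = lincomb (a (col A c)) S $ r" using a[OF col] by simp
    also have "\<dots> = (\<Sum>v\<in>S. a (col A c) v * v $ r)" using that SC by (simp add: lincomb_index)
    also have "\<dots> = (\<Sum>i<card S. a (col A c) (h i) * h i $ r)"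
      using sum.reindex_bij_betw[OF h, of "\<lambda>v. a (col A c) v * v $ r"] by simp
    also have "\<dots> = (\<Sum>i<card S. f i r * g i c)" by (simp add: f_def g_def mult.commute)
    also have "\<dots> = (\<Sum>i<k. f i r * g i c)"
      using cS by (intro sum.mono_neutral_left) (auto simp: f_def)
    finally show ?thesis .
  qed
  then show ?thesis by blast
qed

text \<open>A factorisation into an \<open>X\<close> by \<open>k\<close> and a \<open>k\<close> by
  \<open>Y\<close> matrix. Bounds in this form require no enumeration of vertices and no finiteness,
  pass to subsets at once, and can be concatenated.\<close>

definition cut_rank_le :: "('a \<Rightarrow> 'a \<Rightarrow> bool) \<Rightarrow> 'a set \<Rightarrow> 'a set \<Rightarrow> nat \<Rightarrow> bool" where
  "cut_rank_le E X Y k \<longleftrightarrow> (\<exists>f g :: nat \<Rightarrow> 'a \<Rightarrow> bit.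
     \<forall>x\<in>X. \<forall>y\<in>Y. (if E x y then 1 else 0) = (\<Sum>i<k. f i x * g i y))"

lemma adj_rank_le_iff:
  assumes "finite X" "finite Y"
  shows "adj_rank G X Y \<le> k \<longleftrightarrow> cut_rank_le (\<lambda>u v. (u, v) \<in> parcs G) X Y k"
proof -
  obtain xs where xs: "set xs = X" "distinct xs" using finite_distinct_list[OF assms(1)] by blast
  obtain ys where ys: "set ys = Y" "distinct ys" using finite_distinct_list[OF assms(2)] by blast
  let ?A = "adjacency_mat G xs ys"
  have len: "length xs = card X" using xs distinct_card by metis
  have A: "?A \<in> carrier_mat (card X) (length ys)" by (simp add: adjacency_mat_def len)
  have eq: "adj_rank G X Y = vec_space.rank (card X) ?A"
    using xs ys by (intro adj_rank_eq) (auto simp: permutations_of_set_def)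
  have entry: "?A $$ (i, j) = (if (xs ! i, ys ! j) \<in> parcs G then 1 else 0)"
    if "i < card X" "j < length ys" for i j using that by (simp add: adjacency_mat_def len)
  show ?thesis
  proof
    assume "adj_rank G X Y \<le> k"
    then obtain f g :: "nat \<Rightarrow> nat \<Rightarrow> bit" where fg:
      "\<And>r c. r < card X \<Longrightarrow> c < length ys \<Longrightarrow> ?A $$ (r, c) = (\<Sum>i<k. f i r * g i c)"
      using vec_space.factorisation_rank_le[OF A] eq by metis
    have bx: "bij_betw ((!) xs) {..<card X} X" by (rule bij_betw_nth) (simp_all add: xs len)
    have by': "bij_betw ((!) ys) {..<length ys} Y" by (rule bij_betw_nth) (simp_all add: ys)
    let ?ix = "inv_into {..<card X} ((!) xs)" and ?iy = "inv_into {..<length ys} ((!) ys)"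
    have ix: "?ix x < card X" "xs ! ?ix x = x" if "x \<in> X" for x
      using bij_betw_inv_into[OF bx] bij_betw_inv_into_right[OF bx] that by (auto simp: bij_betw_def)
    have iy: "?iy y < length ys" "ys ! ?iy y = y" if "y \<in> Y" for y
      using bij_betw_inv_into[OF by'] bij_betw_inv_into_right[OF by'] that by (auto simp: bij_betw_def)
    have "(if (x, y) \<in> parcs G then 1 else 0) = (\<Sum>i<k. f i (?ix x) * g i (?iy y))"
      if "x \<in> X" "y \<in> Y" for x y
      using fg[OF ix(1)[OF that(1)] iy(1)[OF that(2)]] entry[OF ix(1)[OF that(1)] iy(1)[OF that(2)]]
        ix(2)[OF that(1)] iy(2)[OF that(2)] by simp
    then show "cut_rank_le (\<lambda>u v. (u, v) \<in> parcs G) X Y k"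
      unfolding cut_rank_le_def
      by (intro exI[of _ "\<lambda>i x. f i (?ix x)"] exI[of _ "\<lambda>i y. g i (?iy y)"]) blast
  next
    assume "cut_rank_le (\<lambda>u v. (u, v) \<in> parcs G) X Y k"
    then obtain f g :: "nat \<Rightarrow> 'a \<Rightarrow> bit" where fg:
      "\<And>x y. x \<in> X \<Longrightarrow> y \<in> Y \<Longrightarrow> (if (x, y) \<in> parcs G then 1 else 0) = (\<Sum>i<k. f i x * g i y)"
      unfolding cut_rank_le_def by blast
    have "vec_space.rank (card X) ?A \<le> k"
    proof (rule vec_space.rank_le_factorisation[OF A, where f = "\<lambda>i r. f i (xs ! r)" and g = "\<lambda>i c. g i (ys ! c)"])
      fix r c assume rc: "r < card X" "c < length ys"
      then have "xs ! r \<in> X" "ys ! c \<in> Y" using xs ys len by auto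
      then show "?A $$ (r, c) = (\<Sum>i<k. f i (xs ! r) * g i (ys ! c))" using fg entry[OF rc] by simp
    qed
    then show "adj_rank G X Y \<le> k" using eq by simp
  qed
qed

section \<open>Rules for bounding cut-ranks\<close>

lemma cut_rank_leI:
  fixes f g :: "nat \<Rightarrow> 'a \<Rightarrow> bit"
  assumes "\<And>x y. x \<in> X \<Longrightarrow> y \<in> Y \<Longrightarrow> (if E x y then 1 else 0) = (\<Sum>i<k. f i x * g i y)"
  shows "cut_rank_le E X Y k"
  unfolding cut_rank_le_def using assms by (intro exI[of _ f] exI[of _ g]) blast

lemma cut_rank_leE:
  assumes "cut_rank_le E X Y k"
  obtains f g :: "nat \<Rightarrow> 'a \<Rightarrow> bit"
  where "\<forall>x\<in>X. \<forall>y\<in>Y. (if E x y then 1 else 0) = (\<Sum>i<k. f i x * g i y)"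
  using assms unfolding cut_rank_le_def by (elim exE)

lemma cut_rank_le_zero: "(\<And>x y. x \<in> X \<Longrightarrow> y \<in> Y \<Longrightarrow> \<not> E x y) \<Longrightarrow> cut_rank_le E X Y 0"
  by (rule cut_rank_leI) auto

lemma cut_rank_le_single: "cut_rank_le E {x} Y 1"
  by (rule cut_rank_leI[where f = "\<lambda>_ _. 1" and g = "\<lambda>_ y. if E x y then 1 else 0"]) auto

lemma cut_rank_le_subset:
  assumes "cut_rank_le E X Y k" "X' \<subseteq> X" "Y' \<subseteq> Y"
  shows "cut_rank_le E X' Y' k"
proof -
  obtain f g :: "nat \<Rightarrow> 'a \<Rightarrow> bit"
    where "\<forall>x\<in>X. \<forall>y\<in>Y. (if E x y then 1 else 0) = (\<Sum>i<k. f i x * g i y)"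
    using assms(1) by (rule cut_rank_leE)
  then show ?thesis using assms(2,3) by (intro cut_rank_leI[where f = f and g = g]) blast
qed

lemma cut_rank_le_flip:
  assumes "symp E" "cut_rank_le E X Y k"
  shows "cut_rank_le E Y X k"
proof -
  obtain f g :: "nat \<Rightarrow> 'a \<Rightarrow> bit"
    where "\<forall>x\<in>X. \<forall>y\<in>Y. (if E x y then 1 else 0) = (\<Sum>i<k. f i x * g i y)"
    using assms(2) by (rule cut_rank_leE)
  then have fg: "\<And>x y. x \<in> X \<Longrightarrow> y \<in> Y \<Longrightarrow> (if E x y then 1 else 0) = (\<Sum>i<k. f i x * g i y)"
    by blast
  show ?thesis
  proof (rule cut_rank_leI[where f = g and g = f])
    fix y x assume yx: "y \<in> Y" "x \<in> X"
    have "(if E y x then 1 else 0 :: bit) = (if E x y then 1 else 0)"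
      using sympD[OF assms(1), of x y] sympD[OF assms(1), of y x] by (cases "E x y"; cases "E y x") simp_all
    also have "\<dots> = (\<Sum>i<k. f i x * g i y)" by (rule fg[OF yx(2,1)])
    also have "\<dots> = (\<Sum>i<k. g i y * f i x)" by (simp only: mult.commute)
    finally show "(if E y x then 1 else 0) = (\<Sum>i<k. g i y * f i x)" .
  qed
qed

lemma sum_lessThan_add:
  fixes h :: "nat \<Rightarrow> 'b::comm_monoid_add"
  shows "(\<Sum>i<k + m. h i) = (\<Sum>i<k. h i) + (\<Sum>i<m. h (k + i))"
  by (induction m) (simp_all add: add.assoc)

lemma cut_rank_le_Un_left:
  assumes "cut_rank_le E X Z k" "cut_rank_le E Y Z m"
  shows "cut_rank_le E (X \<union> Y) Z (k + m)"
proof -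
  obtain f g :: "nat \<Rightarrow> 'a \<Rightarrow> bit"
    where "\<forall>x\<in>X. \<forall>y\<in>Z. (if E x y then 1 else 0) = (\<Sum>i<k. f i x * g i y)"
    using assms(1) by (rule cut_rank_leE)
  then have fg: "\<And>x y. x \<in> X \<Longrightarrow> y \<in> Z \<Longrightarrow> (if E x y then 1 else 0) = (\<Sum>i<k. f i x * g i y)"
    by blast
  obtain f' g' :: "nat \<Rightarrow> 'a \<Rightarrow> bit"
    where "\<forall>x\<in>Y. \<forall>y\<in>Z. (if E x y then 1 else 0) = (\<Sum>i<m. f' i x * g' i y)"
    using assms(2) by (rule cut_rank_leE)
  then have fg': "\<And>x y. x \<in> Y \<Longrightarrow> y \<in> Z \<Longrightarrow> (if E x y then 1 else 0) = (\<Sum>i<m. f' i x * g' i y)"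
    by blast
  \<comment> \<open>A vertex of \<open>X \<inter> Y\<close> is treated as one of \<open>X\<close>:
    its coordinates in the second block are 0.\<close>
  define F where "F i x = (if i < k then if x \<in> X then f i x else 0 else if x \<in> X then 0 else f' (i - k) x)" for i x
  define G where "G i y = (if i < k then g i y else g' (i - k) y)" for i y
  have split: "(\<Sum>i<k + m. F i x * G i y) =
      (\<Sum>i<k. if x \<in> X then f i x * g i y else 0) + (\<Sum>i<m. if x \<in> X then 0 else f' i x * g' i y)" for x y
  proof -
    have "(\<Sum>i<k + m. F i x * G i y) = (\<Sum>i<k. F i x * G i y) + (\<Sum>i<m. F (k + i) x * G (k + i) y)"
      by (rule sum_lessThan_add)
    also have "(\<Sum>i<k. F i x * G i y) = (\<Sum>i<k. if x \<in> X then f i x * g i y else 0)"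
      by (rule sum.cong) (auto simp: F_def G_def)
    also have "(\<Sum>i<m. F (k + i) x * G (k + i) y) = (\<Sum>i<m. if x \<in> X then 0 else f' i x * g' i y)"
      by (rule sum.cong) (auto simp: F_def G_def)
    finally show ?thesis .
  qed
  show ?thesis
  proof (rule cut_rank_leI[where f = F and g = G])
    fix x y assume "x \<in> X \<union> Y" "y \<in> Z"
    then show "(if E x y then 1 else 0) = (\<Sum>i<k + m. F i x * G i y)"
      unfolding split using fg[of x y] fg'[of x y]
      by (cases "x \<in> X") (simp_all only: if_True if_False sum.neutral_const add_0_right add_0_left Un_iff simp_thms)
  qed
qed

lemma cut_rank_le_Un_right:
  assumes "symp E" "cut_rank_le E X Y k" "cut_rank_le E X Z m"
  shows "cut_rank_le E X (Y \<union> Z) (k + m)"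
  using cut_rank_le_flip[OF assms(1) cut_rank_le_Un_left[OF assms(2,3)[THEN cut_rank_le_flip[OF assms(1)]]]] .

lemma cut_rank_le_mono:
  assumes "cut_rank_le E X Y k" "k \<le> m"
  shows "cut_rank_le E X Y m"
proof -
  have "cut_rank_le E {} Y j" for j by (rule cut_rank_leI) auto
  from cut_rank_le_Un_left[OF assms(1) this[of "m - k"]] show ?thesis using assms(2) by simp
qed

text \<open>Repeating rows and columns along \<open>\<phi>\<close> and replacing those where
  \<open>\<alpha>\<close> fails by zero does not increase the rank. Cuts of a graph are compared in
  this way with cuts of a contracted graph.\<close>

lemma cut_rank_le_pullback:
  assumes "cut_rank_le E X' Y' k" "\<And>x. x \<in> X \<Longrightarrow> \<phi> x \<in> X'" "\<And>y. y \<in> Y \<Longrightarrow> \<phi> y \<in> Y'"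
    and eq: "\<And>x y. x \<in> X \<Longrightarrow> y \<in> Y \<Longrightarrow> E x y \<longleftrightarrow> \<alpha> x \<and> \<alpha> y \<and> E (\<phi> x) (\<phi> y)"
  shows "cut_rank_le E X Y k"
proof -
  obtain f g :: "nat \<Rightarrow> 'a \<Rightarrow> bit"
    where "\<forall>x\<in>X'. \<forall>y\<in>Y'. (if E x y then 1 else 0) = (\<Sum>i<k. f i x * g i y)"
    using assms(1) by (rule cut_rank_leE)
  then have fg: "\<And>x y. x \<in> X' \<Longrightarrow> y \<in> Y' \<Longrightarrow> (if E x y then 1 else 0) = (\<Sum>i<k. f i x * g i y)"
    by blast
  show ?thesis
  proof (rule cut_rank_leI[where f = "\<lambda>i x. if \<alpha> x then f i (\<phi> x) else 0" and g = "\<lambda>i y. if \<alpha> y then g i (\<phi> y) else 0"])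
    fix x y assume xy: "x \<in> X" "y \<in> Y"
    have "(if E (\<phi> x) (\<phi> y) then 1 else 0) = (\<Sum>i<k. f i (\<phi> x) * g i (\<phi> y))"
      using fg assms(2,3) xy by blast
    then show "(if E x y then 1 else 0) =
        (\<Sum>i<k. (if \<alpha> x then f i (\<phi> x) else 0) * (if \<alpha> y then g i (\<phi> y) else 0))"
      using eq[OF xy] by (cases "\<alpha> x"; cases "\<alpha> y")
        (simp_all only: if_True if_False sum.neutral_const mult_zero_left mult_zero_right simp_thms)
  qed
qed

text \<open>The cuts of a layout of \<open>Y\<close> are taken in the whole graph on \<open>V\<close>, so that layouts of
  nested sets can be prolonged without loss.\<close>

definition has_layout :: "('a \<Rightarrow> 'a \<Rightarrow> bool) \<Rightarrow> 'a set \<Rightarrow> 'a set \<Rightarrow> nat \<Rightarrow> bool" where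
  "has_layout E V Y w \<longleftrightarrow> (\<exists>xs. distinct xs \<and> set xs = Y \<and>
     (\<forall>i\<le>length xs. cut_rank_le E (set (take i xs)) (V - set (take i xs)) w))"

definition prime_on :: "('a \<Rightarrow> 'a \<Rightarrow> bool) \<Rightarrow> 'a set \<Rightarrow> bool" where
  "prime_on E W \<longleftrightarrow> connected_on E W \<and>
     \<not> (\<exists>S\<subseteq>W. card S \<ge> 2 \<and> card (W - S) \<ge> 2 \<and> rank1_set E W S)"

lemma has_layout_mono: "has_layout E V Y w \<Longrightarrow> w \<le> w' \<Longrightarrow> has_layout E V Y w'"
  unfolding has_layout_def using cut_rank_le_mono by metis

lemma has_layout_single: "has_layout E V {x} 1"
proof -
  have "cut_rank_le E (set (take i [x])) (V - set (take i [x])) 1" for i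
  proof (cases i)
    case 0
    have "cut_rank_le E {} V 0" by (rule cut_rank_le_zero) simp
    then show ?thesis using 0 cut_rank_le_mono[of E "{}" V 0 1] by simp
  next
    case (Suc j)
    then show ?thesis using cut_rank_le_single by simp
  qed
  then show ?thesis unfolding has_layout_def by (intro exI[of _ "[x]"]) simp
qed

text \<open>Costs do not accumulate: the width of an appended block is added to the rank
  \<open>q\<close> of the cut in front of it, not to the width of the earlier layout.\<close>

lemma has_layout_append:
  assumes sym: "symp E"
    and xs: "\<And>i. i \<le> length xs \<Longrightarrow> cut_rank_le E (set (take i xs)) (V - set (take i xs)) w'"
    and ys: "\<And>i. i \<le> length ys \<Longrightarrow> cut_rank_le E (set (take i ys)) (V - set (take i ys)) w"
    and A: "cut_rank_le E (set xs) (V - set xs) q" and w': "q + w \<le> w'"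
    and i: "i \<le> length (xs @ ys)"
  shows "cut_rank_le E (set (take i (xs @ ys))) (V - set (take i (xs @ ys))) w'"
proof (cases "i \<le> length xs")
  case True
  then show ?thesis using xs by simp
next
  case False
  define P where "P = set (take (i - length xs) ys)"
  have eq: "set (take i (xs @ ys)) = set xs \<union> P" using False by (simp add: P_def)
  have "cut_rank_le E P (V - P) w" unfolding P_def using i by (intro ys) simp
  then have "cut_rank_le E P (V - (set xs \<union> P)) w" by (rule cut_rank_le_subset) auto
  moreover have "cut_rank_le E (set xs) (V - (set xs \<union> P)) q" by (rule cut_rank_le_subset[OF A]) auto
  ultimately show ?thesis
    unfolding eq using cut_rank_le_Un_left cut_rank_le_mono w' by metis
qed

lemma rank1_set_Union:
  assumes "symp E" "connected_on E V" "finite \<F>" "\<F> \<noteq> {}"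
    "\<And>Z. Z \<in> \<F> \<Longrightarrow> rank1_set E V Z \<and> v \<in> Z \<and> Z \<subseteq> Y" "Y \<noteq> V" "Y \<subseteq> V"
  shows "rank1_set E V (\<Union>\<F>)"
  using assms(3-5)
proof (induction \<F> rule: finite_ne_induct)
  case (insert Z \<F>)
  have "rank1_set E V (\<Union>\<F>)" using insert by blast
  moreover have "rank1_set E V Z" using insert.prems by blast
  moreover have "Z \<inter> \<Union>\<F> \<noteq> {}" using insert.hyps insert.prems by blast
  moreover have "Z \<union> \<Union>\<F> \<noteq> V"
  proof -
    have "Z \<union> \<Union>\<F> \<subseteq> Y" using insert.prems by blast
    then show ?thesis using assms(6,7) by blast
  qed
  ultimately show ?case using rank1_set_Un[OF assms(1,2)] by simp
qed simp

section \<open>Layouts of graphs without branching\<close>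

text \<open>If no set of cut-rank 1 lies strictly between \<open>X\<close> and \<open>Y\<close>, then contracting \<open>X\<close>, \<open>V - Y\<close> and the
  maximal subsets of \<open>Y - X\<close> of cut-rank 1 (which are disjoint by \<open>rank1_set_Un\<close>) to single
  vertices gives a prime induced subgraph: a split of it would lift to a set of cut-rank 1 that
  is forbidden by the choice of the parts.\<close>

lemma layout_layer:
  assumes sym: "symp E" and fin: "finite V" and con: "connected_on E V"
    and primes: "\<forall>W\<subseteq>V. prime_on E W \<longrightarrow> has_layout E W W p"
    and rX: "rank1_set E V X" and rY: "rank1_set E V Y" and XY: "X \<subseteq> Y"
    and tight: "\<And>U. rank1_set E V U \<Longrightarrow> X \<subseteq> U \<Longrightarrow> U \<subseteq> Y \<Longrightarrow> U = X \<or> U = Y"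
    and limbs: "\<And>Z. rank1_set E V Z \<Longrightarrow> Z \<subseteq> Y - X \<Longrightarrow> has_layout E V Z w"
    and lX: "has_layout E V X w'" and w': "w + p + 2 \<le> w'"
  shows "has_layout E V Y w'"
proof -
  have YV: "Y \<subseteq> V" "Y \<noteq> V" using rank1_set_subset[OF rY] rank1_set_nonempty[OF rY] by auto
  define M where "M v = \<Union>{Z. rank1_set E V Z \<and> v \<in> Z \<and> Z \<subseteq> Y - X}" for v
  have vM: "v \<in> M v" "rank1_set E V (M v)" "M v \<subseteq> Y - X" if v: "v \<in> Y - X" for v
  proof -
    have "V \<noteq> {v}" using v YV by blast
    then have "rank1_set E V {v}" using rank1_set_singleton[OF sym con, of v] v YV by blast
    then have 1: "{v} \<in> {Z. rank1_set E V Z \<and> v \<in> Z \<and> Z \<subseteq> Y - X}" using v by blast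
    then show "v \<in> M v" unfolding M_def by blast
    have "{Z. rank1_set E V Z \<and> v \<in> Z \<and> Z \<subseteq> Y - X} \<subseteq> Pow V" using rank1_set_subset[of E V] by blast
    then have f: "finite {Z. rank1_set E V Z \<and> v \<in> Z \<and> Z \<subseteq> Y - X}" using fin finite_subset by blast
    show "rank1_set E V (M v)"
      unfolding M_def using 1 by (intro rank1_set_Union[OF sym con f _ _ YV(2,1)]) blast+
    show "M v \<subseteq> Y - X" unfolding M_def by blast
  qed
  have Mmax: "Z \<subseteq> M v" if "rank1_set E V Z" "Z \<subseteq> Y - X" "v \<in> Y - X" "Z \<inter> M v \<noteq> {}" for Z v
  proof -
    have "Z \<union> M v \<noteq> V" using that(2) vM(3)[OF that(3)] YV by blast
    then have "rank1_set E V (Z \<union> M v)" using rank1_set_Un[OF sym con that(1) vM(2)[OF that(3)] that(4)] by blast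
    then have "Z \<union> M v \<in> {Z. rank1_set E V Z \<and> v \<in> Z \<and> Z \<subseteq> Y - X}"
      using that(2) vM(1,3)[OF that(3)] by blast
    then show ?thesis unfolding M_def[of v] by blast
  qed
  have Meq: "M u = M v" if "v \<in> Y - X" "u \<in> M v" for u v
  proof -
    have u: "u \<in> Y - X" using vM(3)[OF that(1)] that(2) by blast
    have "M v \<subseteq> M u" using Mmax[OF vM(2,3)[OF that(1)] u] vM(1)[OF u] that(2) by blast
    moreover have "M u \<subseteq> M v" using Mmax[OF vM(2,3)[OF u] that(1)] vM(1)[OF u] that(2) by blast
    ultimately show ?thesis by blast
  qed
  define part where "part v = (if v \<in> X then X else if v \<in> Y then M v else V - Y)" for v
  have part: "rank1_set E V (part v)" "v \<in> part v" if "v \<in> V" for v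
    using that rX rank1_set_complement[OF sym rY] vM[of v] unfolding part_def by auto
  have part_eq: "part u = part v" if "v \<in> V" "u \<in> part v" for u v
  proof (cases "v \<in> X \<or> v \<notin> Y")
    case True
    then show ?thesis using that XY unfolding part_def by (auto split: if_splits)
  next
    case False
    then have "v \<in> Y - X" by blast
    then have "u \<in> M v" "u \<in> Y - X" "M u = M v" using that False vM(3)[of v] Meq[of v u] unfolding part_def by auto
    then show ?thesis using False unfolding part_def by auto
  qed
  \<comment> \<open>\<open>\<beta>\<close> marks the vertices with a neighbour outside their part,
    and \<open>\<phi>\<close> picks one such vertex in each part. By the rank condition all marked
    vertices of a part have the same neighbours outside it.\<close>
  define \<beta> where "\<beta> u \<longleftrightarrow> (\<exists>w\<in>V - part u. E u w)" for u
  define \<phi> where "\<phi> v = (SOME u. u \<in> part v \<and> (\<exists>w\<in>V - part v. E u w))" for v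
  have \<phi>: "\<phi> v \<in> part v \<and> (\<exists>w\<in>V - part v. E (\<phi> v) w)" if v: "v \<in> V" for v
  proof -
    obtain u w where "u \<in> part v" "w \<in> V" "w \<notin> part v" "E u w" using part(1)[OF v] by (rule rank1_set_edge)
    then have "\<exists>u. u \<in> part v \<and> (\<exists>w\<in>V - part v. E u w)" by blast
    then show ?thesis unfolding \<phi>_def by (rule someI_ex)
  qed
  have \<phi>V: "\<phi> v \<in> V" "part (\<phi> v) = part v" "\<beta> (\<phi> v)" if "v \<in> V" for v
  proof -
    show "\<phi> v \<in> V" using \<phi>[OF that] rank1_set_subset[OF part(1)[OF that]] by blast
    show p: "part (\<phi> v) = part v" using \<phi>[OF that] part_eq[OF that] by blast
    show "\<beta> (\<phi> v)" unfolding \<beta>_def p using \<phi>[OF that] by blast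
  qed
  have \<phi>_cong: "part u = part v \<Longrightarrow> \<phi> u = \<phi> v" for u v unfolding \<phi>_def by simp
  have \<phi>\<phi>: "\<phi> (\<phi> v) = \<phi> v" if "v \<in> V" for v using \<phi>_cong \<phi>V(2)[OF that] .
  have twin: "E u w \<longleftrightarrow> E (\<phi> u) w" if u: "u \<in> V" "\<beta> u" "w \<in> V - part u" for u w
  proof -
    obtain x where x: "x \<in> V - part u" "E u x" using u(2) unfolding \<beta>_def by blast
    obtain y where y: "y \<in> V - part u" "E (\<phi> u) y" using \<phi>[OF u(1)] by blast
    have m: "u \<in> part u" "\<phi> u \<in> part u" using part(2)[OF u(1)] \<phi>[OF u(1)] by blast+
    show ?thesis
      using rank1_setD[OF part(1)[OF u(1)] m x(1) u(3) x(2)]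
        rank1_setD[OF part(1)[OF u(1)] m(2,1) y(1) u(3) y(2)] by blast
  qed
  have notin: "v \<in> V - part u" if "u \<in> V" "v \<in> V" "part u \<noteq> part v" for u v
    using part_eq[OF that(1)] that by blast
  \<comment> \<open>Between different parts the graph is thus a blow-up of the graph on the chosen
    vertices. This is the equivalence that \<open>cut_rank_le_pullback\<close> asks for.\<close>
  have adj: "E u v \<longleftrightarrow> \<beta> u \<and> \<beta> v \<and> E (\<phi> u) (\<phi> v)" if uv: "u \<in> V" "v \<in> V" "part u \<noteq> part v" for u v
  proof -
    have n: "v \<in> V - part u" "u \<in> V - part v" using notin[of u v] notin[of v u] uv by auto
    have n': "\<phi> u \<in> V - part v" using notin[of v "\<phi> u"] \<phi>V[OF uv(1)] uv by auto
    have b: "\<beta> u" "\<beta> v" if "E u v" using n that sympD[OF sym that] unfolding \<beta>_def by blast+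
    show ?thesis
    proof (cases "\<beta> u \<and> \<beta> v")
      case True
      have "E u v \<longleftrightarrow> E (\<phi> u) v" using twin[OF uv(1) _ n(1)] True by blast
      also have "\<dots> \<longleftrightarrow> E v (\<phi> u)" using sympD[OF sym] by blast
      also have "\<dots> \<longleftrightarrow> E (\<phi> v) (\<phi> u)" using twin[OF uv(2) _ n'] True by blast
      also have "\<dots> \<longleftrightarrow> E (\<phi> u) (\<phi> v)" using sympD[OF sym] by blast
      finally show ?thesis using True by blast
    next
      case False
      then show ?thesis using b by blast
    qed
  qed
  define W where "W = \<phi> ` V"
  have WV: "W \<subseteq> V" unfolding W_def using \<phi>V(1) by blast
  have W: "\<phi> v = v" if "v \<in> W" for v using that \<phi>\<phi> unfolding W_def by auto
  obtain x0 o0 where x0: "x0 \<in> X" "o0 \<in> V - Y" using rank1_set_nonempty[OF rX] YV by blast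
  define a where "a = \<phi> o0"
  define b where "b = \<phi> x0"
  have x0V: "x0 \<in> V" using x0 XY YV by blast
  have o0: "o0 \<notin> X" "part o0 = V - Y" "part x0 = X" using x0 XY unfolding part_def by auto
  have ab: "a \<in> W" "b \<in> W" "a \<in> V - Y" "b \<in> X"
    using x0 x0V \<phi>[of o0] \<phi>[of x0] o0 unfolding a_def b_def W_def by auto
  have \<phi>a: "\<phi> v = a" if "v \<in> V - Y" for v
    using that x0 XY unfolding a_def by (intro \<phi>_cong) (auto simp: part_def)
  have \<phi>b: "\<phi> v = b" if "v \<in> X" for v
    using that x0 unfolding b_def by (intro \<phi>_cong) (auto simp: part_def)
  have lift_edge: "E (\<phi> u) (\<phi> v)" if "u \<in> V" "v \<in> V" "\<phi> u \<noteq> \<phi> v" "E u v" for u v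
    using adj[of u v] that \<phi>_cong[of u v] by blast
  have "connected_on E W"
    unfolding connected_on_def
  proof (intro conjI allI impI)
    show "W \<noteq> {}" using ab by blast
    fix S assume S: "S \<subseteq> W \<and> S \<noteq> {} \<and> S \<noteq> W"
    define L where "L = {v \<in> V. \<phi> v \<in> S}"
    have lift: "s \<in> L \<longleftrightarrow> s \<in> S" if "s \<in> W" for s
      using W[OF that] that WV unfolding L_def by auto
    obtain s t where st: "s \<in> S" "t \<in> W" "t \<notin> S" using S by blast
    have "s \<in> L" "t \<notin> L" "t \<in> V" using lift[of s] lift[of t] st S WV by blast+
    then have "L \<subseteq> V" "L \<noteq> {}" "L \<noteq> V" unfolding L_def by blast+
    then obtain u v where uv: "u \<in> L" "v \<in> V - L" "E u v" using connected_onD[OF con] by metis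
    then have "\<phi> u \<in> S" "\<phi> v \<in> W - S" unfolding L_def W_def by auto
    moreover have "E (\<phi> u) (\<phi> v)"
      by (rule lift_edge) (use uv in \<open>auto simp: L_def\<close>)
    ultimately show "\<exists>u\<in>S. \<exists>v\<in>W - S. E u v" by blast
  qed
  \<comment> \<open>The sides of a split may be exchanged, so it is enough to refute those whose
    side \<open>S\<close> avoids \<open>a\<close>. The set \<open>L\<close> of all vertices
    represented in \<open>S\<close> then has cut-rank 1 and lies in \<open>Y\<close>.\<close>
  moreover have "False" if S: "S \<subseteq> W" "card S \<ge> 2" "card (W - S) \<ge> 2" "rank1_set E W S" "a \<notin> S" for S
  proof -
    define L where "L = {v \<in> V. \<phi> v \<in> S}"
    have "rank1_set E V L"
      unfolding rank1_set_def
    proof (intro conjI ballI impI)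
      show "L \<subseteq> V" unfolding L_def by blast
      obtain u v where "u \<in> S" "v \<in> W" "v \<notin> S" "E u v" using S(4) by (rule rank1_set_edge)
      then show "\<exists>u\<in>L. \<exists>v\<in>V - L. E u v" unfolding L_def using W S(1) WV by force
      fix u u' v v' assume uv: "u \<in> L" "u' \<in> L" "v \<in> V - L" "v' \<in> V - L" "E u v" "E u' v'"
      have m: "u \<in> V" "u' \<in> V" "v \<in> V" "v' \<in> V" "\<phi> u \<in> S" "\<phi> u' \<in> S" "\<phi> v \<in> W - S" "\<phi> v' \<in> W - S"
        using uv(1-4) unfolding L_def W_def by auto
      have ne: "\<phi> u \<noteq> \<phi> v" "\<phi> u' \<noteq> \<phi> v'" "\<phi> u \<noteq> \<phi> v'"
        using DiffD2[OF m(7)] DiffD2[OF m(8)] m(5,6) by metis+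
      have e: "\<beta> u \<and> E (\<phi> u) (\<phi> v)" "\<beta> v' \<and> E (\<phi> u') (\<phi> v')"
        using adj[of u v] adj[of u' v'] m uv(5,6) ne \<phi>_cong by blast+
      have "E (\<phi> u) (\<phi> v')" using rank1_setD[OF S(4) m(5-8)] e by blast
      then show "E u v'" using adj[of u v'] m e ne \<phi>_cong by blast
    qed
    have LY: "L \<subseteq> Y" using \<phi>a S(5) unfolding L_def by blast
    have pick: "\<exists>s\<in>Q. s \<noteq> x" if "card Q \<ge> 2" for Q :: "'a set" and x
    proof (rule ccontr)
      assume "\<not> ?thesis"
      then have "Q \<subseteq> {x}" by blast
      then have "card Q \<le> 1" using card_mono[of "{x}" Q] by simp
      then show False using that by simp
    qed
    have SL: "s \<in> L" if "s \<in> S" for s using that W S(1) WV unfolding L_def by force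
    \<comment> \<open>If \<open>b\<close> is in \<open>S\<close>, then \<open>L\<close> contains
      \<open>X\<close>, and an element of \<open>S\<close> other than \<open>b\<close> and one of
      \<open>W - S\<close> other than \<open>a\<close> place \<open>L\<close> strictly between
      \<open>X\<close> and \<open>Y\<close>. If not, \<open>L\<close> lies in a single part,
      although two parts are represented in \<open>S\<close>.\<close>
    show False
    proof (cases "b \<in> S")
      case True
      have "X \<subseteq> L" using \<phi>b True XY YV unfolding L_def by blast
      moreover obtain s where "s \<in> S" "s \<noteq> b" using pick[OF S(2)] by blast
      then have "s \<in> L" "s \<notin> X" using SL \<phi>b W S(1) by force+
      moreover obtain t where "t \<in> W - S" "t \<noteq> a" using pick[OF S(3)] by blast
      then have "t \<notin> L" "t \<in> Y" using \<phi>a W WV unfolding L_def by force+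
      ultimately show False using tight[OF \<open>rank1_set E V L\<close> _ LY] by blast
    next
      case False
      have LYX: "L \<subseteq> Y - X" using LY \<phi>b False unfolding L_def by blast
      obtain s where s: "s \<in> S" using pick[OF S(2)] by blast
      obtain t where t: "t \<in> S" "t \<noteq> s" using pick[OF S(2)] by blast
      have sYX: "s \<in> Y - X" using SL[OF s] LYX by blast
      have "L \<subseteq> M s" using Mmax[OF \<open>rank1_set E V L\<close> LYX sYX] SL[OF s] vM(1)[OF sYX] by blast
      then have "t \<in> M s" using SL t by blast
      then have "t \<in> part s" using sYX unfolding part_def by auto
      then have "\<phi> t = \<phi> s" using part_eq[of s t] \<phi>_cong sYX YV by blast
      moreover have "\<phi> t = t" "\<phi> s = s" using W s t(1) S(1) by blast+
      ultimately show False using t(2) by simp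
    qed
  qed
  then have "\<not> (\<exists>S\<subseteq>W. card S \<ge> 2 \<and> card (W - S) \<ge> 2 \<and> rank1_set E W S)"
    using rank1_set_complement[OF sym, of W] by (metis DiffD2 Diff_subset double_diff subset_refl)
  ultimately have "prime_on E W" unfolding prime_on_def by blast
  then obtain zs where zs: "distinct zs" "set zs = W"
      "\<And>i. i \<le> length zs \<Longrightarrow> cut_rank_le E (set (take i zs)) (W - set (take i zs)) p"
    using primes WV unfolding has_layout_def by blast
  obtain xs where xs: "distinct xs" "set xs = X"
      "\<And>i. i \<le> length xs \<Longrightarrow> cut_rank_le E (set (take i xs)) (V - set (take i xs)) w'"
    using lX unfolding has_layout_def by blast
  have "\<exists>l. distinct l \<and> set l = part z \<and> (\<forall>i\<le>length l. cut_rank_le E (set (take i l)) (V - set (take i l)) w)"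
    if "z \<in> Y - X" for z
    using limbs[OF vM(2,3)[OF that]] that unfolding has_layout_def part_def by auto
  then obtain l0 where l0: "\<And>z. z \<in> Y - X \<Longrightarrow> distinct (l0 z) \<and> set (l0 z) = part z \<and>
      (\<forall>i\<le>length (l0 z). cut_rank_le E (set (take i (l0 z))) (V - set (take i (l0 z))) w)" by metis
  define l where "l z = (if z \<in> Y - X then l0 z else [])" for z
  have empty: "cut_rank_le E {} Q k" for Q k by (rule cut_rank_leI) auto
  have l_cut: "cut_rank_le E (set (take i (l z))) (V - set (take i (l z))) w" if "i \<le> length (l z)" for i z
    using that l0[of z] empty unfolding l_def by (cases "z \<in> Y - X") auto
  have l_set: "set (l z) = (if z \<in> Y - X then part z else {})" for z
    using l0[of z] unfolding l_def by auto
  \<comment> \<open>The layout of the prime graph with \<open>b\<close> moved to the front and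
    \<open>a\<close> to the end; each move costs 1, whence \<open>p + 2\<close>. In
    \<open>L n\<close>, the vertex \<open>b\<close> is replaced by the layout \<open>xs\<close> of
    \<open>X\<close> and every other vertex by a layout of its part, while \<open>l\<close> is empty
    at \<open>a\<close> and \<open>b\<close>.\<close>
  define S where "S n = insert b (set (take n zs) - {a})" for n
  define L where "L n = xs @ concat (map l (take n zs))" for n
  have YXW: "z \<in> Y - X \<longleftrightarrow> z \<noteq> a \<and> z \<noteq> b" if "z \<in> W" for z
    using that ab XY \<phi>a[of z] \<phi>b[of z] W[OF that] WV by auto
  have setL: "set (L n) = {v \<in> V. \<phi> v \<in> S n}" for n
  proof (rule subset_antisym; rule subsetI)
    fix v assume "v \<in> set (L n)"
    then consider "v \<in> X" | z where "z \<in> set (take n zs)" "z \<in> Y - X" "v \<in> part z"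
      unfolding L_def using xs(2) l_set by (auto split: if_splits)
    then show "v \<in> {v \<in> V. \<phi> v \<in> S n}"
    proof cases
      case 1
      then show ?thesis using \<phi>b XY YV unfolding S_def by blast
    next
      case 2
      have zW: "z \<in> W" using 2(1) zs(2) set_take_subset by fastforce
      then have "\<phi> v = z" using part_eq[of z v] \<phi>_cong[of v z] 2(3) WV W by auto
      moreover have "v \<in> V" using 2(3) zW WV rank1_set_subset[OF part(1)[of z]] by blast
      ultimately show ?thesis using 2(1) YXW[OF zW] 2(2) unfolding S_def by blast
    qed
  next
    fix v assume v: "v \<in> {v \<in> V. \<phi> v \<in> S n}"
    show "v \<in> set (L n)"
    proof (cases "v \<in> X")
      case True
      then show ?thesis unfolding L_def using xs(2) by simp
    next
      case False
      have "\<phi> v \<in> part v" using \<phi> v by blast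
      then have "\<phi> v \<noteq> b"
      proof -
        have "part v \<inter> X = {}"
          using part_eq[of v] part(2)[of v] v False XY vM(3)[of v] unfolding part_def by auto
        then show ?thesis using \<open>\<phi> v \<in> part v\<close> ab(4) by blast
      qed
      then have z: "\<phi> v \<in> set (take n zs)" "\<phi> v \<noteq> a" using v unfolding S_def by auto
      have "\<phi> v \<in> W" using v unfolding W_def by blast
      then have "\<phi> v \<in> Y - X" using YXW z \<open>\<phi> v \<noteq> b\<close> by blast
      moreover have "v \<in> part (\<phi> v)" using \<phi>V(2) part(2) v by blast
      ultimately have "v \<in> set (l (\<phi> v))" using l_set by auto
      then show ?thesis unfolding L_def using z(1) by auto
    qed
  qed
  have S_cut: "cut_rank_le E (S n) (W - S n) (p + 2)" if "n \<le> length zs" for n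
  proof -
    let ?T = "set (take n zs)"
    have "cut_rank_le E (?T - {a}) (W - ?T) p" by (rule cut_rank_le_subset[OF zs(3)[OF that]]) auto
    moreover have "cut_rank_le E (?T - {a}) {a} 1" by (rule cut_rank_le_flip[OF sym cut_rank_le_single])
    ultimately have "cut_rank_le E (?T - {a}) (W - ?T \<union> {a}) (p + 1)" by (rule cut_rank_le_Un_right[OF sym])
    from cut_rank_le_Un_left[OF this cut_rank_le_single[of E b]]
    have "cut_rank_le E (?T - {a} \<union> {b}) (W - ?T \<union> {a}) (p + 2)" by simp
    then show ?thesis by (rule cut_rank_le_subset) (auto simp: S_def)
  qed
  have L_cut: "cut_rank_le E (set (L n)) (V - set (L n)) (p + 2)" if "n \<le> length zs" for n
  proof (rule cut_rank_le_pullback[OF S_cut[OF that], where \<phi> = \<phi> and \<alpha> = \<beta>])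
    show "\<phi> x \<in> S n" if "x \<in> set (L n)" for x using that unfolding setL by blast
    show "\<phi> y \<in> W - S n" if "y \<in> V - set (L n)" for y using that unfolding setL W_def by blast
    show "E x y \<longleftrightarrow> \<beta> x \<and> \<beta> y \<and> E (\<phi> x) (\<phi> y)" if "x \<in> set (L n)" "y \<in> V - set (L n)" for x y
    proof (rule adj)
      show "x \<in> V" "y \<in> V" "part x \<noteq> part y" using that \<phi>_cong[of x y] unfolding setL by auto
    qed
  qed
  have L_Suc: "L (Suc n) = L n @ l (zs ! n)" if "n < length zs" for n
    unfolding L_def using that by (simp add: take_Suc_conv_app_nth)
  have all: "n \<le> length zs \<Longrightarrow> distinct (L n) \<and>
      (\<forall>i\<le>length (L n). cut_rank_le E (set (take i (L n))) (V - set (take i (L n))) w')" for n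
  proof (induction n)
    case 0
    then show ?case using xs unfolding L_def by simp
  next
    case (Suc n)
    then have n: "n < length zs" "n \<le> length zs" by simp_all
    let ?z = "zs ! n"
    have IH: "distinct (L n)" "\<And>i. i \<le> length (L n) \<Longrightarrow> cut_rank_le E (set (take i (L n))) (V - set (take i (L n))) w'"
      using Suc.IH[OF n(2)] by blast+
    have zW: "?z \<in> W" using n(1) zs(2) nth_mem by blast
    have "set (L n) \<inter> set (l ?z) = {}"
    proof (rule ccontr)
      assume "set (L n) \<inter> set (l ?z) \<noteq> {}"
      then obtain v where v: "v \<in> set (L n)" "?z \<in> Y - X" "v \<in> part ?z" unfolding l_set by (auto split: if_splits)
      have "\<phi> v = ?z" using part_eq[of ?z v] \<phi>_cong[of v ?z] v(3) zW WV W by auto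
      then have "?z \<in> set (take n zs)" using v(1,2) YXW[OF zW] unfolding setL S_def by auto
      then obtain j where "j < n" "zs ! j = ?z" using n by (auto simp: in_set_conv_nth)
      then show False using zs(1) n by (simp add: nth_eq_iff_index_eq)
    qed
    moreover have "distinct (l ?z)" using l0[of ?z] unfolding l_def by auto
    ultimately have "distinct (L (Suc n))" unfolding L_Suc[OF n(1)] using IH(1) by simp
    \<comment> \<open>Within a part the width \<open>w\<close> of its layout is added to
      \<open>p + 2\<close>; once the part is complete, the bound is \<open>p + 2\<close>
      again.\<close>
    moreover have "cut_rank_le E (set (take i (L (Suc n)))) (V - set (take i (L (Suc n)))) w'"
      if "i \<le> length (L (Suc n))" for i
      unfolding L_Suc[OF n(1)]
      by (rule has_layout_append[OF sym IH(2) l_cut L_cut[OF n(2)]]) (use w' that L_Suc[OF n(1)] in auto)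
    ultimately show ?case by blast
  qed
  have "set (L (length zs)) = Y"
  proof -
    have "S (length zs) = W - {a}" using zs(2) ab XY unfolding S_def by auto
    then have "set (L (length zs)) = {v \<in> V. \<phi> v \<noteq> a}" unfolding setL W_def by auto
    also have "\<dots> = Y"
    proof (rule subset_antisym; rule subsetI)
      fix v assume "v \<in> {v \<in> V. \<phi> v \<noteq> a}"
      then show "v \<in> Y" using \<phi>a by blast
    next
      fix v assume v: "v \<in> Y"
      have "\<phi> v \<in> part v" using \<phi> v YV by blast
      then have "\<phi> v \<in> Y" using v XY vM(3)[of v] unfolding part_def by (auto split: if_splits)
      then show "v \<in> {v \<in> V. \<phi> v \<noteq> a}" using v YV ab(3) by blast
    qed
    finally show ?thesis .
  qed
  then show ?thesis unfolding has_layout_def using all[of "length zs"] by blast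
qed

text \<open>A set \<open>U\<close> of cut-rank 1 strictly between \<open>X\<close> and
  \<open>Y\<close> cuts the interval in two. The layout of \<open>X\<close> is prolonged to
  \<open>U\<close> and then to \<open>Y\<close> at the same width \<open>w'\<close>, since limbs of
  either shorter interval are limbs of the long one.\<close>

lemma layout_chain:
  assumes sym: "symp E" and fin: "finite V" and con: "connected_on E V"
    and primes: "\<forall>W\<subseteq>V. prime_on E W \<longrightarrow> has_layout E W W p"
    and rX: "rank1_set E V X" and rY: "rank1_set E V Y" and XY: "X \<subseteq> Y"
    and limbs: "\<And>Z. rank1_set E V Z \<Longrightarrow> Z \<subseteq> Y - X \<Longrightarrow> has_layout E V Z w"
    and lX: "has_layout E V X w'" and w': "w + p + 2 \<le> w'"
  shows "has_layout E V Y w'"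
  using rX rY XY limbs lX
proof (induction "card (Y - X)" arbitrary: X Y rule: less_induct)
  case less
  have finY: "finite (Y - X)" using rank1_set_subset[OF less.prems(2)] fin finite_subset by blast
  show ?case
  proof (cases "\<exists>U. rank1_set E V U \<and> X \<subseteq> U \<and> U \<subseteq> Y \<and> U \<noteq> X \<and> U \<noteq> Y")
    case True
    then obtain U where U: "rank1_set E V U" "X \<subseteq> U" "U \<subseteq> Y" "U \<noteq> X" "U \<noteq> Y" by blast
    have "U - X \<subset> Y - X" "Y - U \<subset> Y - X" using U less.prems(3) by blast+
    then have c: "card (U - X) < card (Y - X)" "card (Y - U) < card (Y - X)"
      using finY psubset_card_mono by blast+
    have "has_layout E V U w'"
    proof (rule less.hyps[OF c(1) less.prems(1) U(1,2) _ less.prems(5)])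
      fix Z assume "rank1_set E V Z" "Z \<subseteq> U - X"
      then show "has_layout E V Z w" using less.prems(4)[of Z] U(3) by blast
    qed
    then show ?thesis
    proof (rule less.hyps[OF c(2) U(1) less.prems(2) U(3), rotated])
      fix Z assume "rank1_set E V Z" "Z \<subseteq> Y - U"
      then show "has_layout E V Z w" using less.prems(4)[of Z] U(2) by blast
    qed
  next
    case False
    show ?thesis
    proof (rule layout_layer[OF sym fin con primes less.prems(1-3) _ _ less.prems(5) w'])
      show "U = X \<or> U = Y" if "rank1_set E V U" "X \<subseteq> U" "U \<subseteq> Y" for U using False that by blast
      show "has_layout E V Z w" if "rank1_set E V Z" "Z \<subseteq> Y - X" for Z by (rule less.prems(4)[OF that])
    qed
  qed
qed

text \<open>Among the subsets of \<open>Y\<close> that branch \<open>k\<close> times take a family of pairwise disjoint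
  minimal ones. As \<open>Y\<close> does not branch \<open>k + 1\<close> times, the unions of its members
  have cut-rank 1, so that they can be laid out one after the other.\<close>

lemma layout_of_not_branching:
  assumes sym: "symp E" and fin: "finite V" and con: "connected_on E V"
    and primes: "\<forall>W\<subseteq>V. prime_on E W \<longrightarrow> has_layout E W W p"
    and "rank1_set E V Y" "\<not> branching k E V Y"
  shows "has_layout E V Y (2 * (p + 2) * k)"
  using assms(5,6)
proof (induction k arbitrary: Y)
  case 0
  then show ?case by simp
next
  case (Suc k)
  define w where "w = 2 * (p + 2) * k"
  define q where "q = p + 2"
  have w2: "2 * (p + 2) * Suc k = w + 2 * q" unfolding w_def q_def by simp
  note rY = Suc.prems(1)
  have YV: "Y \<subseteq> V" "Y \<noteq> V" using rank1_set_subset[OF rY] rank1_set_nonempty[OF rY] by auto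
  have finY: "finite Y" using YV fin finite_subset by blast
  note chain = layout_chain[OF sym fin con primes]
  have single: "rank1_set E V {v}" "has_layout E V {v} (w + q)" if "v \<in> Y" for v
  proof -
    have "v \<in> V" "V \<noteq> {v}" using that YV by blast+
    then show "rank1_set E V {v}" using rank1_set_singleton[OF sym con] by blast
    show "has_layout E V {v} (w + q)" by (rule has_layout_mono[OF has_layout_single]) (simp add: q_def)
  qed
  define minimal where "minimal Z \<longleftrightarrow> branching k E V Z \<and> (\<forall>Z'\<subseteq>Z. branching k E V Z' \<longrightarrow> Z' = Z)" for Z
  have ex_min: "\<exists>Z'\<subseteq>Z. minimal Z'" if "Z \<subseteq> Y" "branching k E V Z" for Z
  proof -
    have "finite Z" using that(1) finY finite_subset by blast
    then show ?thesis using that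
    proof (induction Z rule: finite_psubset_induct)
      case (psubset Z)
      show ?case
      proof (cases "minimal Z")
        case False
        then obtain Z' where "Z' \<subseteq> Z" "branching k E V Z'" "Z' \<noteq> Z" using psubset.prems unfolding minimal_def by blast
        then show ?thesis using psubset.IH[of Z'] psubset.prems by blast
      qed blast
    qed
  qed
  have thin: "has_layout E V Z w" if "rank1_set E V Z" "\<not> branching k E V Z" for Z
    using Suc.IH[OF that] unfolding w_def .
  \<comment> \<open>The chain starts at a single vertex \<open>v\<close> of \<open>Z\<close>. A limb
    avoiding \<open>v\<close> is a proper subset of the minimal set \<open>Z\<close>, so it does not
    branch \<open>k\<close> times and has width \<open>w\<close> by induction. This is the first
    \<open>q\<close>.\<close>
  have lay_min: "has_layout E V Z (w + q)" if Z: "minimal Z" "Z \<subseteq> Y" for Z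
  proof -
    have r: "rank1_set E V Z" using Z(1) branching_rank1 unfolding minimal_def by blast
    then obtain v where v: "v \<in> Z" using rank1_set_nonempty[OF r] by blast
    have vY: "v \<in> Y" using v Z(2) by blast
    show ?thesis
    proof (rule chain[OF single(1)[OF vY] r _ _ single(2)[OF vY]])
      show "{v} \<subseteq> Z" using v by blast
      fix Z' assume Z': "rank1_set E V Z'" "Z' \<subseteq> Z - {v}"
      then have "\<not> branching k E V Z'" using Z(1) v unfolding minimal_def by blast
      then show "has_layout E V Z' w" by (rule thin[OF Z'(1)])
    qed (simp_all add: q_def)
  qed
  have join: "rank1_set E V (Z1 \<union> Z2)"
    if "Z1 \<subseteq> Y" "Z2 \<subseteq> Y" "Z1 \<inter> Z2 = {}" "branching k E V Z1" "branching k E V Z2" for Z1 Z2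
    using branching_SucI[OF rY that] Suc.prems(2) by blast
  \<comment> \<open>The last clause allows \<open>U\<close> to absorb one more branching set. A
    largest good \<open>U\<close> hence leaves none in \<open>Y - U\<close>.\<close>
  define good where "good U \<longleftrightarrow> U \<subseteq> Y \<and> rank1_set E V U \<and> has_layout E V U (w + 2 * q) \<and>
     (\<forall>Z\<subseteq>Y - U. branching k E V Z \<longrightarrow> rank1_set E V (U \<union> Z))" for U
  show ?case
  proof (cases "\<exists>Z\<subseteq>Y. branching k E V Z")
    case False
    then have "\<not> branching k E V Y" by blast
    then show ?thesis unfolding w2 using has_layout_mono[OF thin[OF rY]] by simp
  next
    case True
    then obtain Z0 where Z0: "Z0 \<subseteq> Y" "minimal Z0" using ex_min by (meson subset_trans)
    have bZ0: "branching k E V Z0" using Z0(2) unfolding minimal_def by blast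
    have "has_layout E V Z0 (w + 2 * q)" by (rule has_layout_mono[OF lay_min[OF Z0(2,1)]]) simp
    moreover have "rank1_set E V (Z0 \<union> Z)" if "Z \<subseteq> Y - Z0" "branching k E V Z" for Z
      by (rule join[OF Z0(1) _ _ bZ0 that(2)]) (use that in blast)+
    ultimately have "good Z0" unfolding good_def using Z0(1) branching_rank1[OF bZ0] by blast
    moreover have "card U \<le> card Y" if "good U" for U
      using that card_mono[OF finY] unfolding good_def by blast
    ultimately obtain U where U: "good U" "\<And>U'. good U' \<Longrightarrow> card U' \<le> card U"
      using ex_has_greatest_nat[of good Z0 card "Suc (card Y)"] by (metis le_imp_less_Suc)
    have UY: "U \<subseteq> Y" and rU: "rank1_set E V U" and lU: "has_layout E V U (w + 2 * q)"
      and jU: "\<And>Z. Z \<subseteq> Y - U \<Longrightarrow> branching k E V Z \<Longrightarrow> rank1_set E V (U \<union> Z)"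
      using U(1) unfolding good_def by blast+
    have none: "\<not> branching k E V Z" if Z: "Z \<subseteq> Y - U" for Z
    proof
      assume "branching k E V Z"
      then obtain Z1 where Z1: "Z1 \<subseteq> Z" "minimal Z1" using ex_min[of Z] Z by blast
      have bZ1: "branching k E V Z1" using Z1(2) unfolding minimal_def by blast
      have Z1Y: "Z1 \<subseteq> Y" "Z1 \<subseteq> Y - U" using Z1(1) Z by blast+
      have rUZ: "rank1_set E V (U \<union> Z1)" by (rule jU[OF Z1Y(2) bZ1])
      \<comment> \<open>A limb of this chain lies in \<open>Z1\<close>. By minimality it is
        \<open>Z1\<close> itself, of width \<open>w + q\<close>, or it does not branch. The second
        \<open>q\<close> is paid here, and the width stays \<open>w + 2 * q\<close> however many
        sets are absorbed.\<close>
      have "has_layout E V (U \<union> Z1) (w + 2 * q)"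
      proof (rule chain[OF rU rUZ _ _ lU])
        show "w + q + p + 2 \<le> w + 2 * q" by (simp add: q_def)
        fix Z' assume Z': "rank1_set E V Z'" "Z' \<subseteq> U \<union> Z1 - U"
        then have sub: "Z' \<subseteq> Z1" by blast
        show "has_layout E V Z' (w + q)"
        proof (cases "branching k E V Z'")
          case True
          then have "Z' = Z1" using Z1(2) sub unfolding minimal_def by blast
          then show ?thesis using lay_min[OF Z1(2) Z1Y(1)] by simp
        next
          case False
          show ?thesis by (rule has_layout_mono[OF thin[OF Z'(1) False]]) simp
        qed
      qed blast+
      \<comment> \<open>\<open>U \<union> Z2\<close> and \<open>Z1 \<union> Z2\<close> have cut-rank
        1 and overlap in \<open>Z2\<close>.\<close>
      moreover have "rank1_set E V (U \<union> Z1 \<union> Z2)" if Z2: "Z2 \<subseteq> Y - (U \<union> Z1)" "branching k E V Z2" for Z2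
      proof -
        have "rank1_set E V (U \<union> Z2)" using jU[of Z2] Z2 by blast
        moreover have "rank1_set E V (Z1 \<union> Z2)" by (rule join[OF Z1Y(1) _ _ bZ1 Z2(2)]) (use Z2(1) in blast)+
        moreover have "(U \<union> Z2) \<inter> (Z1 \<union> Z2) \<noteq> {}"
          using rank1_set_nonempty[OF branching_rank1[OF Z2(2)]] by blast
        moreover have "(U \<union> Z2) \<union> (Z1 \<union> Z2) \<noteq> V" using UY Z1Y(1) Z2(1) YV by blast
        ultimately have "rank1_set E V ((U \<union> Z2) \<union> (Z1 \<union> Z2))" by (rule rank1_set_Un[OF sym con])
        moreover have "(U \<union> Z2) \<union> (Z1 \<union> Z2) = U \<union> Z1 \<union> Z2" by blast
        ultimately show ?thesis by simp
      qed
      ultimately have "good (U \<union> Z1)" unfolding good_def using UY Z1Y(1) rUZ by blast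
      then have "card (U \<union> Z1) \<le> card U" by (rule U(2))
      moreover have "U \<subset> U \<union> Z1"
        using rank1_set_nonempty[OF branching_rank1[OF bZ1]] Z1Y(2) by blast
      moreover have "finite (U \<union> Z1)" using UY Z1Y(1) finY finite_subset by blast
      ultimately show False using psubset_card_mono by (metis leD)
    qed
    have "has_layout E V Y (w + 2 * q)"
    proof (rule chain[OF rU rY UY _ lU])
      show "w + p + 2 \<le> w + 2 * q" by (simp add: q_def)
      fix Z assume "rank1_set E V Z" "Z \<subseteq> Y - U"
      then show "has_layout E V Z w" using thin none by blast
    qed
    then show ?thesis unfolding w2 .
  qed
qed

text \<open>Components are laid out one after the other, with no edges between them. A component
  \<open>C\<close> itself has cut-rank 0, so \<open>layout_of_not_branching\<close> is applied to
  the complement of a vertex \<open>r\<close>, which has cut-rank 1, and \<open>r\<close> is put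
  last. For a component of one vertex, \<open>m \<ge> 1\<close> makes the bound large
  enough.\<close>

lemma layout_all:
  assumes sym: "symp E" and fin: "finite V"
    and primes: "\<forall>W\<subseteq>V. prime_on E W \<longrightarrow> has_layout E W W p"
    and nobr: "\<And>C r. C \<subseteq> V \<Longrightarrow> r \<in> C \<Longrightarrow> connected_on E C \<Longrightarrow> \<not> branching m E C (C - {r})"
    and m: "m \<ge> 1"
  shows "has_layout E V V (2 * (p + 2) * m)"
  using fin primes nobr
proof (induction "card V" arbitrary: V rule: less_induct)
  case less
  let ?w = "2 * (p + 2) * m"
  have w1: "1 \<le> ?w" using m by simp
  show ?case
  proof (cases "V = {}")
    case True
    have "cut_rank_le E {} {} ?w" by (rule cut_rank_leI) auto
    then show ?thesis using True unfolding has_layout_def by (intro exI[of _ "[]"]) auto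
  next
    case False
    then obtain r where r: "r \<in> V" by blast
    define \<F> where "\<F> = {S. r \<in> S \<and> S \<subseteq> V \<and> connected_on E S}"
    define C where "C = \<Union>\<F>"
    have rF: "{r} \<in> \<F>" unfolding \<F>_def using r by (simp add: connected_on_singleton)
    have rC: "r \<in> C" "C \<subseteq> V" using rF unfolding C_def \<F>_def by blast+
    have finC: "finite C" using rC(2) less.prems(1) finite_subset by blast
    have conC: "connected_on E C"
      unfolding C_def by (rule connected_on_Union[OF sym, of _ r]) (use rF in \<open>auto simp: \<F>_def\<close>)
    have out: "\<not> E u v \<and> \<not> E v u" if "u \<in> C" "v \<in> V - C" for u v
    proof -
      have "\<not> E v u"
      proof
        assume "E v u"
        then have "connected_on E (insert v C)" by (rule connected_on_insert[OF sym conC that(1)])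
        then have "insert v C \<in> \<F>" unfolding \<F>_def using rC that by blast
        then show False using that unfolding C_def by blast
      qed
      then show ?thesis using sympD[OF sym] by blast
    qed
    have "has_layout E C C ?w"
    proof (cases "C = {r}")
      case True
      show ?thesis unfolding True by (rule has_layout_mono[OF has_layout_single w1])
    next
      case False
      have "rank1_set E C (C - {r})"
        using rank1_set_complement[OF sym rank1_set_singleton[OF sym conC rC(1) False]] .
      moreover have "\<not> branching m E C (C - {r})" by (rule less.prems(3)[OF rC(2,1) conC])
      moreover have "\<forall>W\<subseteq>C. prime_on E W \<longrightarrow> has_layout E W W p" using less.prems(2) rC(2) by blast
      ultimately have "has_layout E C (C - {r}) ?w"
        using layout_of_not_branching[OF sym finC conC] by blast
      then obtain xs where xs: "distinct xs" "set xs = C - {r}"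
        "\<And>i. i \<le> length xs \<Longrightarrow> cut_rank_le E (set (take i xs)) (C - set (take i xs)) ?w"
        unfolding has_layout_def by blast
      have "cut_rank_le E (set (take i (xs @ [r]))) (C - set (take i (xs @ [r]))) ?w" if "i \<le> length (xs @ [r])" for i
      proof (cases "i \<le> length xs")
        case True
        then show ?thesis using xs(3) by simp
      next
        case False
        then have e: "C - set (take i (xs @ [r])) = {}" using that xs(2) by auto
        show ?thesis unfolding e by (rule cut_rank_leI) auto
      qed
      moreover have "distinct (xs @ [r])" "set (xs @ [r]) = C" using xs rC by auto
      ultimately show ?thesis unfolding has_layout_def by blast
    qed
    then obtain xs where xs: "distinct xs" "set xs = C"
        "\<And>i. i \<le> length xs \<Longrightarrow> cut_rank_le E (set (take i xs)) (C - set (take i xs)) ?w"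
      unfolding has_layout_def by blast
    have "V - C \<subset> V" using rC r by blast
    then have c: "card (V - C) < card V" using less.prems(1) psubset_card_mono by blast
    have "has_layout E (V - C) (V - C) ?w"
    proof (rule less.hyps[OF c])
      show "finite (V - C)" using less.prems(1) by blast
      show "\<forall>W\<subseteq>V - C. prime_on E W \<longrightarrow> has_layout E W W p" using less.prems(2) by blast
      show "\<not> branching m E C' (C' - {r})" if "C' \<subseteq> V - C" "r \<in> C'" "connected_on E C'" for C' r
        using less.prems(3)[of C' r] that by blast
    qed
    then obtain ys where ys: "distinct ys" "set ys = V - C"
        "\<And>i. i \<le> length ys \<Longrightarrow> cut_rank_le E (set (take i ys)) (V - C - set (take i ys)) ?w"
      unfolding has_layout_def by blast
    have x: "cut_rank_le E (set (take i xs)) (V - set (take i xs)) ?w" if "i \<le> length xs" for i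
    proof -
      let ?P = "set (take i xs)"
      have P: "?P \<subseteq> C" using xs(2) set_take_subset by metis
      have "cut_rank_le E ?P (V - C) 0" by (rule cut_rank_le_zero) (use P out in blast)
      from cut_rank_le_Un_right[OF sym xs(3)[OF that] this] have "cut_rank_le E ?P (C - ?P \<union> (V - C)) ?w" by simp
      then show ?thesis by (rule cut_rank_le_subset) blast+
    qed
    have y: "cut_rank_le E (set (take i ys)) (V - set (take i ys)) ?w" if "i \<le> length ys" for i
    proof -
      let ?P = "set (take i ys)"
      have P: "?P \<subseteq> V - C" using ys(2) set_take_subset by metis
      have "cut_rank_le E ?P C 0" by (rule cut_rank_le_zero) (use P out in blast)
      from cut_rank_le_Un_right[OF sym ys(3)[OF that] this] have "cut_rank_le E ?P (V - C - ?P \<union> C) ?w" by simp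
      then show ?thesis by (rule cut_rank_le_subset) blast+
    qed
    have z: "cut_rank_le E (set xs) (V - set xs) 0" by (rule cut_rank_le_zero) (use xs(2) out in blast)
    have "cut_rank_le E (set (take i (xs @ ys))) (V - set (take i (xs @ ys))) ?w" if "i \<le> length (xs @ ys)" for i
      by (rule has_layout_append[OF sym x y z _ that]) simp_all
    moreover have "distinct (xs @ ys)" "set (xs @ ys) = V" using xs ys rC by auto
    ultimately show ?thesis unfolding has_layout_def by blast
  qed
qed

section \<open>Local complementations inside a limb\<close>

text \<open>\<open>vmin S V E W F\<close>: the graph \<open>(W, F)\<close> arises from \<open>(V, E)\<close> by local complementations and deletions
  at vertices of \<open>S\<close>. Deletion keeps the relation, whose values outside the vertex set are junk.\<close>

inductive vmin :: "'a set \<Rightarrow> 'a set \<Rightarrow> ('a \<Rightarrow> 'a \<Rightarrow> bool) \<Rightarrow> 'a set \<Rightarrow> ('a \<Rightarrow> 'a \<Rightarrow> bool) \<Rightarrow> bool"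
  for S V E where
  refl: "vmin S V E V E"
| locomp: "vmin S V E W F \<Longrightarrow> x \<in> S \<Longrightarrow> x \<in> W \<Longrightarrow> vmin S V E W (locomp F x)"
| delete: "vmin S V E W F \<Longrightarrow> x \<in> S \<Longrightarrow> x \<in> W \<Longrightarrow> vmin S V E (W - {x}) F"

lemma vmin_trans:
  assumes "vmin S V E W F" "vmin R W F U H" "R \<subseteq> S"
  shows "vmin S V E U H"
  using assms(2,1,3) by induction (auto intro: vmin.intros)

lemma vmin_mono: "vmin R V E W F \<Longrightarrow> R \<subseteq> S \<Longrightarrow> vmin S V E W F"
  using vmin_trans[OF vmin.refl] by metis

lemma vmin_delete_set:
  assumes "finite D" "vmin S V E W F" "D \<subseteq> S" "D \<subseteq> W"
  shows "vmin S V E (W - D) F"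
  using assms
proof (induction D)
  case (insert x D)
  have "vmin S V E (W - D) F" using insert.IH insert.prems by blast
  then have "vmin S V E (W - D - {x}) F" by (rule vmin.delete) (use insert in blast)+
  moreover have "W - insert x D = W - D - {x}" by blast
  ultimately show ?case by simp
qed simp

text \<open>The relation is total and the operations take place at vertices of \<open>S\<close>, so
  further vertices outside \<open>S\<close> can be carried along with the same
  \<open>F\<close>.\<close>

lemma vmin_extend:
  assumes "vmin S V E W F" "U \<inter> S = {}"
  shows "vmin S (V \<union> U) E (W \<union> U) F"
  using assms(1)
proof induction
  case (delete W F x)
  have "vmin S (V \<union> U) E (W \<union> U - {x}) F" using delete by (intro vmin.delete) auto
  moreover have "W \<union> U - {x} = W - {x} \<union> U" using assms(2) delete by auto
  ultimately show ?case by simp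
qed (auto intro: vmin.intros)

lemma vmin_graph:
  assumes "vmin S V E W F"
  shows "symp E \<Longrightarrow> symp F" "irreflp E \<Longrightarrow> irreflp F"
  using assms by induction (auto simp: symp_locomp irreflp_locomp)

lemma vmin_verts: "vmin S V E W F \<Longrightarrow> W \<subseteq> V \<and> V - S \<subseteq> W"
  by (induction rule: vmin.induct) auto

text \<open>A local complementation at a vertex of \<open>Y\<close> only toggles edges inside \<open>insert a Y\<close>.\<close>

lemma vmin_local:
  assumes "vmin Y V E W F" "symp E" "\<And>y v. y \<in> Y \<Longrightarrow> v \<in> V - Y \<Longrightarrow> E y v \<Longrightarrow> v = a"
  shows "(\<forall>u\<in>V - Y. \<forall>v\<in>V - Y. F u v = E u v) \<and> (\<forall>y\<in>Y. \<forall>v\<in>V - Y. F y v \<longrightarrow> v = a)"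
  using assms(1)
proof induction
  case refl
  then show ?case using assms(3) by auto
next
  case (locomp W F x)
  then have 1: "F u v = E u v" if "u \<in> V - Y" "v \<in> V - Y" for u v using that by blast
  have 2: "F y v \<Longrightarrow> v = a" if "y \<in> Y" "v \<in> V - Y" for y v using that locomp.IH by blast
  have "locomp F x u v = E u v" if "u \<in> V - Y" "v \<in> V - Y" for u v
    using 1[OF that] 2[OF locomp.hyps(2) that(1)] 2[OF locomp.hyps(2) that(2)]
    unfolding locomp_def by blast
  moreover have "v = a" if "y \<in> Y" "v \<in> V - Y" "locomp F x y v" for y v
    using 2[OF that(1,2)] 2[OF locomp.hyps(2) that(2)] that(3) unfolding locomp_def by blast
  ultimately show ?case by blast
qed

text \<open>Each operation preserves the branching of \<open>Z\<close> as long as an edge leaves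
  \<open>Z\<close>. Going backwards, an edge leaving \<open>Z\<close> at the end forces one at every
  earlier stage, so it suffices to ask for one in the last graph.\<close>

lemma branching_vmin:
  assumes "vmin S V E W F" "symp E" "irreflp E" "branching k E V Z" "Z \<subseteq> W"
    "\<exists>u\<in>Z. \<exists>v\<in>W - Z. F u v"
  shows "branching k F W Z"
  using assms(1,5,6)
proof induction
  case refl
  then show ?case using assms(4) by simp
next
  case (locomp W F x)
  have g: "symp F" "irreflp F" using vmin_graph[OF locomp.hyps(1)] assms(2,3) by auto
  obtain u v where uv: "u \<in> Z" "v \<in> W - Z" "locomp F x u v" using locomp.prems by blast
  have "\<exists>u\<in>Z. \<exists>v\<in>W - Z. F u v"
  proof (cases "F u v")
    case False
    then have "F x u" "F x v" using uv unfolding locomp_def by auto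
    then show ?thesis using uv locomp.hyps(3) sympD[OF g(1)] by (cases "x \<in> Z") blast+
  qed (use uv in blast)
  then show ?case using locomp.IH locomp.prems branching_locomp_iff[OF g locomp.hyps(3)] by blast
next
  case (delete W F x)
  obtain u v where uv: "u \<in> Z" "v \<in> W - {x} - Z" "F u v" using delete.prems by blast
  have sub: "Z \<subseteq> W" using delete.prems by blast
  then have b: "branching k F W Z" using delete.IH uv by blast
  have "branching k F (W - {x}) Z = branching k F W Z"
    by (rule branching_restrict[OF branching_rank1[OF b], of _ u v]) (use uv delete.prems in auto)
  then show ?case using b by simp
qed

text \<open>The single vertex \<open>b\<close> represents the surroundings of \<open>Z\<close>.
  Limbs are handed on in this form: connected and branching on \<open>insert b Z\<close>.\<close>

lemma limb_restrict:
  assumes "symp E" "connected_on E X" "branching k E X Z" "b \<in> X - Z" "y \<in> Z" "E y b"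
  shows "connected_on E (insert b Z) \<and> branching k E (insert b Z) Z"
proof
  show "connected_on E (insert b Z)"
    using connected_on_rank1_set[OF assms(1,2) branching_rank1[OF assms(3)] assms(4-6)] .
  have "branching k E (insert b Z) Z = branching k E X Z"
    by (rule branching_restrict[OF branching_rank1[OF assms(3)], of _ y b])
      (use assms rank1_set_subset[OF branching_rank1[OF assms(3)]] in auto)
  then show "branching k E (insert b Z) Z" using assms(3) by simp
qed

lemma branching_extend:
  assumes "branching k E V' Y" "V' \<subseteq> V" "\<And>y v. y \<in> Y \<Longrightarrow> v \<in> V - V' \<Longrightarrow> \<not> E y v"
  shows "branching k E V Y"
proof -
  note r = branching_rank1[OF assms(1)]
  obtain u v where uv: "u \<in> Y" "v \<in> V'" "v \<notin> Y" "E u v" using r by (rule rank1_set_edge)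
  have "E u v'" if "u \<in> Y" "u' \<in> Y" "v \<in> V - Y" "v' \<in> V - Y" "E u v" "E u' v'" for u u' v v'
  proof -
    have "v \<in> V' - Y" "v' \<in> V' - Y" using assms(3)[of u v] assms(3)[of u' v'] that by blast+
    then show ?thesis using rank1_setD[OF r that(1,2) _ _ that(5,6)] by blast
  qed
  moreover have "Y \<subseteq> V" using rank1_set_subset[OF r] assms(2) by blast
  moreover have "\<exists>u\<in>Y. \<exists>v\<in>V - Y. E u v" using uv assms(2) by blast
  ultimately have R: "rank1_set E V Y" unfolding rank1_set_def by metis
  have "branching k E V' Y = branching k E V Y"
    by (rule branching_restrict[OF R, of _ u v]) (use uv assms(2) rank1_set_subset[OF r] in auto)
  then show ?thesis using assms(1) by simp
qed

text \<open>The vertices of \<open>D\<close> are removed one at a time, each preceded by a local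
  complementation if \<open>connected_on_eliminate\<close> demands it.\<close>

lemma vmin_eliminate:
  assumes "finite D" "symp E" "irreflp E" "connected_on E X" "D \<subseteq> X" "D \<noteq> X"
  shows "\<exists>F. vmin D X E (X - D) F \<and> connected_on F (X - D)"
  using assms(1,5,6)
proof (induction D)
  case empty
  then show ?case using assms(4) by (auto intro: vmin.refl)
next
  case (insert x D)
  then obtain F where F: "vmin D X E (X - D) F" "connected_on F (X - D)" by blast
  have g: "symp F" "irreflp F" using vmin_graph[OF F(1)] assms(2,3) by auto
  have x: "x \<in> X - D" "X - D \<noteq> {x}" "X - insert x D = X - D - {x}" using insert by blast+
  have v: "vmin (insert x D) X E (X - D) F" using vmin_mono[OF F(1)] by blast
  have "vmin (insert x D) X E (X - insert x D) F"
    unfolding x(3) using v x(1) by (intro vmin.delete) auto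
  moreover have "vmin (insert x D) X E (X - insert x D) (locomp F x)"
    unfolding x(3) using v x(1) by (intro vmin.delete vmin.locomp) auto
  ultimately show ?case using connected_on_eliminate[OF g F(2) x(1,2)] unfolding x(3) by blast
qed

text \<open>Up to local complementations outside \<open>a\<close>, the vertex \<open>c\<close> can be moved between \<open>a\<close> and \<open>Y\<close>, unless
  \<open>a\<close> separates \<open>c\<close> from \<open>Y\<close>.\<close>

lemma subdivide_triangle:
  assumes sym: "symp E" and irr: "irreflp E" and con: "connected_on E (insert a (insert c Y))"
    and br: "branching k E (insert a (insert c Y)) Y"
    and notin: "a \<notin> Y" "c \<notin> Y" "a \<noteq> c" and cy: "y \<in> Y" "E c y"
  shows "\<exists>F. vmin (insert c Y) (insert a (insert c Y)) E (insert a (insert c Y)) F \<and> F a c \<and>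
      (\<forall>y\<in>Y. \<not> F a y) \<and> connected_on F (insert c Y) \<and> branching k F (insert c Y) Y"
proof -
  let ?X = "insert a (insert c Y)"
  note r = branching_rank1[OF br]
  \<comment> \<open>It is enough to reach a graph where \<open>a\<close> sees \<open>c\<close> but
    nothing of \<open>Y\<close>: an edge leaving \<open>Y\<close> then ends at \<open>c\<close>, and
    \<open>limb_restrict\<close> applies.\<close>
  have final: "?thesis" if F: "vmin (insert c Y) ?X E ?X F" "F a c" "\<forall>y\<in>Y. \<not> F a y" "connected_on F ?X"
    "branching k F ?X Y" for F
  proof -
    have g: "symp F" "irreflp F" using vmin_graph[OF F(1)] assms(1,2) by auto
    obtain u v where uv: "u \<in> Y" "v \<in> ?X" "v \<notin> Y" "F u v"
      using branching_rank1[OF F(5)] by (rule rank1_set_edge)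
    have "v \<noteq> a" using F(3) uv(1) sympD[OF g(1) uv(4)] by blast
    then have "F u c" using uv by blast
    moreover have "c \<in> ?X - Y" using notin by blast
    ultimately have "connected_on F (insert c Y)" "branching k F (insert c Y) Y"
      using limb_restrict[OF g(1) F(4,5) _ uv(1)] by blast+
    then show ?thesis using F(1-3) by blast
  qed
  \<comment> \<open>If \<open>a\<close> and \<open>c\<close> are adjacent and both see
    \<open>Y\<close>, the rank condition gives them the same neighbours in \<open>Y\<close>, so a
    local complementation at \<open>c\<close> removes all edges from \<open>a\<close> to
    \<open>Y\<close>.\<close>
  have tri: "?thesis"
    if E: "vmin (insert c Y) ?X E ?X E'" "E' a c" "\<exists>y\<in>Y. E' a y" "\<exists>y\<in>Y. E' c y" "connected_on E' ?X"
      "branching k E' ?X Y" for E'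
  proof -
    have g: "symp E'" "irreflp E'" using vmin_graph[OF E(1)] assms(1,2) by auto
    note r = branching_rank1[OF E(6)] and s = sympD[OF g(1)]
    have m: "a \<in> ?X - Y" "c \<in> ?X - Y" using notin by auto
    have "E' a z \<longleftrightarrow> E' c z" if "z \<in> Y" for z
    proof -
      obtain y1 y2 where y: "y1 \<in> Y" "E' y1 a" "y2 \<in> Y" "E' y2 c" using E(3,4) s by blast
      show ?thesis
        using rank1_setD[OF r that y(3) m(1,2) _ y(4)] rank1_setD[OF r that y(1) m(2,1) _ y(2)]
          s[of a z] s[of z a] s[of c z] s[of z c] by blast
    qed
    then have no: "\<not> locomp E' c a z" if "z \<in> Y" for z
      using that E(2) s[of a c] notin unfolding locomp_def by metis
    show ?thesis
    proof (rule final)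
      show "vmin (insert c Y) ?X E ?X (locomp E' c)" using E(1) by (intro vmin.locomp) auto
      show "locomp E' c a c" using E(2) g by simp
      show "connected_on (locomp E' c) ?X" using E g by (intro connected_on_locomp) auto
      show "branching k (locomp E' c) ?X Y" using branching_locomp_iff[OF g, of c ?X] E(6) by blast
    qed (use no in blast)
  qed
  consider "\<forall>y\<in>Y. \<not> E a y" | "\<exists>y\<in>Y. E a y" "E a c" | y' where "y' \<in> Y" "E a y'" "\<not> E a c" by blast
  then show ?thesis
  proof cases
    case 1
    have "{a} \<subseteq> ?X" "{a} \<noteq> {}" "{a} \<noteq> ?X" using notin by auto
    then obtain u v where "u \<in> {a}" "v \<in> ?X - {a}" "E u v"
      using connected_onD[OF con] by metis
    then have "E a c" using 1 by blast
    then show ?thesis using final[OF vmin.refl _ 1 con br] by blast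
  next
    case 2
    then show ?thesis using tri[OF vmin.refl] cy con br by blast
  next
    case 3
    \<comment> \<open>By the rank condition \<open>y'\<close> is a common neighbour of
      \<open>a\<close> and \<open>c\<close>. A local complementation at \<open>y'\<close> makes them
      adjacent and produces the situation of \<open>tri\<close>.\<close>
    have y'a: "E y' a" using sympD[OF sym 3(2)] .
    have "E y' c"
      using rank1_setD[OF r 3(1) cy(1) _ _ y'a sympD[OF sym cy(2)]] notin by blast
    then have "locomp E y' a c" using 3(3) notin y'a unfolding locomp_def by blast
    moreover have "locomp E y' a y'" "locomp E y' c y'" using irr 3(2) sympD[OF sym \<open>E y' c\<close>] by simp_all
    moreover have "vmin (insert c Y) ?X E ?X (locomp E y')"
      using 3(1) by (intro vmin.locomp vmin.refl) auto
    moreover have "connected_on (locomp E y') ?X" using 3(1) con sym irr by (intro connected_on_locomp) auto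
    moreover have "branching k (locomp E y') ?X Y"
      using branching_locomp_iff[OF sym irr, of y' ?X] br 3(1) by blast
    ultimately show ?thesis using tri[of "locomp E y'"] 3(1) by blast
  qed
qed

section \<open>Placing a new vertex between \<open>a\<close> and a limb\<close>

definition extendable :: "nat \<Rightarrow> ('a \<Rightarrow> 'a \<Rightarrow> bool) \<Rightarrow> 'a \<Rightarrow> 'a set \<Rightarrow> bool" where
  "extendable k E a Y \<longleftrightarrow> (\<exists>F c Z. c \<in> Y \<and> Z \<subseteq> Y \<and> c \<notin> Z \<and>
     vmin Y (insert a Y) E (insert a (insert c Z)) F \<and> F a c \<and> (\<forall>z\<in>Z. \<not> F a z) \<and>
     connected_on F (insert c Z) \<and> branching k F (insert c Z) Z)"

text \<open>\<open>extendable\<close> is the step that adds a tree vertex: \<open>c\<close> becomes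
  its image and \<open>Z\<close> the limb hanging on it. A vertex \<open>c\<close> next to
  \<open>Z\<close> serves as soon as \<open>a\<close> is adjacent to \<open>c\<close> or to
  \<open>Z\<close>: the rest of \<open>Y\<close> is deleted, what remains is connected, and
  \<open>subdivide_triangle\<close> applies.\<close>

lemma extendable_neighbour:
  assumes sym: "symp E" and irr: "irreflp E" and fin: "finite Y" and con: "connected_on E (insert a Y)"
    and br: "branching k E (insert a Y) Z" and Z: "Z \<subseteq> Y" "a \<notin> Y"
    and c: "c \<in> Y - Z" "z \<in> Z" "E c z" and ac: "E a c \<or> (\<exists>y\<in>Z. E a y)"
  shows "extendable k E a Y"
proof -
  let ?X = "insert a (insert c Z)"
  note r = branching_rank1[OF br]
  have "connected_on E (insert c Z)"
    using connected_on_rank1_set[OF sym con r _ c(2) sympD[OF sym c(3)]] c(1) by blast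
  then have con': "connected_on E ?X"
    using ac connected_on_insert[OF sym, of "insert c Z" _ a] by blast
  have "branching k E ?X Z = branching k E (insert a Y) Z"
    by (rule branching_restrict[OF r, of _ z c]) (use c Z sympD[OF sym c(3)] in auto)
  then have br': "branching k E ?X Z" using br by simp
  have "a \<notin> Z" "c \<notin> Z" "a \<noteq> c" using c Z by auto
  from subdivide_triangle[OF sym irr con' br' this c(2,3)] obtain F where
    F: "vmin (insert c Z) ?X E ?X F" "F a c" "\<forall>y\<in>Z. \<not> F a y" "connected_on F (insert c Z)"
      "branching k F (insert c Z) Z" by blast
  have "vmin Y (insert a Y) E (insert a Y - (Y - insert c Z)) E"
    using fin by (intro vmin_delete_set vmin.refl) auto
  moreover have "insert a Y - (Y - insert c Z) = ?X" using Z c by blast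
  ultimately have "vmin Y (insert a Y) E ?X F"
    using vmin_trans[OF _ F(1), of Y "insert a Y" E] Z c by auto
  then show ?thesis unfolding extendable_def using F c Z by blast
qed

text \<open>Vertices of \<open>Y - Z\<close> that are not adjacent to \<open>a\<close> are
  eliminated with connectedness kept; a local complementation at such a vertex does not alter the
  edges at \<open>a\<close>, so \<open>a\<close> still sees nothing of \<open>Z\<close>. When all
  remaining vertices of \<open>Y - Z\<close> are neighbours of \<open>a\<close>, an edge leaving
  \<open>Z\<close> ends at one of them, which serves as \<open>c\<close>.\<close>

lemma extendable_far:
  assumes "symp E" "irreflp E" "finite Y" "connected_on E (insert a Y)" "branching k E (insert a Y) Z"
    "Z \<subseteq> Y" "a \<notin> Y" "\<forall>z\<in>Z. \<not> E a z"
  shows "extendable k E a Y"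
  using assms
proof (induction "card (Y - Z)" arbitrary: Y E rule: less_induct)
  case less
  note sym = less.prems(1) and irr = less.prems(2) and fin = less.prems(3) and con = less.prems(4)
    and br = less.prems(5) and Z = less.prems(6,7) and far = less.prems(8)
  show ?case
  proof (cases "\<exists>u\<in>Y - Z. \<not> E a u")
    case True
    then obtain u where u: "u \<in> Y" "u \<notin> Z" "\<not> E a u" by blast
    have "insert a Y \<noteq> {u}" "u \<in> insert a Y" using u Z by blast+
    from connected_on_eliminate[OF sym irr con this(2,1)]
    obtain F where F: "F = E \<or> F = locomp E u" "connected_on F (insert a Y - {u})" by blast
    have X: "insert a Y - {u} = insert a (Y - {u})" using u Z by blast
    have v: "vmin {u} (insert a Y) E (insert a (Y - {u})) F"
      unfolding X[symmetric] using F(1) u by (auto intro: vmin.intros)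
    have g: "symp F" "irreflp F" using vmin_graph[OF v] sym irr by auto
    have far': "\<forall>z\<in>Z. \<not> F a z" using F(1) far u sympD[OF sym] unfolding locomp_def by blast
    have Z': "Z \<noteq> {}" "Z \<subseteq> Y - {u}" using rank1_set_nonempty[OF branching_rank1[OF br]] u Z by auto
    have "\<exists>u'\<in>Z. \<exists>v\<in>insert a (Y - {u}) - Z. F u' v"
      using connected_onD[OF F(2)[unfolded X], of Z] Z Z' by (metis insertI1 subsetD subset_insertI2)
    then have br': "branching k F (insert a (Y - {u})) Z"
      using branching_vmin[OF v sym irr br] Z' by blast
    have "card (Y - {u} - Z) < card (Y - Z)" using u fin by (intro psubset_card_mono) auto
    then have "extendable k F a (Y - {u})"
      using less.hyps[OF _ g _ _ br' Z'(2)] F(2) X fin Z far' by simp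
    then obtain H c Z0 where H: "c \<in> Y - {u}" "Z0 \<subseteq> Y - {u}" "c \<notin> Z0"
       "vmin (Y - {u}) (insert a (Y - {u})) F (insert a (insert c Z0)) H" "H a c" "\<forall>z\<in>Z0. \<not> H a z"
       "connected_on H (insert c Z0)" "branching k H (insert c Z0) Z0"
      unfolding extendable_def by blast
    have "vmin Y (insert a Y) E (insert a (insert c Z0)) H"
      by (rule vmin_trans[OF vmin_mono[OF v] H(4)]) (use u in auto)
    then show ?thesis unfolding extendable_def using H by blast
  next
    case False
    obtain z c where "z \<in> Z" "c \<in> insert a Y" "c \<notin> Z" "E z c"
      using branching_rank1[OF br] by (rule rank1_set_edge)
    moreover have "c \<noteq> a" using far calculation sympD[OF sym] by blast
    ultimately have "c \<in> Y - Z" "z \<in> Z" "E c z" "E a c" using False sympD[OF sym] by blast+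
    then show ?thesis using extendable_neighbour[OF sym irr fin con br Z] by blast
  qed
qed

text \<open>If \<open>a\<close> misses one of the two children, \<open>extendable_far\<close>
  applies. If \<open>a\<close> sees both, a vertex of \<open>Y\<close> outside a child and adjacent
  to it suffices: an end of an edge between the children or, failing that, a vertex outside both,
  whose existence follows from the rank condition on their union.\<close>

lemma branching_extendable:
  assumes sym: "symp E" and irr: "irreflp E" and fin: "finite Y" and con: "connected_on E (insert a Y)"
    and br: "branching (Suc k) E (insert a Y) Y" and a: "a \<notin> Y"
  shows "extendable k E a Y"
proof -
  let ?X = "insert a Y"
  obtain Y1 Y2 where Y: "rank1_set E ?X Y" "Y1 \<subseteq> Y" "Y2 \<subseteq> Y" "Y1 \<inter> Y2 = {}"
      "branching k E ?X Y1" "branching k E ?X Y2" "\<not> rank1_set E ?X (Y1 \<union> Y2)"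
    using br by (rule branching_SucE)
  note r1 = branching_rank1[OF Y(5)] and r2 = branching_rank1[OF Y(6)] and s = sympD[OF sym]
  note n1 = extendable_neighbour[OF sym irr fin con Y(5,2) a]
  note n2 = extendable_neighbour[OF sym irr fin con Y(6,3) a]
  consider "\<forall>z\<in>Y1. \<not> E a z" | "\<forall>z\<in>Y2. \<not> E a z" | y1 y2 where "y1 \<in> Y1" "E a y1" "y2 \<in> Y2" "E a y2"
    by blast
  then show ?thesis
  proof cases
    case 1
    then show ?thesis using extendable_far[OF sym irr fin con Y(5,2) a] by blast
  next
    case 2
    then show ?thesis using extendable_far[OF sym irr fin con Y(6,3) a] by blast
  next
    case 3
    show ?thesis
    proof (cases "\<exists>u\<in>Y1. \<exists>v\<in>Y2. E v u")
      case True
      then obtain u v where uv: "u \<in> Y1" "v \<in> Y2" "E v u" by blast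
      then have "v \<in> Y - Y1" using Y(3,4) by blast
      then show ?thesis using n1[OF _ uv(1,3)] 3 by blast
    next
      case False
      \<comment> \<open>Otherwise every vertex outside the union, \<open>a\<close> included, would
        see both children or neither, and the rank conditions of the children would combine to
        cut-rank 1 of the union.\<close>
      have "\<exists>c\<in>Y - (Y1 \<union> Y2). (\<exists>z\<in>Y1. E c z) \<noteq> (\<exists>z\<in>Y2. E c z)"
      proof (rule ccontr)
        assume "\<not> ?thesis"
        then have same: "(\<exists>z\<in>Y1. E c z) \<longleftrightarrow> (\<exists>z\<in>Y2. E c z)" if "c \<in> ?X - (Y1 \<union> Y2)" for c
          using 3 that by blast
        have "E u v'" if uv: "u \<in> Y1 \<union> Y2" "u' \<in> Y1 \<union> Y2" "v \<in> ?X - (Y1 \<union> Y2)" "v' \<in> ?X - (Y1 \<union> Y2)"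
          "E u v" "E u' v'" for u u' v v'
        proof -
          have "\<exists>w\<in>Y1. E v' w" "\<exists>w\<in>Y2. E v' w"
            using same[OF uv(4)] uv(2) s[OF uv(6)] by blast+
          then have "\<exists>w\<in>Y1. E w v'" "\<exists>w\<in>Y2. E w v'" using s by blast+
          then obtain w1 w2 where w: "w1 \<in> Y1" "E w1 v'" "w2 \<in> Y2" "E w2 v'" by blast
          have "v \<in> ?X - Y1" "v \<in> ?X - Y2" "v' \<in> ?X - Y1" "v' \<in> ?X - Y2" using uv(3,4) by blast+
          then show ?thesis
            using uv(1) rank1_setD[OF r1 _ w(1) _ _ uv(5) w(2)] rank1_setD[OF r2 _ w(3) _ _ uv(5) w(4)]
            by blast
        qed
        moreover have "\<exists>u\<in>Y1 \<union> Y2. \<exists>v\<in>?X - (Y1 \<union> Y2). E u v"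
          using s[OF 3(2)] 3(1) a Y(2,3) by blast
        ultimately have "rank1_set E ?X (Y1 \<union> Y2)"
          unfolding rank1_set_def using Y(2,3) by (metis Un_least subset_insertI2)
        with Y(7) show False ..
      qed
      then obtain c where c: "c \<in> Y - Y1" "c \<in> Y - Y2" "(\<exists>z\<in>Y1. E c z) \<or> (\<exists>z\<in>Y2. E c z)" by blast
      show ?thesis using c(3) n1[OF c(1)] n2[OF c(2)] 3 by blast
    qed
  qed
qed

section \<open>Splitting a limb into two\<close>

lemma connected_on_Un:
  assumes "symp E" "connected_on E X" "connected_on E Y" "X \<inter> Y \<noteq> {}"
  shows "connected_on E (X \<union> Y)"
  unfolding connected_on_def
proof (intro conjI allI impI)
  show "X \<union> Y \<noteq> {}" using assms(4) by blast
  fix S assume S: "S \<subseteq> X \<union> Y \<and> S \<noteq> {} \<and> S \<noteq> X \<union> Y"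
  obtain z where z: "z \<in> X" "z \<in> Y" using assms(4) by blast
  have "\<exists>Q. (Q = X \<or> Q = Y) \<and> S \<inter> Q \<noteq> {} \<and> S \<inter> Q \<noteq> Q"
  proof (cases "z \<in> S")
    case True
    obtain w where "w \<in> X \<union> Y" "w \<notin> S" using S by blast
    then show ?thesis using z True by blast
  next
    case False
    obtain w where "w \<in> X \<union> Y" "w \<in> S" using S by blast
    then show ?thesis using z False by blast
  qed
  then obtain Q where Q: "connected_on E Q" "Q \<subseteq> X \<union> Y" "S \<inter> Q \<noteq> {}" "S \<inter> Q \<noteq> Q"
    using assms(2,3) by blast
  obtain u v where "u \<in> S \<inter> Q" "v \<in> Q - S \<inter> Q" "E u v"
    using connected_onD[OF Q(1) _ Q(3,4)] by blast
  then show "\<exists>u\<in>S. \<exists>v\<in>X \<union> Y - S. E u v" using Q(2) by blast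
qed

lemma connected_on_cong:
  assumes con: "connected_on E X" and eq: "\<And>u v. u \<in> X \<Longrightarrow> v \<in> X \<Longrightarrow> E u v = F u v"
  shows "connected_on F X"
  unfolding connected_on_def
proof (intro conjI allI impI)
  show "X \<noteq> {}" using con by (simp add: connected_on_def)
  fix S assume S: "S \<subseteq> X \<and> S \<noteq> {} \<and> S \<noteq> X"
  then obtain u v where uv: "u \<in> S" "v \<in> X - S" "E u v" using connected_onD[OF con] by metis
  then have "F u v" using eq[of u v] S by blast
  then show "\<exists>u\<in>S. \<exists>v\<in>X - S. F u v" using uv by blast
qed

text \<open>All of \<open>Y\<close> except two children is eliminated with connectedness kept. If
  \<open>x\<close> then sees only one child \<open>A\<close>, the other child \<open>B\<close> is
  joined to \<open>A\<close>. A neighbour \<open>y\<close> of \<open>x\<close> in \<open>A\<close>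
  sees \<open>B\<close> by the rank condition, and a local complementation at \<open>y\<close> gives
  \<open>x\<close> a neighbour in \<open>B\<close>.\<close>

lemma branching_two_limbs:
  assumes sym: "symp E" and irr: "irreflp E" and fin: "finite Y" and con: "connected_on E (insert x Y)"
    and br: "branching (Suc k) E (insert x Y) Y" and x: "x \<notin> Y"
  shows "\<exists>F Y1 Y2. Y1 \<subseteq> Y \<and> Y2 \<subseteq> Y \<and> Y1 \<inter> Y2 = {} \<and>
     vmin Y (insert x Y) E (insert x (Y1 \<union> Y2)) F \<and> connected_on F (insert x (Y1 \<union> Y2)) \<and>
     branching k F (insert x (Y1 \<union> Y2)) Y1 \<and> branching k F (insert x (Y1 \<union> Y2)) Y2 \<and>
     (\<exists>y\<in>Y1. F x y) \<and> (\<exists>y\<in>Y2. F x y)"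
proof -
  obtain Y1 Y2 where Y: "rank1_set E (insert x Y) Y" "Y1 \<subseteq> Y" "Y2 \<subseteq> Y" "Y1 \<inter> Y2 = {}"
      "branching k E (insert x Y) Y1" "branching k E (insert x Y) Y2"
    using br by (rule branching_SucE)
  let ?X = "insert x (Y1 \<union> Y2)"
  have D: "insert x Y - (Y - (Y1 \<union> Y2)) = ?X" using x Y(2,3) by blast
  have "finite (Y - (Y1 \<union> Y2))" "Y - (Y1 \<union> Y2) \<subseteq> insert x Y" "Y - (Y1 \<union> Y2) \<noteq> insert x Y"
    using fin x by auto
  from vmin_eliminate[OF this(1) sym irr con this(2,3)] obtain F where
    F: "vmin (Y - (Y1 \<union> Y2)) (insert x Y) E ?X F" "connected_on F ?X" unfolding D by blast
  have v: "vmin Y (insert x Y) E ?X F" using vmin_mono[OF F(1)] by blast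
  have g: "symp F" "irreflp F" using vmin_graph[OF v] sym irr by auto
  have edge: "\<exists>u\<in>Z. \<exists>v\<in>?X - Z. F u v" if "Z \<noteq> {}" "Z \<subseteq> Y1 \<union> Y2" for Z
  proof -
    have "Z \<subseteq> ?X" "Z \<noteq> ?X" using that x Y(2,3) by blast+
    then show ?thesis using connected_onD[OF F(2) _ that(1)] by metis
  qed
  have ne: "Y1 \<noteq> {}" "Y2 \<noteq> {}" using Y(5,6) branching_rank1 rank1_set_nonempty by blast+
  have b1: "branching k F ?X Y1" using branching_vmin[OF v sym irr Y(5)] edge[OF ne(1)] by blast
  have b2: "branching k F ?X Y2" using branching_vmin[OF v sym irr Y(6)] edge[OF ne(2)] by blast
  have step: "\<exists>H. vmin Y (insert x Y) E ?X H \<and> connected_on H ?X \<and>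
     branching k H ?X Y1 \<and> branching k H ?X Y2 \<and> (\<exists>y\<in>A. H x y) \<and> (\<exists>y\<in>B. H x y)"
    if A: "A \<union> B = Y1 \<union> Y2" "A \<inter> B = {}" "rank1_set F ?X A" "\<forall>y\<in>B. \<not> F x y"
       "\<exists>y\<in>A. F x y" "\<exists>u\<in>B. \<exists>v\<in>A. F u v" for A B
  proof -
    have xAB: "x \<notin> A" "x \<notin> B" using A(1) x Y(2,3) by blast+
    obtain y where y: "y \<in> A" "F x y" using A(5) by blast
    obtain b u where b: "b \<in> B" "u \<in> A" "F b u" using A(6) by blast
    have yX: "y \<in> ?X" using y A(1) by blast
    have "x \<in> ?X - A" "b \<in> ?X - A" using xAB b(1) A(1,2) by blast+
    then have "F y b"
      using rank1_setD[OF A(3) y(1) b(2) _ _ sympD[OF g(1) y(2)] sympD[OF g(1) b(3)]] by blast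
    then have "locomp F y x b" using A(4) b(1) sympD[OF g(1) y(2)] xAB unfolding locomp_def by blast
    moreover have "locomp F y x y" using y g by simp
    moreover have "vmin Y (insert x Y) E ?X (locomp F y)"
      using v yX y(1) A(1) Y(2,3) by (intro vmin.locomp) blast+
    moreover have "connected_on (locomp F y) ?X" using g F(2) yX by (intro connected_on_locomp)
    ultimately show ?thesis using b(1) y(1) b1 b2 branching_locomp_iff[OF g yX] by blast
  qed
  have "\<exists>H. vmin Y (insert x Y) E ?X H \<and> connected_on H ?X \<and>
     branching k H ?X Y1 \<and> branching k H ?X Y2 \<and> (\<exists>y\<in>Y1. H x y) \<and> (\<exists>y\<in>Y2. H x y)"
  proof -
    consider "\<exists>y\<in>Y1. F x y" "\<exists>y\<in>Y2. F x y" | "\<forall>y\<in>Y1. \<not> F x y" | "\<forall>y\<in>Y2. \<not> F x y" by blast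
    then show ?thesis
    proof cases
      case 1
      then show ?thesis using v F(2) b1 b2 by blast
    next
      case 2
      have "\<exists>u\<in>Y1. \<exists>v\<in>Y2. F u v" using edge[OF ne(1)] 2 sympD[OF g(1)] by blast
      moreover have "\<exists>y\<in>Y2. F x y"
        using edge[of "Y1 \<union> Y2"] ne 2 sympD[OF g(1)] by blast
      ultimately show ?thesis using step[of Y2 Y1] 2 Y(4) branching_rank1[OF b2] by blast
    next
      case 3
      have "\<exists>u\<in>Y2. \<exists>v\<in>Y1. F u v" using edge[OF ne(2)] 3 sympD[OF g(1)] by blast
      moreover have "\<exists>y\<in>Y1. F x y"
        using edge[of "Y1 \<union> Y2"] ne 3 sympD[OF g(1)] by blast
      ultimately show ?thesis using step[of Y1 Y2] 3 Y(4) branching_rank1[OF b1] by blast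
    qed
  qed
  then show ?thesis using Y(2-4) by blast
qed

text \<open>The extension takes place inside \<open>insert x Z\<close>. As \<open>Z\<close> meets
  the rest of \<open>X\<close> only at \<open>x\<close>, \<open>vmin_extend\<close> and
  \<open>vmin_local\<close> transfer it to \<open>X\<close> with everything outside \<open>Z\<close>
  unchanged.\<close>

lemma extend_path:
  assumes sym: "symp E" and irr: "irreflp E" and fin: "finite Z" and con: "connected_on E (insert x Z)"
    and br: "branching (Suc k) E (insert x Z) Z" and x: "x \<in> X" "x \<notin> Z" and Z: "Z \<subseteq> X"
    and att: "\<And>z v. z \<in> Z \<Longrightarrow> v \<in> X - Z \<Longrightarrow> E z v \<Longrightarrow> v = x"
  shows "\<exists>F c Z'. c \<in> Z \<and> Z' \<subseteq> Z \<and> c \<notin> Z' \<and> vmin Z X E (X - Z \<union> insert c Z') F \<and> F x c \<and>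
     (\<forall>z\<in>Z'. \<forall>v\<in>X - Z. \<not> F z v) \<and> (\<forall>v\<in>X - Z. F c v \<longrightarrow> v = x) \<and>
     (\<forall>u\<in>X - Z. \<forall>v\<in>X - Z. F u v = E u v) \<and>
     connected_on F (insert c Z') \<and> branching k F (insert c Z') Z'"
proof -
  obtain F c Z' where F: "c \<in> Z" "Z' \<subseteq> Z" "c \<notin> Z'" "vmin Z (insert x Z) E (insert x (insert c Z')) F"
     "F x c" "\<forall>z\<in>Z'. \<not> F x z" "connected_on F (insert c Z')" "branching k F (insert c Z') Z'"
    using branching_extendable[OF sym irr fin con br x(2)] unfolding extendable_def by blast
  have "vmin Z (insert x Z \<union> (X - Z)) E (insert x (insert c Z') \<union> (X - Z)) F"
    by (rule vmin_extend[OF F(4)]) blast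
  moreover have "insert x Z \<union> (X - Z) = X" "insert x (insert c Z') \<union> (X - Z) = X - Z \<union> insert c Z'"
    using x Z by blast+
  ultimately have v: "vmin Z X E (X - Z \<union> insert c Z') F" by simp
  have g: "symp F" using vmin_graph[OF v] sym by blast
  have "(\<forall>u\<in>X - Z. \<forall>v\<in>X - Z. F u v = E u v) \<and> (\<forall>y\<in>Z. \<forall>v\<in>X - Z. F y v \<longrightarrow> v = x)"
    by (rule vmin_local[OF v sym]) (fact att)
  then have loc: "\<forall>u\<in>X - Z. \<forall>v\<in>X - Z. F u v = E u v"
      "\<And>y v. y \<in> Z \<Longrightarrow> v \<in> X - Z \<Longrightarrow> F y v \<Longrightarrow> v = x" by blast+
  have "\<forall>z\<in>Z'. \<forall>v\<in>X - Z. \<not> F z v" using loc(2) F(2,6) sympD[OF g] by blast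
  moreover have "\<forall>v\<in>X - Z. F c v \<longrightarrow> v = x" using loc(2) F(1) by blast
  ultimately show ?thesis using F v loc(1) by blast
qed

definition forkable :: "nat \<Rightarrow> ('a \<Rightarrow> 'a \<Rightarrow> bool) \<Rightarrow> 'a \<Rightarrow> 'a set \<Rightarrow> bool" where
  "forkable k E a Y \<longleftrightarrow> (\<exists>F Y1 Y2. Y1 \<subseteq> Y \<and> Y2 \<subseteq> Y \<and> Y1 \<inter> Y2 = {} \<and>
     vmin Y (insert a Y) E (insert a (Y1 \<union> Y2)) F \<and> (\<forall>u\<in>Y1. \<forall>v\<in>Y2. \<not> F u v) \<and>
     connected_on F (insert a Y1) \<and> branching k F (insert a Y1) Y1 \<and>
     connected_on F (insert a Y2) \<and> branching k F (insert a Y2) Y2)"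

text \<open>Pivoting on the edge between \<open>p\<close> and \<open>q\<close> makes \<open>a\<close> take over the neighbourhood of \<open>q\<close>
  in \<open>Y1 \<union> Y2\<close>.\<close>

lemma fork_contract_path:
  assumes sym: "symp E" and irr: "irreflp E"
    and dist: "a \<noteq> p" "a \<noteq> q" "p \<noteq> q" "a \<notin> Y1 \<union> Y2" "p \<notin> Y1 \<union> Y2" "q \<notin> Y1 \<union> Y2" "Y1 \<inter> Y2 = {}"
    and path: "E a p" "E p q" "\<not> E a q"
    and noY: "\<And>y. y \<in> Y1 \<union> Y2 \<Longrightarrow> \<not> E a y \<and> \<not> E p y"
    and no12: "\<And>u v. u \<in> Y1 \<Longrightarrow> v \<in> Y2 \<Longrightarrow> \<not> E u v"
    and con: "connected_on E (insert q Y1)" "connected_on E (insert q Y2)"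
    and br: "branching k E (insert q Y1) Y1" "branching k E (insert q Y2) Y2"
  shows "forkable k E a (insert p (insert q (Y1 \<union> Y2)))"
proof -
  let ?Y = "Y1 \<union> Y2" and ?X = "insert a (insert p (insert q (Y1 \<union> Y2)))"
  note s = sympD[OF sym]
  \<comment> \<open>Complementing at \<open>p\<close>, \<open>q\<close> and \<open>p\<close> is the
    pivot. The first makes \<open>a\<close> adjacent to \<open>q\<close>. The second gives
    \<open>a\<close> and \<open>p\<close> the neighbours of \<open>q\<close> in
    \<open>Y1 \<union> Y2\<close> and separates \<open>a\<close> from \<open>p\<close>. The third
    undoes the changes inside \<open>Y1 \<union> Y2\<close> and, as \<open>a\<close> is no longer
    adjacent to \<open>p\<close>, keeps the neighbours of \<open>a\<close>.\<close>
  define E1 where "E1 = locomp E p"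
  define E2 where "E2 = locomp E1 q"
  define F where "F = locomp E2 p"
  have g1: "symp E1" "irreflp E1" unfolding E1_def using sym irr by (simp_all add: symp_locomp irreflp_locomp)
  have g2: "symp E2" "irreflp E2" unfolding E2_def using g1 by (simp_all add: symp_locomp irreflp_locomp)
  have gF: "symp F" "irreflp F" unfolding F_def using g2 by (simp_all add: symp_locomp irreflp_locomp)
  have e: "E p a" "E q p" "\<not> E q a" using path s by blast+
  have yE: "\<not> E y a \<and> \<not> E y p" if "y \<in> ?Y" for y using noY[OF that] s by blast
  have E1: "E1 a q" "E1 q a" "E1 p a" "E1 p q" "E1 q p"
    using e path dist irreflpD[OF irr, of p] unfolding E1_def by (auto simp: locomp_def)
  have E1y: "E1 y v = E y v" "E1 v y = E v y" if "y \<in> ?Y" for y v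
    using noY[OF that] unfolding E1_def locomp_def by auto
  have E2: "\<not> E2 p a" unfolding E2_def locomp_def using E1 dist by auto
  have E2a: "E2 a y = E q y" "E2 p y = E q y" if "y \<in> ?Y" for y
    using noY[OF that] E1 E1y[OF that] dist that unfolding E2_def locomp_def by blast+
  have E2y: "E2 u v = (E u v \<noteq> (E q u \<and> E q v \<and> u \<noteq> v))" if "u \<in> ?Y" "v \<in> ?Y" for u v
    using E1y(1)[OF that(1)] E1y(2)[OF that(1)] E1y(2)[OF that(2)] unfolding E2_def locomp_def by blast
  have Fa: "F a y = E q y" if "y \<in> ?Y" for y
    using E2 E2a[OF that] unfolding F_def locomp_def by blast
  have Fy: "F u v = E u v" if "u \<in> ?Y" "v \<in> ?Y" for u v
    using E2y[OF that] E2a(2)[OF that(1)] E2a(2)[OF that(2)] unfolding F_def locomp_def by blast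
  have "connected_on E (insert q Y1 \<union> insert q Y2)"
    using connected_on_Un[OF sym con] by blast
  then have "connected_on E (insert q ?Y)" by (simp add: insert_commute)
  then have "connected_on E (insert p (insert q ?Y))" using connected_on_insert[OF sym, of _ q p] path by blast
  then have "connected_on E ?X" using connected_on_insert[OF sym, of _ p a] path by blast
  moreover have X: "p \<in> ?X" "q \<in> ?X" by auto
  ultimately have conF: "connected_on F ?X"
    unfolding F_def E2_def E1_def
    using sym irr by (intro connected_on_locomp symp_locomp irreflp_locomp)
  have Xlim: "connected_on F (insert a Q) \<and> branching k F (insert a Q) Q"
    if Q: "Q \<subseteq> ?Y" "branching k E (insert q Q) Q" "\<And>y v. y \<in> Q \<Longrightarrow> v \<in> ?Y - Q \<Longrightarrow> \<not> E y v" for Q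
  proof -
    have "branching k E ?X Q"
    proof (rule branching_extend[OF Q(2)])
      show "insert q Q \<subseteq> ?X" using Q(1) by blast
      fix y v assume "y \<in> Q" "v \<in> ?X - insert q Q"
      then show "\<not> E y v" using Q(1,3) yE[of y] by blast
    qed
    then have b: "branching k F ?X Q"
      using branching_locomp_iff[OF sym irr X(1)] branching_locomp_iff[OF g1 X(2)] branching_locomp_iff[OF g2 X(1)]
      unfolding F_def E2_def E1_def by blast
    obtain y v where "y \<in> Q" "v \<in> insert q Q" "v \<notin> Q" "E y v"
      using branching_rank1[OF Q(2)] by (rule rank1_set_edge)
    then have y: "y \<in> Q" "E q y" using s by blast+
    then have "F y a" using Fa Q(1) sympD[OF gF(1)] by blast
    moreover have "a \<in> ?X - Q" using dist(4) Q(1) by blast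
    ultimately show ?thesis using limb_restrict[OF gF(1) conF b _ y(1)] by blast
  qed
  have l1: "connected_on F (insert a Y1) \<and> branching k F (insert a Y1) Y1"
    by (rule Xlim[OF _ br(1)]) (use no12 in blast)+
  have l2: "connected_on F (insert a Y2) \<and> branching k F (insert a Y2) Y2"
    by (rule Xlim[OF _ br(2)]) (use no12 s in blast)+
  have "vmin {p, q} ?X E ?X F"
    unfolding F_def E2_def E1_def by (intro vmin.locomp vmin.refl) auto
  then have "vmin {p, q} ?X E (?X - {p, q}) F" by (intro vmin_delete_set) auto
  moreover have "?X - {p, q} = insert a ?Y" using dist by blast
  ultimately have "vmin (insert p (insert q ?Y)) ?X E (insert a ?Y) F"
    using vmin_mono[of "{p, q}"] by auto
  moreover have "\<forall>u\<in>Y1. \<forall>v\<in>Y2. \<not> F u v" using Fy no12 by blast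
  ultimately show ?thesis
    unfolding forkable_def using l1 l2 dist(7) by (intro exI[of _ F] exI[of _ Y1] exI[of _ Y2]) blast
qed

lemma forkable_vmin:
  assumes "vmin Y (insert a Y) E (insert a Z) F" "forkable k F a Z" "Z \<subseteq> Y"
  shows "forkable k E a Y"
proof -
  obtain H Y1 Y2 where H: "Y1 \<subseteq> Z" "Y2 \<subseteq> Z" "Y1 \<inter> Y2 = {}"
     "vmin Z (insert a Z) F (insert a (Y1 \<union> Y2)) H" "\<forall>u\<in>Y1. \<forall>v\<in>Y2. \<not> H u v"
     "connected_on H (insert a Y1)" "branching k H (insert a Y1) Y1"
     "connected_on H (insert a Y2)" "branching k H (insert a Y2) Y2"
    using assms(2) unfolding forkable_def by blast
  have "vmin Y (insert a Y) E (insert a (Y1 \<union> Y2)) H" by (rule vmin_trans[OF assms(1) H(4) assms(3)])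
  moreover have "Y1 \<subseteq> Y" "Y2 \<subseteq> Y" using H(1,2) assms(3) by blast+
  ultimately show ?thesis
    unfolding forkable_def using H(3,5-9) by (intro exI[of _ H] exI[of _ Y1] exI[of _ Y2] conjI)
qed

text \<open>Three extensions give a path \<open>a - c1 - c2 - c3\<close> behind which \<open>c3\<close> sees two limbs. If they are
  not joined, suppressing \<open>c1\<close> leaves a path of even length to contract; if they are joined, local
  complementation at \<open>c3\<close> separates them and moves them to \<open>c2\<close>, again at even distance.\<close>

lemma branching_forkable:
  assumes sym: "symp E" and irr: "irreflp E" and fin: "finite Y" and con: "connected_on E (insert a Y)"
    and br: "branching (Suc (Suc (Suc (Suc k)))) E (insert a Y) Y" and a: "a \<notin> Y"
  shows "forkable k E a Y"
proof -
  let ?X = "insert a Y"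
  \<comment> \<open>Three levels are spent on \<open>c1\<close>, \<open>c2\<close> and
    \<open>c3\<close>, the fourth on the two limbs at \<open>c3\<close>. The contraction consumes
    two vertices of the path, and preparing the limbs consumes the third.\<close>
  obtain F1 c1 Z1 where F1: "c1 \<in> Y" "Z1 \<subseteq> Y" "c1 \<notin> Z1" "vmin Y ?X E (?X - Y \<union> insert c1 Z1) F1"
     "F1 a c1" "\<forall>z\<in>Z1. \<forall>v\<in>?X - Y. \<not> F1 z v"
     "connected_on F1 (insert c1 Z1)" "branching (Suc (Suc (Suc k))) F1 (insert c1 Z1) Z1"
    using extend_path[OF sym irr fin con br, of ?X] a by blast
  define X1 where "X1 = insert a (insert c1 Z1)"
  have a1: "a \<notin> Z1" "a \<noteq> c1" using F1(1,2) a by auto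
  have "?X - Y \<union> insert c1 Z1 = X1" unfolding X1_def using a by blast
  with F1(4) have v1: "vmin Y ?X E X1 F1" by simp
  have g1: "symp F1" "irreflp F1" using vmin_graph[OF v1] sym irr by auto
  have X1Z: "X1 - Z1 = {a, c1}" unfolding X1_def using a1 F1(3) by blast
  have att1: "v = c1" if "z \<in> Z1" "v \<in> X1 - Z1" "F1 z v" for z v
    using F1(6) that a unfolding X1Z by blast
  have fin1: "finite Z1" using finite_subset[OF F1(2) fin] .
  have "\<exists>F c Z'. c \<in> Z1 \<and> Z' \<subseteq> Z1 \<and> c \<notin> Z' \<and> vmin Z1 X1 F1 (X1 - Z1 \<union> insert c Z') F \<and> F c1 c \<and>
     (\<forall>z\<in>Z'. \<forall>v\<in>X1 - Z1. \<not> F z v) \<and> (\<forall>v\<in>X1 - Z1. F c v \<longrightarrow> v = c1) \<and>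
     (\<forall>u\<in>X1 - Z1. \<forall>v\<in>X1 - Z1. F u v = F1 u v) \<and>
     connected_on F (insert c Z') \<and> branching (Suc (Suc k)) F (insert c Z') Z'"
  proof (rule extend_path[OF g1 fin1 F1(7,8) _ F1(3)])
    show "c1 \<in> X1" "Z1 \<subseteq> X1" unfolding X1_def by blast+
  qed (fact att1)
  then obtain F2 c2 Z2 where F2: "c2 \<in> Z1" "Z2 \<subseteq> Z1" "c2 \<notin> Z2" "vmin Z1 X1 F1 (X1 - Z1 \<union> insert c2 Z2) F2"
     "F2 c1 c2" "\<forall>z\<in>Z2. \<forall>v\<in>{a, c1}. \<not> F2 z v" "\<forall>v\<in>{a, c1}. F2 c2 v \<longrightarrow> v = c1"
     "\<forall>u\<in>{a, c1}. \<forall>v\<in>{a, c1}. F2 u v = F1 u v"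
     "connected_on F2 (insert c2 Z2)" "branching (Suc (Suc k)) F2 (insert c2 Z2) Z2"
    unfolding X1Z by (elim exE conjE)
  define X2 where "X2 = insert a (insert c1 (insert c2 Z2))"
  have a2: "a \<notin> Z2" "c1 \<notin> Z2" "a \<noteq> c2" "c1 \<noteq> c2" using F2(1,2) a1 F1(3) by auto
  have "X1 - Z1 \<union> insert c2 Z2 = X2" unfolding X1Z X2_def by blast
  with F2(4) have v2': "vmin Z1 X1 F1 X2 F2" by simp
  have v2: "vmin Y ?X E X2 F2" by (rule vmin_trans[OF v1 v2' F1(2)])
  have g2: "symp F2" "irreflp F2" using vmin_graph[OF v2] sym irr by auto
  have X2Z: "X2 - Z2 = {a, c1, c2}" unfolding X2_def using a2 F2(3) by blast
  have att2: "v = c2" if "z \<in> Z2" "v \<in> X2 - Z2" "F2 z v" for z v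
    using F2(6) that unfolding X2Z by blast
  have fin2: "finite Z2" using finite_subset[OF F2(2) fin1] .
  have "\<exists>F c Z'. c \<in> Z2 \<and> Z' \<subseteq> Z2 \<and> c \<notin> Z' \<and> vmin Z2 X2 F2 (X2 - Z2 \<union> insert c Z') F \<and> F c2 c \<and>
     (\<forall>z\<in>Z'. \<forall>v\<in>X2 - Z2. \<not> F z v) \<and> (\<forall>v\<in>X2 - Z2. F c v \<longrightarrow> v = c2) \<and>
     (\<forall>u\<in>X2 - Z2. \<forall>v\<in>X2 - Z2. F u v = F2 u v) \<and>
     connected_on F (insert c Z') \<and> branching (Suc k) F (insert c Z') Z'"
  proof (rule extend_path[OF g2 fin2 F2(9,10) _ F2(3)])
    show "c2 \<in> X2" "Z2 \<subseteq> X2" unfolding X2_def by blast+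
  qed (fact att2)
  then obtain F3 c3 Z3 where F3: "c3 \<in> Z2" "Z3 \<subseteq> Z2" "c3 \<notin> Z3" "vmin Z2 X2 F2 (X2 - Z2 \<union> insert c3 Z3) F3"
     "F3 c2 c3" "\<forall>z\<in>Z3. \<forall>v\<in>{a, c1, c2}. \<not> F3 z v" "\<forall>v\<in>{a, c1, c2}. F3 c3 v \<longrightarrow> v = c2"
     "\<forall>u\<in>{a, c1, c2}. \<forall>v\<in>{a, c1, c2}. F3 u v = F2 u v"
     "connected_on F3 (insert c3 Z3)" "branching (Suc k) F3 (insert c3 Z3) Z3"
    unfolding X2Z by (elim exE conjE)
  have a3: "a \<notin> Z3" "c1 \<notin> Z3" "c2 \<notin> Z3" "a \<noteq> c3" "c1 \<noteq> c3" "c2 \<noteq> c3"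
    using F3(1,2) a2 F2(3) by auto
  have "X2 - Z2 \<union> insert c3 Z3 = insert c3 Z3 \<union> {a, c1, c2}" unfolding X2Z by blast
  with F3(4) have v3': "vmin Z2 X2 F2 (insert c3 Z3 \<union> {a, c1, c2}) F3" by simp
  have v3: "vmin Y ?X E (insert c3 Z3 \<union> {a, c1, c2}) F3"
    by (rule vmin_trans[OF v2 v3']) (use F1(2) F2(2) in blast)
  have g3: "symp F3" "irreflp F3" using vmin_graph[OF v3] sym irr by auto
  have fin3: "finite Z3" using finite_subset[OF F3(2) fin2] .
  obtain F Y1 Y2 where F: "Y1 \<subseteq> Z3" "Y2 \<subseteq> Z3" "Y1 \<inter> Y2 = {}"
     "vmin Z3 (insert c3 Z3) F3 (insert c3 (Y1 \<union> Y2)) F" "connected_on F (insert c3 (Y1 \<union> Y2))"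
     "branching k F (insert c3 (Y1 \<union> Y2)) Y1" "branching k F (insert c3 (Y1 \<union> Y2)) Y2"
     "\<exists>y\<in>Y1. F c3 y" "\<exists>y\<in>Y2. F c3 y"
    using branching_two_limbs[OF g3 fin3 F3(9,10,3)] by blast
  let ?C = "{a, c1, c2}" and ?Q = "insert c3 (Y1 \<union> Y2)"
  have v': "vmin Z3 (insert c3 Z3 \<union> ?C) F3 (?Q \<union> ?C) F"
    by (rule vmin_extend[OF F(4)]) (use a3 in blast)
  have v: "vmin Y ?X E (?Q \<union> ?C) F"
    by (rule vmin_trans[OF v3 v']) (use F1(2) F2(2) F3(2) in blast)
  have g: "symp F" "irreflp F" using vmin_graph[OF v] sym irr by auto
  note s = sympD[OF g(1)]
  have "(\<forall>u\<in>insert c3 Z3 \<union> ?C - Z3. \<forall>v\<in>insert c3 Z3 \<union> ?C - Z3. F u v = F3 u v) \<and>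
        (\<forall>y\<in>Z3. \<forall>v\<in>insert c3 Z3 \<union> ?C - Z3. F y v \<longrightarrow> v = c3)"
    by (rule vmin_local[OF v' g3(1)]) (use F3(6) in blast)
  moreover have "insert c3 Z3 \<union> ?C - Z3 = {a, c1, c2, c3}" using a3 F3(3) by blast
  ultimately have loc: "F u v = F3 u v" "y \<in> Z3 \<Longrightarrow> F y v \<Longrightarrow> v = c3"
    if "u \<in> {a, c1, c2, c3}" "v \<in> {a, c1, c2, c3}" for u v y
    using that by metis+
  have path: "F a c1" "F c1 c2" "F c2 c3" "\<not> F a c2" "\<not> F a c3" "\<not> F c1 c3"
  proof -
    show "F a c1" using loc(1)[of a c1] F3(8) F2(8) F1(5) by blast
    show "F c1 c2" using loc(1)[of c1 c2] F3(8) F2(5) by blast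
    show "F c2 c3" using loc(1)[of c2 c3] F3(5) by blast
    have "\<not> F2 c2 a" using F2(7) a1(2) by blast
    then have "\<not> F2 a c2" using sympD[OF g2(1)] by blast
    then show "\<not> F a c2" using loc(1)[of a c2] F3(8) by blast
    have "\<not> F3 c3 a" "\<not> F3 c3 c1" using F3(7) a2(3,4) by blast+
    then show "\<not> F a c3" "\<not> F c1 c3" using loc(1)[of a c3] loc(1)[of c1 c3] sympD[OF g3(1)] by blast+
  qed
  have noY: "\<not> F c y" "\<not> F y c" if "y \<in> Y1 \<union> Y2" "c \<in> ?C" for y c
  proof -
    have "y \<in> Z3" "c \<noteq> c3" using that F(1,2) a3 by blast+
    then show "\<not> F y c" using loc(2)[of a c y] that(2) by blast
    then show "\<not> F c y" using s by blast
  qed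
  have nin: "a \<notin> Y1 \<union> Y2" "c1 \<notin> Y1 \<union> Y2" "c2 \<notin> Y1 \<union> Y2" "c3 \<notin> Y1 \<union> Y2"
    using F(1,2) a3 F3(3) by blast+
  have inY: "c1 \<in> Y" "c2 \<in> Y" "c3 \<in> Y" "Y1 \<subseteq> Y" "Y2 \<subseteq> Y"
    using F1(1,2) F2(1,2) F3(1,2) F(1,2) by blast+
  show ?thesis
  proof (cases "\<exists>u\<in>Y1. \<exists>v\<in>Y2. F u v")
    case False
    \<comment> \<open>This makes \<open>a\<close> adjacent to \<open>c2\<close>; once
      \<open>c1\<close> is deleted, the path to contract is \<open>a\<close>, \<open>c2\<close>,
      \<open>c3\<close>.\<close>
    define H where "H = locomp F c1"
    have gH: "symp H" "irreflp H" unfolding H_def using g by (simp_all add: symp_locomp irreflp_locomp)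
    have eq: "H u v = F u v" if "u \<in> ?Q" for u v
      using that noY(2)[of _ c1] noY(1)[of _ c1] path(6) unfolding H_def locomp_def by blast
    have "forkable k H a (insert c2 (insert c3 (Y1 \<union> Y2)))"
    proof (rule fork_contract_path[OF gH])
      show "H a c2" "H c2 c3" "\<not> H a c3"
        using path a2(3) s[OF path(1)] unfolding H_def locomp_def by blast+
      show "\<not> H a y \<and> \<not> H c2 y" if "y \<in> Y1 \<union> Y2" for y
        using eq[of y] that noY(2)[OF that] sympD[OF gH(1)] by blast
      show "\<not> H u v" if "u \<in> Y1" "v \<in> Y2" for u v using False eq[of u v] that by blast
      have sub: "insert c3 Q \<subseteq> ?Q" if "Q \<subseteq> Y1 \<union> Y2" for Q using that by blast
      have lim: "connected_on H (insert c3 Q) \<and> branching k H (insert c3 Q) Q"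
        if Q: "Q \<subseteq> Y1 \<union> Y2" "branching k F ?Q Q" "\<exists>y\<in>Q. F c3 y" for Q
      proof -
        obtain y where y: "y \<in> Q" "F y c3" using Q(3) s by blast
        have "c3 \<in> ?Q - Q" using nin(4) Q(1) by blast
        then have l: "connected_on F (insert c3 Q) \<and> branching k F (insert c3 Q) Q"
          using limb_restrict[OF g(1) F(5) Q(2) _ y] by blast
        have e: "F u v = H u v" if "u \<in> insert c3 Q" "v \<in> insert c3 Q" for u v
          using eq[of u v] that Q(1) by blast
        have "branching k F (insert c3 Q) Q = branching k H (insert c3 Q) Q"
          by (rule branching_cong) (rule e)
        then show ?thesis using l connected_on_cong[of F "insert c3 Q" H] e by blast
      qed
      show "connected_on H (insert c3 Y1)" "branching k H (insert c3 Y1) Y1"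
        using lim[of Y1] F(6,8) by blast+
      show "connected_on H (insert c3 Y2)" "branching k H (insert c3 Y2) Y2"
        using lim[of Y2] F(7,9) by blast+
    qed (use a2 a3 nin F(3) in blast)+
    moreover have "vmin Y ?X E (insert a (insert c2 (insert c3 (Y1 \<union> Y2)))) H"
    proof -
      have "vmin Y ?X E (?Q \<union> ?C - {c1}) H"
        unfolding H_def by (intro vmin.delete vmin.locomp v) (use inY in blast)+
      moreover have "?Q \<union> ?C - {c1} = insert a (insert c2 (insert c3 (Y1 \<union> Y2)))"
        using nin a1(2) a2(4) a3(5) by blast
      ultimately show ?thesis by simp
    qed
    ultimately show ?thesis using forkable_vmin[of Y a E _ H k] inY by blast
  next
    case True
    then obtain u0 v0 where uv0: "u0 \<in> Y1" "v0 \<in> Y2" "F u0 v0" by blast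
    obtain y1 y2 where y12: "y1 \<in> Y1" "F c3 y1" "y2 \<in> Y2" "F c3 y2" using F(8,9) by blast
    note r1 = branching_rank1[OF F(6)] and r2 = branching_rank1[OF F(7)]
    have m: "c3 \<in> ?Q - Y1" "c3 \<in> ?Q - Y2" "\<And>v. v \<in> Y2 \<Longrightarrow> v \<in> ?Q - Y1" "\<And>v. v \<in> Y1 \<Longrightarrow> v \<in> ?Q - Y2"
      using nin F(3) by blast+
    \<comment> \<open>The rank conditions of both limbs turn the edges between them into exactly the
      pairs of neighbours of \<open>c3\<close>. A local complementation at \<open>c3\<close> removes
      all of them and passes the neighbours of \<open>c3\<close> in the limbs on to
      \<open>c2\<close>, so \<open>c3\<close> can be deleted.\<close>
    have join: "F u v \<longleftrightarrow> F c3 u \<and> F c3 v" if uv: "u \<in> Y1" "v \<in> Y2" for u v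
    proof
      assume e: "F u v"
      have "F u c3" using rank1_setD[OF r1 uv(1) y12(1) m(3)[OF uv(2)] m(1) e s[OF y12(2)]] .
      moreover have "F v c3" using rank1_setD[OF r2 uv(2) y12(3) m(4)[OF uv(1)] m(2) s[OF e] s[OF y12(4)]] .
      ultimately show "F c3 u \<and> F c3 v" using s by blast
    next
      assume e: "F c3 u \<and> F c3 v"
      have "F u v0" using rank1_setD[OF r1 uv(1) uv0(1) m(1) m(3)[OF uv0(2)] s uv0(3)] e by blast
      then have "F v u"
        using rank1_setD[OF r2 uv(2) uv0(2) m(2) m(4)[OF uv(1)] s s[of u v0]] e by blast
      then show "F u v" using s by blast
    qed
    define H where "H = locomp F c3"
    have gH: "symp H" "irreflp H" unfolding H_def using g by (simp_all add: symp_locomp irreflp_locomp)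
    have c2y: "H c2 y = F c3 y" if "y \<in> Y1 \<union> Y2" for y
      using noY(1)[OF that, of c2] s[OF path(3)] that nin(3) unfolding H_def locomp_def by blast
    have no12: "\<not> H u v" if "u \<in> Y1" "v \<in> Y2" for u v
      using join[OF that] that F(3) unfolding H_def locomp_def by blast
    have "forkable k H a (insert c1 (insert c2 (Y1 \<union> Y2)))"
    proof (rule fork_contract_path[OF gH])
      show "H a c1" "H c1 c2" "\<not> H a c2"
        using path s unfolding H_def locomp_def by blast+
      show "\<not> H a y \<and> \<not> H c1 y" if "y \<in> Y1 \<union> Y2" for y
        using noY(1)[OF that] path(5,6) s unfolding H_def locomp_def by blast
      show "\<not> H u v" if "u \<in> Y1" "v \<in> Y2" for u v by (rule no12[OF that])
      let ?P = "insert c2 ?Q"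
      have conP: "connected_on H ?P"
        unfolding H_def using connected_on_insert[OF g(1) F(5) _ path(3)] g by (intro connected_on_locomp) auto
      have lim: "connected_on H (insert c2 Q) \<and> branching k H (insert c2 Q) Q"
        if Q: "Q \<subseteq> Y1 \<union> Y2" "branching k F ?Q Q" "\<exists>y\<in>Q. F c3 y" for Q
      proof -
        have "branching k F ?P Q"
          by (rule branching_extend[OF Q(2)]) (use Q(1) noY(2) in blast)+
        then have b: "branching k H ?P Q"
          unfolding H_def using branching_locomp_iff[OF g, of c3 ?P] by blast
        obtain y where y: "y \<in> Q" "H y c2" using Q(1,3) c2y sympD[OF gH(1)] by blast
        have "c2 \<in> ?P - Q" using nin(3) Q(1) by blast
        then show ?thesis using limb_restrict[OF gH(1) conP b _ y] by blast
      qed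
      show "connected_on H (insert c2 Y1)" "branching k H (insert c2 Y1) Y1"
        using lim[of Y1] F(6,8) by blast+
      show "connected_on H (insert c2 Y2)" "branching k H (insert c2 Y2) Y2"
        using lim[of Y2] F(7,9) by blast+
    qed (use a1 a2 a3 nin F(3) in blast)+
    moreover have "vmin Y ?X E (insert a (insert c1 (insert c2 (Y1 \<union> Y2)))) H"
    proof -
      have "vmin Y ?X E (?Q \<union> ?C - {c3}) H"
        unfolding H_def by (intro vmin.delete vmin.locomp v) (use inY in blast)+
      moreover have "?Q \<union> ?C - {c3} = insert a (insert c1 (insert c2 (Y1 \<union> Y2)))"
        using nin a3 by blast
      ultimately show ?thesis by simp
    qed
    ultimately show ?thesis using forkable_vmin[of Y a E _ H k] inY by blast
  qed
qed

section \<open>Rooted trees\<close>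

text \<open>The rules match the two ways of growing: \<open>extend\<close> corresponds to
  \<open>extendable\<close>, and \<open>join\<close> to splitting a limb at the root. The parts of a
  \<open>join\<close> are nontrivial, so that both are smaller than the union.\<close>

inductive rooted_tree :: "('b \<Rightarrow> 'b \<Rightarrow> bool) \<Rightarrow> 'b set \<Rightarrow> 'b \<Rightarrow> bool" for T where
  leaf: "rooted_tree T {t} t"
| extend: "rooted_tree T V s \<Longrightarrow> t \<notin> V \<Longrightarrow> (\<And>v. v \<in> V \<Longrightarrow> T t v \<longleftrightarrow> v = s) \<Longrightarrow> rooted_tree T (insert t V) t"
| join: "rooted_tree T V1 t \<Longrightarrow> rooted_tree T V2 t \<Longrightarrow> V1 \<inter> V2 = {t} \<Longrightarrow> V1 \<noteq> {t} \<Longrightarrow> V2 \<noteq> {t} \<Longrightarrow>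
    (\<And>u v. u \<in> V1 - {t} \<Longrightarrow> v \<in> V2 - {t} \<Longrightarrow> \<not> T u v) \<Longrightarrow> rooted_tree T (V1 \<union> V2) t"

lemma rooted_tree_root: "rooted_tree T V t \<Longrightarrow> finite V \<and> t \<in> V"
  by (induction rule: rooted_tree.induct) auto

text \<open>Acyclicity has the form that a vertex outside a connected set has at most one neighbour
  in it, which passes to subsets of \<open>V\<close>. The component \<open>C\<close> of a neighbour
  \<open>s\<close> of \<open>t\<close> in \<open>V - {t}\<close> is a smaller tree, to which
  \<open>extend\<close> adds \<open>t\<close>; the remaining vertices form with \<open>t\<close> the
  second part of a \<open>join\<close>.\<close>

lemma rooted_treeI:
  assumes "finite V" "symp T" "connected_on T V" "t \<in> V"
    and "\<And>S u s s'. S \<subseteq> V \<Longrightarrow> u \<in> V - S \<Longrightarrow> connected_on T S \<Longrightarrow> s \<in> S \<Longrightarrow> s' \<in> S \<Longrightarrow> T u s \<Longrightarrow> T u s' \<Longrightarrow> s = s'"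
  shows "rooted_tree T V t"
  using assms
proof (induction "card V" arbitrary: V t rule: less_induct)
  case less
  note fin = less.prems(1) and sym = less.prems(2) and con = less.prems(3) and t = less.prems(4)
    and acyc = less.prems(5)
  show ?case
  proof (cases "V = {t}")
    case True
    then show ?thesis by (simp add: rooted_tree.leaf)
  next
    case False
    have "{t} \<subseteq> V" "{t} \<noteq> {}" "{t} \<noteq> V" using t False by auto
    then obtain s where s: "s \<in> V - {t}" "T t s" using connected_onD[OF con] by blast
    define \<F> where "\<F> = {S. s \<in> S \<and> S \<subseteq> V - {t} \<and> connected_on T S}"
    define C where "C = \<Union>\<F>"
    have sF: "{s} \<in> \<F>" unfolding \<F>_def using s by (simp add: connected_on_singleton)
    have sC: "s \<in> C" using sF unfolding C_def by blast
    have C: "C \<subseteq> V - {t}" unfolding C_def \<F>_def by blast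
    have conC: "connected_on T C"
      unfolding C_def by (rule connected_on_Union[OF sym, of _ s]) (use sF in \<open>auto simp: \<F>_def\<close>)
    have out: "\<not> T u w" if "u \<in> C" "w \<in> V - {t} - C" for u w
    proof
      assume "T u w"
      then have "connected_on T (insert w C)" using connected_on_insert[OF sym conC that(1)] sympD[OF sym] by blast
      then have "insert w C \<in> \<F>" unfolding \<F>_def using sC C that by blast
      then show False using that unfolding C_def by blast
    qed
    have "C \<subset> V" using C t by blast
    then have "card C < card V" "finite C" using fin psubset_card_mono finite_subset by blast+
    moreover have "s = s'" if "S \<subseteq> C" "u \<in> C - S" "connected_on T S" "s \<in> S" "s' \<in> S" "T u s" "T u s'" for S u s s'
      using acyc[of S u s s'] that \<open>C \<subset> V\<close> by blast
    ultimately have rC: "rooted_tree T C s" using less.hyps[of C s] sym conC sC by blast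
    have tC: "t \<notin> C" using C by blast
    have rtC: "rooted_tree T (insert t C) t"
    proof (rule rooted_tree.extend[OF rC tC])
      fix v assume v: "v \<in> C"
      show "T t v \<longleftrightarrow> v = s"
      proof
        assume "T t v"
        then show "v = s" using acyc[of C t v s] C conC v sC s(2) t tC by blast
      qed (use s in simp)
    qed
    define D where "D = V - C"
    have V: "V = insert t C \<union> D" "insert t C \<inter> D = {t}" "t \<in> D" unfolding D_def using C t tC by blast+
    show ?thesis
    proof (cases "D = {t}")
      case True
      then show ?thesis using rtC V(1) by (simp add: insert_absorb)
    next
      case False
      have conD: "connected_on T D"
        unfolding connected_on_def
      proof (intro conjI allI impI)
        show "D \<noteq> {}" using V(3) by blast
        have cut: "\<exists>u\<in>S. \<exists>v\<in>D - S. T u v" if S: "S \<subseteq> D" "S \<noteq> {}" "t \<notin> S" for S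
        proof -
          have "S \<subseteq> V" "S \<noteq> V" using S t unfolding D_def by blast+
          then obtain u v where uv: "u \<in> S" "v \<in> V - S" "T u v" using connected_onD[OF con _ S(2)] by metis
          have "u \<in> V - {t} - C" using uv(1) S unfolding D_def by blast
          then have "v \<notin> C" using out[of v u] sympD[OF sym uv(3)] by blast
          then show ?thesis using uv unfolding D_def by blast
        qed
        fix S assume S: "S \<subseteq> D \<and> S \<noteq> {} \<and> S \<noteq> D"
        show "\<exists>u\<in>S. \<exists>v\<in>D - S. T u v"
        proof (cases "t \<in> S")
          case False
          then show ?thesis using cut[of S] S by blast
        next
          case True
          have "D - S \<subseteq> D" "D - S \<noteq> {}" "t \<notin> D - S" using S True by blast+
          then obtain u v where "u \<in> D - S" "v \<in> D - (D - S)" "T u v" using cut by metis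
          then show ?thesis using sympD[OF sym] by blast
        qed
      qed
      have "D \<subset> V" unfolding D_def using sC s by blast
      then have "card D < card V" "finite D" using fin psubset_card_mono finite_subset by blast+
      moreover have "s = s'" if "S \<subseteq> D" "u \<in> D - S" "connected_on T S" "s \<in> S" "s' \<in> S" "T u s" "T u s'" for S u s s'
        using acyc[of S u s s'] that \<open>D \<subset> V\<close> by blast
      ultimately have rD: "rooted_tree T D t" using less.hyps[of D t] sym conD V(3) by blast
      have "rooted_tree T (insert t C \<union> D) t"
      proof (rule rooted_tree.join[OF rtC rD V(2) _ False])
        show "insert t C \<noteq> {t}" using sC tC by blast
        fix u v assume "u \<in> insert t C - {t}" "v \<in> D - {t}"
        then show "\<not> T u v" using out[of u v] unfolding D_def by blast
      qed
      then show ?thesis using V(1) by simp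
    qed
  qed
qed

text \<open>The root is sent to \<open>a\<close>, the only contact of \<open>Y\<close> with the
  rest, so that realizations can be glued there.\<close>

definition realizes :: "('b \<Rightarrow> 'b \<Rightarrow> bool) \<Rightarrow> 'b set \<Rightarrow> 'b \<Rightarrow> ('a \<Rightarrow> 'a \<Rightarrow> bool) \<Rightarrow> 'a \<Rightarrow> 'a set \<Rightarrow> bool" where
  "realizes T V t E a Y \<longleftrightarrow> (\<exists>W F \<phi>. vmin Y (insert a Y) E W F \<and> bij_betw \<phi> V W \<and> \<phi> t = a \<and>
     (\<forall>u\<in>V. \<forall>v\<in>V. T u v \<longleftrightarrow> F (\<phi> u) (\<phi> v)))"

text \<open>Operations inside a limb do not disturb what lies outside, by \<open>vmin_local\<close>.
  Hence under \<open>extend\<close> the vertex \<open>a\<close> still has \<open>c\<close> as its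
  only neighbour after the limb behind \<open>c\<close> has been processed, and under
  \<open>join\<close> the two limbs can be processed one after the other.\<close>

lemma branching_realizes:
  fixes T :: "'b \<Rightarrow> 'b \<Rightarrow> bool" and E :: "'a \<Rightarrow> 'a \<Rightarrow> bool"
  assumes "rooted_tree T V t" "symp T" "irreflp T"
    and "symp E" "irreflp E" "finite Y" "a \<notin> Y" "connected_on E (insert a Y)"
      "branching (4 * card V) E (insert a Y) Y"
  shows "realizes T V t E a Y"
  using assms
proof (induction arbitrary: E a Y rule: rooted_tree.induct)
  case (leaf t)
  have "vmin Y (insert a Y) E (insert a Y - Y) E" using leaf by (intro vmin_delete_set vmin.refl) auto
  moreover have "insert a Y - Y = {a}" using leaf by auto
  moreover have "\<not> T t t" "\<not> E a a" using leaf by (auto dest: irreflpD)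
  ultimately show ?case unfolding realizes_def
    by (intro exI[of _ "{a}"] exI[of _ E] exI[of _ "\<lambda>_. a"]) (auto simp: bij_betw_def)
next
  case (extend V s t)
  note sym = extend.prems(3) and irr = extend.prems(4) and fin = extend.prems(5) and a = extend.prems(6)
  have finV: "finite V" "s \<in> V" using rooted_tree_root[OF extend.hyps(1)] by auto
  have "4 * card (insert t V) = Suc (4 * card V + 3)" using finV extend.hyps(2) by simp
  then have "extendable (4 * card V + 3) E a Y"
    using branching_extendable[OF sym irr fin extend.prems(7) _ a] extend.prems(8) by metis
  then obtain F c Z where F: "c \<in> Y" "Z \<subseteq> Y" "c \<notin> Z" "vmin Y (insert a Y) E (insert a (insert c Z)) F"
     "F a c" "\<forall>z\<in>Z. \<not> F a z" "connected_on F (insert c Z)" "branching (4 * card V + 3) F (insert c Z) Z"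
    unfolding extendable_def by blast
  have g: "symp F" "irreflp F" using vmin_graph[OF F(4)] sym irr by auto
  have "realizes T V s F c Z"
    using extend.IH[OF extend.prems(1,2) g finite_subset[OF F(2) fin] F(3,7)] branching_mono[OF F(8)] by simp
  then obtain W H \<phi> where H: "vmin Z (insert c Z) F W H" "bij_betw \<phi> V W" "\<phi> s = c"
     "\<forall>u\<in>V. \<forall>v\<in>V. T u v \<longleftrightarrow> H (\<phi> u) (\<phi> v)" unfolding realizes_def by blast
  have aZ: "a \<notin> Z" "a \<noteq> c" using F(1,2) a by auto
  have v: "vmin Z (insert c Z \<union> {a}) F (W \<union> {a}) H" by (rule vmin_extend[OF H(1)]) (use aZ in blast)
  have gH: "symp H" "irreflp H" using vmin_graph[OF v] g by auto
  have "(\<forall>u\<in>insert c Z \<union> {a} - Z. \<forall>v\<in>insert c Z \<union> {a} - Z. H u v = F u v) \<and>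
       (\<forall>y\<in>Z. \<forall>v\<in>insert c Z \<union> {a} - Z. H y v \<longrightarrow> v = c)"
    by (rule vmin_local[OF v g(1)]) (use F(6) sympD[OF g(1)] in blast)
  moreover have "insert c Z \<union> {a} - Z = {a, c}" using aZ F(3) by blast
  ultimately have loc: "\<forall>u\<in>{a, c}. \<forall>v\<in>{a, c}. H u v = F u v" "\<forall>y\<in>Z. \<forall>v\<in>{a, c}. H y v \<longrightarrow> v = c" by simp_all
  have W: "W \<subseteq> insert c Z" "c \<in> W" using vmin_verts[OF H(1)] F(3) by auto
  have Hac: "H a c" using loc(1) F(5) by blast
  have Haz: "\<not> H a z" if "z \<in> Z" for z
    using loc(2) that aZ(2) sympD[OF gH(1), of a z] by blast
  define \<psi> where "\<psi> = \<phi>(t := a)"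
  have \<psi>: "\<psi> t = a" "\<And>v. v \<in> V \<Longrightarrow> \<psi> v = \<phi> v" using extend.hyps(2) unfolding \<psi>_def by auto
  have im: "\<phi> v \<in> W" if "v \<in> V" for v using H(2) that by (auto simp: bij_betw_def)
  have inj: "\<phi> v = c \<longleftrightarrow> v = s" if "v \<in> V" for v
    using H(2,3) that finV(2) unfolding bij_betw_def inj_on_def by metis
  have t1: "T t v \<longleftrightarrow> H a (\<phi> v)" if "v \<in> V" for v
    using extend.hyps(3)[OF that] inj[OF that] Hac Haz im[OF that] W(1) by blast
  have t2: "T v t \<longleftrightarrow> H (\<phi> v) a" if "v \<in> V" for v
    using t1[OF that] sympD[OF extend.prems(1)] sympD[OF gH(1)] by blast
  have "vmin Z (insert a (insert c Z)) F (insert a W) H" using v by simp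
  then have "vmin Y (insert a Y) E (insert a W) H" by (rule vmin_trans[OF F(4) _ F(2)])
  moreover have "bij_betw \<psi> (insert t V) (insert a W)"
  proof -
    have "bij_betw \<psi> V W" using H(2) \<psi>(2) bij_betw_cong[of V \<psi> \<phi> W] by blast
    moreover have "a \<notin> W" using W(1) aZ by blast
    ultimately show ?thesis using notIn_Un_bij_betw[of t V \<psi> W] extend.hyps(2) \<psi>(1) by simp
  qed
  moreover have "T u v \<longleftrightarrow> H (\<psi> u) (\<psi> v)" if "u \<in> insert t V" "v \<in> insert t V" for u v
    using that t1 t2 H(4) \<psi> irreflpD[OF extend.prems(2)] irreflpD[OF gH(2)] by (metis insertE)
  ultimately show ?case unfolding realizes_def using \<psi>(1) by blast
next
  case (join V1 t V2)
  note sym = join.prems(3) and irr = join.prems(4) and fin = join.prems(5) and a = join.prems(6)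
  have finV: "finite V1" "t \<in> V1" "finite V2" "t \<in> V2"
    using rooted_tree_root[OF join.hyps(1)] rooted_tree_root[OF join.hyps(2)] by auto
  have "{t} \<subset> V1" "{t} \<subset> V2" using finV join.hyps(4,5) by blast+
  then have "card {t} < card V1" "card {t} < card V2"
    using psubset_card_mono finV(1,3) by blast+
  moreover have "card (V1 \<union> V2) + card (V1 \<inter> V2) = card V1 + card V2"
    using card_Un_Int[OF finV(1,3)] by simp
  ultimately have n: "card (V1 \<union> V2) \<ge> Suc (card V1)" "card (V1 \<union> V2) \<ge> Suc (card V2)"
    using join.hyps(3) by auto
  \<comment> \<open>The parts share \<open>t\<close> and each has another vertex, so either has
    fewer vertices than the union. This frees the four levels that \<open>branching_forkable\<close>
    consumes.\<close>
  define k where "k = 4 * card (V1 \<union> V2) - 4"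
  have k: "4 * card (V1 \<union> V2) = Suc (Suc (Suc (Suc k)))" "4 * card V1 \<le> k" "4 * card V2 \<le> k"
    using n unfolding k_def by auto
  have "forkable k E a Y"
    using branching_forkable[OF sym irr fin join.prems(7) _ a] join.prems(8) unfolding k(1) .
  then obtain F Y1 Y2 where F: "Y1 \<subseteq> Y" "Y2 \<subseteq> Y" "Y1 \<inter> Y2 = {}"
     "vmin Y (insert a Y) E (insert a (Y1 \<union> Y2)) F" "\<forall>u\<in>Y1. \<forall>v\<in>Y2. \<not> F u v"
     "connected_on F (insert a Y1)" "branching k F (insert a Y1) Y1"
     "connected_on F (insert a Y2)" "branching k F (insert a Y2) Y2"
    unfolding forkable_def by blast
  have aY: "a \<notin> Y1" "a \<notin> Y2" using F(1,2) a by auto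
  have g: "symp F" "irreflp F" using vmin_graph[OF F(4)] sym irr by auto
  have "realizes T V1 t F a Y1"
    using join.IH(1)[OF join.prems(1,2) g finite_subset[OF F(1) fin] aY(1) F(6)] branching_mono[OF F(7) k(2)] .
  then obtain W1 F1 \<phi>1 where F1: "vmin Y1 (insert a Y1) F W1 F1" "bij_betw \<phi>1 V1 W1" "\<phi>1 t = a"
     "\<forall>u\<in>V1. \<forall>v\<in>V1. T u v \<longleftrightarrow> F1 (\<phi>1 u) (\<phi>1 v)" unfolding realizes_def by blast
  have g1: "symp F1" "irreflp F1" using vmin_graph[OF F1(1)] g by auto
  have W1: "W1 \<subseteq> insert a Y1" "a \<in> W1" using vmin_verts[OF F1(1)] aY by auto
  have v1: "vmin Y1 (insert a Y1 \<union> Y2) F (W1 \<union> Y2) F1"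
    by (rule vmin_extend[OF F1(1)]) (use F(3) in blast)
  have D1: "insert a Y1 \<union> Y2 - Y1 = insert a Y2" using aY F(3) by blast
  have l1: "(\<forall>u\<in>insert a Y1 \<union> Y2 - Y1. \<forall>v\<in>insert a Y1 \<union> Y2 - Y1. F1 u v = F u v) \<and>
       (\<forall>y\<in>Y1. \<forall>v\<in>insert a Y1 \<union> Y2 - Y1. F1 y v \<longrightarrow> v = a)"
    by (rule vmin_local[OF v1 g(1)]) (use F(5) in blast)
  have loc1: "\<And>u v. u \<in> insert a Y2 \<Longrightarrow> v \<in> insert a Y2 \<Longrightarrow> F u v = F1 u v"
      "\<And>y v. y \<in> Y1 \<Longrightarrow> v \<in> insert a Y2 \<Longrightarrow> F1 y v \<Longrightarrow> v = a"
    using l1[unfolded D1] by blast+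
  \<comment> \<open>The operations in \<open>Y1\<close> left the relation on
    \<open>insert a Y2\<close> as it was, so \<open>Y2\<close> is still a limb at \<open>a\<close>
    in \<open>F1\<close>.\<close>
  have "connected_on F1 (insert a Y2)" by (rule connected_on_cong[OF F(8) loc1(1)])
  moreover have "branching (4 * card V2) F (insert a Y2) Y2 = branching (4 * card V2) F1 (insert a Y2) Y2"
    by (rule branching_cong) (rule loc1(1))
  then have "branching (4 * card V2) F1 (insert a Y2) Y2" using branching_mono[OF F(9) k(3)] by simp
  ultimately have "realizes T V2 t F1 a Y2"
    using join.IH(2)[OF join.prems(1,2) g1 finite_subset[OF F(2) fin] aY(2)] by blast
  then obtain W2 F2 \<phi>2 where F2: "vmin Y2 (insert a Y2) F1 W2 F2" "bij_betw \<phi>2 V2 W2" "\<phi>2 t = a"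
     "\<forall>u\<in>V2. \<forall>v\<in>V2. T u v \<longleftrightarrow> F2 (\<phi>2 u) (\<phi>2 v)" unfolding realizes_def by blast
  have g2: "symp F2" "irreflp F2" using vmin_graph[OF F2(1)] g1 by auto
  have W2: "W2 \<subseteq> insert a Y2" "a \<in> W2" using vmin_verts[OF F2(1)] aY by auto
  have "vmin Y2 (insert a Y2 \<union> W1) F1 (W2 \<union> W1) F2"
    by (rule vmin_extend[OF F2(1)]) (use W1 aY F(3) in blast)
  moreover have "insert a Y2 \<union> W1 = W1 \<union> Y2" using W1(2) by blast
  ultimately have v2: "vmin Y2 (W1 \<union> Y2) F1 (W2 \<union> W1) F2" by simp
  have D2: "W1 \<union> Y2 - Y2 = W1" using W1(1) aY(2) F(3) by blast
  have l2: "(\<forall>u\<in>W1 \<union> Y2 - Y2. \<forall>v\<in>W1 \<union> Y2 - Y2. F2 u v = F1 u v) \<and>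
       (\<forall>y\<in>Y2. \<forall>v\<in>W1 \<union> Y2 - Y2. F2 y v \<longrightarrow> v = a)"
  proof (rule vmin_local[OF v2 g1(1)])
    fix y v assume yv: "y \<in> Y2" "v \<in> W1 \<union> Y2 - Y2" "F1 y v"
    then show "v = a" using loc1(2)[of v y] W1(1) sympD[OF g1(1)] aY(2) by blast
  qed
  have loc2: "\<And>u v. u \<in> W1 \<Longrightarrow> v \<in> W1 \<Longrightarrow> F2 u v = F1 u v"
      "\<And>y v. y \<in> Y2 \<Longrightarrow> v \<in> W1 \<Longrightarrow> F2 y v \<Longrightarrow> v = a"
    using l2[unfolded D2] by blast+
  define \<psi> where "\<psi> = (\<lambda>v. if v \<in> V1 then \<phi>1 v else \<phi>2 v)"
  have \<psi>1: "\<And>v. v \<in> V1 \<Longrightarrow> \<psi> v = \<phi>1 v" unfolding \<psi>_def by simp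
  have \<psi>2: "\<psi> v = \<phi>2 v" if "v \<in> V2" for v
  proof (cases "v \<in> V1")
    case True
    then have "v = t" using that join.hyps(3) by blast
    then show ?thesis using F1(3) F2(3) finV(2) unfolding \<psi>_def by simp
  qed (simp add: \<psi>_def)
  have im1: "\<And>v. v \<in> V1 \<Longrightarrow> \<phi>1 v \<in> W1" and im2: "\<And>v. v \<in> V2 \<Longrightarrow> \<phi>2 v \<in> W2"
    using F1(2) F2(2) by (auto simp: bij_betw_def)
  have a1: "\<phi>1 v = a \<longleftrightarrow> v = t" if "v \<in> V1" for v
    using F1(2,3) that finV(2) unfolding bij_betw_def inj_on_def by metis
  have a2: "\<phi>2 v = a \<longleftrightarrow> v = t" if "v \<in> V2" for v
    using F2(2,3) that finV(4) unfolding bij_betw_def inj_on_def by metis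
  have cross: "\<not> T u v \<and> \<not> F2 (\<phi>1 u) (\<phi>2 v)" if uv: "u \<in> V1 - {t}" "v \<in> V2 - {t}" for u v
  proof -
    have "\<phi>2 v \<in> Y2" "\<phi>1 u \<in> W1" "\<phi>1 u \<noteq> a" using im2 im1 W2(1) a1 a2 uv by blast+
    then have "\<not> F2 (\<phi>2 v) (\<phi>1 u)" using loc2(2) by blast
    then show ?thesis using join.hyps(6)[OF uv] sympD[OF g2(1)] by blast
  qed
  have e1: "T u v \<longleftrightarrow> F2 (\<psi> u) (\<psi> v)" if "u \<in> V1" "v \<in> V1" for u v
    using that F1(4) loc2(1) im1 \<psi>1 by simp
  have e2: "T u v \<longleftrightarrow> F2 (\<psi> u) (\<psi> v)" if "u \<in> V2" "v \<in> V2" for u v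
    using that F2(4) \<psi>2 by simp
  have e3: "T u v \<longleftrightarrow> F2 (\<psi> u) (\<psi> v)" "T v u \<longleftrightarrow> F2 (\<psi> v) (\<psi> u)" if "u \<in> V1 - {t}" "v \<in> V2 - {t}" for u v
    using cross[OF that] that \<psi>1[of u] \<psi>2[of v] sympD[OF g2(1)] sympD[OF join.prems(1)] by auto
  have "T u v \<longleftrightarrow> F2 (\<psi> u) (\<psi> v)" if uv: "u \<in> V1 \<union> V2" "v \<in> V1 \<union> V2" for u v
  proof -
    consider "u \<in> V1" "v \<in> V1" | "u \<in> V2" "v \<in> V2" | "u \<in> V1 - {t}" "v \<in> V2 - {t}" | "v \<in> V1 - {t}" "u \<in> V2 - {t}"
      using uv finV by blast
    then show ?thesis by cases (use e1 e2 e3 in blast)+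
  qed
  moreover have "bij_betw \<psi> (V1 \<union> V2) (W2 \<union> W1)"
  proof -
    have "V1 \<union> V2 = V1 \<union> (V2 - {t})" "W2 \<union> W1 = W1 \<union> (W2 - {a})" using finV(2) W1(2) by blast+
    moreover have "bij_betw \<psi> V1 W1" using F1(2) \<psi>1 bij_betw_cong[of V1 \<psi> \<phi>1 W1] by blast
    moreover have "bij_betw \<psi> (V2 - {t}) (W2 - {a})"
    proof -
      have "bij_betw \<psi> V2 W2" using F2(2) \<psi>2 bij_betw_cong[of V2 \<psi> \<phi>2 W2] by blast
      then have "bij_betw \<psi> (V2 - {t}) (W2 - \<psi> ` {t})"
        unfolding bij_betw_def using finV(4) by (auto simp: inj_on_def)
      then show ?thesis using \<psi>2[OF finV(4)] F2(3) by simp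
    qed
    moreover have "W1 \<inter> (W2 - {a}) = {}" using W1(1) W2(1) F(3) by blast
    ultimately show ?thesis using bij_betw_combine[of \<psi> V1 W1 "V2 - {t}" "W2 - {a}"] by simp
  qed
  moreover have "vmin Y (insert a Y) E (W2 \<union> W1) F2"
  proof -
    have "vmin Y (insert a Y) E (W1 \<union> Y2) F1"
      by (rule vmin_trans[OF F(4) _ F(1)]) (use v1 in simp)
    then show ?thesis by (rule vmin_trans[OF _ v2 F(2)])
  qed
  moreover have "\<psi> t = a" using \<psi>1[OF finV(2)] F1(3) by simp
  ultimately show ?case unfolding realizes_def by blast
qed

section \<open>Translation to pair graphs\<close>

text \<open>Cutting the relation down to \<open>V\<close> removes the values outside the vertex set
  that \<open>vmin\<close> leaves behind.\<close>

definition graph_on :: "'a set \<Rightarrow> ('a \<Rightarrow> 'a \<Rightarrow> bool) \<Rightarrow> 'a pair_pre_digraph" where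
  "graph_on V E = \<lparr> pverts = V, parcs = {(u, v). u \<in> V \<and> v \<in> V \<and> E u v} \<rparr>"

lemma graph_on_simps [simp]:
  "pverts (graph_on V E) = V"
  "(u, v) \<in> parcs (graph_on V E) \<longleftrightarrow> u \<in> V \<and> v \<in> V \<and> E u v"
  by (simp_all add: graph_on_def)

lemma pair_wf_digraph_graph_on: "pair_wf_digraph (graph_on V E)"
  by unfold_locales auto

lemma pair_graph_graph_on:
  assumes "pair_graph G"
  defines "E \<equiv> \<lambda>u v. (u, v) \<in> parcs G"
  shows "graph_on (pverts G) E = G" "symp E" "irreflp E" "finite (pverts G)"
proof -
  interpret pair_graph G by fact
  have "parcs (graph_on (pverts G) E) = parcs G"
    unfolding graph_on_def E_def using in_arcsD1 in_arcsD2 by auto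
  then show "graph_on (pverts G) E = G" unfolding graph_on_def by simp
  show "symp E" unfolding E_def by (rule sympI) (rule arcs_symmetric)
  show "irreflp E" unfolding E_def by (rule irreflpI) (use no_loops' in blast)
  show "finite (pverts G)" by (rule pair_finite_verts)
qed

lemma local_complement_graph_on:
  assumes "x \<in> W"
  shows "local_complement (graph_on W F) x = graph_on W (locomp F x)"
  using assms unfolding local_complement_def neighbourhood_def Let_def graph_on_def locomp_def by auto

lemma delete_vertex_graph_on: "delete_vertex (graph_on W F) x = graph_on (W - {x}) F"
  unfolding delete_vertex_def graph_on_def by auto

lemma vmin_has_vertex_minor:
  assumes "vmin S V E W F"
  shows "has_vertex_minor (graph_on V E) (graph_on W F)"
  using assms
proof induction
  case refl
  show ?case by (rule has_vertex_minor.refl)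
next
  case (locomp W F x)
  then show ?case
    using has_vertex_minor.local_complement[OF locomp.IH, of x] local_complement_graph_on[of x W F] by simp
next
  case (delete W F x)
  then show ?case
    using has_vertex_minor.delete_vertex[OF delete.IH, of x] delete_vertex_graph_on[of W F x] by simp
qed

lemma connected_on_reachable:
  assumes "connected_on E V" "u \<in> V" "v \<in> V"
  shows "u \<rightarrow>\<^sup>*\<^bsub>with_proj (graph_on V E)\<^esub> v"
proof -
  interpret pair_wf_digraph "graph_on V E" by (rule pair_wf_digraph_graph_on)
  let ?H = "with_proj (graph_on V E)"
  define R where "R = {v \<in> V. u \<rightarrow>\<^sup>*\<^bsub>?H\<^esub> v}"
  have R: "R \<subseteq> V" "R \<noteq> {}" using assms(2) unfolding R_def by auto
  have "R = V"
  proof (rule ccontr)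
    assume "R \<noteq> V"
    then obtain x y where "x \<in> R" "y \<in> V - R" "E x y" using connected_onD[OF assms(1) R] by metis
    then have "u \<rightarrow>\<^sup>*\<^bsub>?H\<^esub> x" "(x, y) \<in> parcs (graph_on V E)" using R(1) unfolding R_def by auto
    then have "u \<rightarrow>\<^sup>*\<^bsub>?H\<^esub> y" using reachable_adj_trans by blast
    then show False using \<open>y \<in> V - R\<close> unfolding R_def by blast
  qed
  then show ?thesis using assms(3) unfolding R_def by blast
qed

lemma mk_symmetric_graph_on:
  assumes "symp E"
  shows "mk_symmetric (with_proj (graph_on V E)) = graph_on V E"
proof -
  have "(\<Union>e\<in>parcs (graph_on V E). {(fst e, snd e), (snd e, fst e)}) = parcs (graph_on V E)"
    using sympD[OF assms] by (auto simp: graph_on_def)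
  then show ?thesis unfolding mk_symmetric_def by (simp add: graph_on_def)
qed

text \<open>The library's connectedness is strong connectedness of the symmetric closure, and a
  symmetric graph is its own closure. What remains is to compare reachability with crossing
  edges.\<close>

lemma connected_graph_on_iff:
  assumes "symp E"
  shows "Digraph_Component.connected (with_proj (graph_on V E)) \<longleftrightarrow> connected_on E V"
proof
  assume "connected_on E V"
  then show "Digraph_Component.connected (with_proj (graph_on V E))"
    unfolding Digraph_Component.connected_def strongly_connected_def mk_symmetric_graph_on[OF assms]
    using connected_on_reachable[of E V] by (auto simp: connected_on_def)
next
  assume "Digraph_Component.connected (with_proj (graph_on V E))"
  then have ne: "V \<noteq> {}" and reach: "\<And>u v. u \<in> V \<Longrightarrow> v \<in> V \<Longrightarrow> u \<rightarrow>\<^sup>*\<^bsub>with_proj (graph_on V E)\<^esub> v"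
    unfolding Digraph_Component.connected_def strongly_connected_def mk_symmetric_graph_on[OF assms] by auto
  interpret pair_wf_digraph "graph_on V E" by (rule pair_wf_digraph_graph_on)
  show "connected_on E V"
  proof (rule ccontr)
    assume "\<not> connected_on E V"
    then obtain S where S: "S \<subseteq> V" "S \<noteq> {}" "S \<noteq> V" "\<And>u v. u \<in> S \<Longrightarrow> v \<in> V - S \<Longrightarrow> \<not> E u v"
      using not_connected_onE[OF _ ne] by metis
    obtain u v where uv: "u \<in> S" "v \<in> V - S" using S(1-3) by blast
    have "u \<rightarrow>\<^sup>*\<^bsub>with_proj (graph_on V E)\<^esub> v" using reach uv S(1) by blast
    then have "v \<in> S"
    proof (induct rule: reachable_induct)
      case base
      show ?case by (rule uv(1))
    next
      case (step x y)
      then show ?case using S(4)[of x y] by auto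
    qed
    then show False using uv(2) by blast
  qed
qed

section \<open>Cycles and rooted trees\<close>

lemma pawalk_verts_snoc: "pcas s p s' \<Longrightarrow> pawalk_verts s (p @ [(s', u)]) = pawalk_verts s p @ [u]"
  by (induction p arbitrary: s) auto

lemma pcas_snoc: "pcas s p s' \<Longrightarrow> pcas s (p @ [(s', u)]) u"
  by (induction p arbitrary: s) auto

lemma pawalk_verts_subset: "set (pawalk_verts s p) \<subseteq> insert s (snd ` set p \<union> fst ` set p)"
  by (induction p arbitrary: s) auto

text \<open>If \<open>u\<close> had two neighbours in a connected set \<open>S\<close> avoiding it,
  a path between them in the graph on \<open>S\<close> would close up through \<open>u\<close> to a
  cycle of length at least 3.\<close>

lemma tree_graph_rooted_tree:
  assumes "tree_graph T" "t \<in> pverts T"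
  shows "rooted_tree (\<lambda>u v. (u, v) \<in> parcs T) (pverts T) t"
proof -
  have pg: "pair_graph T" and con: "Digraph_Component.connected (with_proj T)"
    and acyc: "\<And>c. pre_digraph.cycle (with_proj T) c \<Longrightarrow> length c < 3"
    using assms(1) unfolding tree_graph_def by (auto simp: not_le[symmetric])
  let ?E = "\<lambda>u v. (u, v) \<in> parcs T"
  note G = pair_graph_graph_on[OF pg]
  interpret T: pair_graph T by (rule pg)
  show ?thesis
  proof (rule rooted_treeI[OF G(4,2) _ assms(2)])
    show "connected_on ?E (pverts T)" using connected_graph_on_iff[OF G(2), of "pverts T"] con G(1) by simp
    fix S u s s'
    assume S: "S \<subseteq> pverts T" "u \<in> pverts T - S" "connected_on ?E S" "s \<in> S" "s' \<in> S" "(u, s) \<in> parcs T" "(u, s') \<in> parcs T"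
    show "s = s'"
    proof (rule ccontr)
      assume ne: "s \<noteq> s'"
      interpret H: pair_wf_digraph "graph_on S ?E" by (rule pair_wf_digraph_graph_on)
      obtain p where p: "H.apath s p s'"
        using connected_on_reachable[OF S(3,4,5)] H.reachable_apath by blast
      then have p': "pcas s p s'" "distinct (pawalk_verts s p)" "set p \<subseteq> parcs (graph_on S ?E)"
        unfolding H.apath_def H.awalk_def by auto
      have pS: "set p \<subseteq> parcs T" "fst ` set p \<subseteq> S" "snd ` set p \<subseteq> S"
        using p'(3) unfolding graph_on_def by auto
      have "p \<noteq> []" using p'(1) ne by auto
      let ?c = "(u, s) # p @ [(s', u)]"
      have "T.awalk u ?c u"
        unfolding T.awalk_def using S pS(1) pcas_snoc[OF p'(1)] T.arcs_symmetric by auto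
      moreover have "u \<notin> set (pawalk_verts s p)" using pawalk_verts_subset[of s p] pS S(2,4) by blast
      then have "distinct (tl (pawalk_verts u ?c))" using p'(2) pawalk_verts_snoc[OF p'(1)] by simp
      ultimately have "T.cycle ?c" unfolding T.cycle_def by blast
      then show False using acyc[of ?c] \<open>p \<noteq> []\<close> by (cases p) auto
    qed
  qed
qed

lemma digraph_iso_graph_on:
  assumes T: "pair_graph T" and bij: "bij_betw \<phi> (pverts T) W"
    and edges: "\<forall>u\<in>pverts T. \<forall>v\<in>pverts T. (u, v) \<in> parcs T \<longleftrightarrow> F (\<phi> u) (\<phi> v)"
  shows "digraph_iso (with_proj (graph_on W F)) (with_proj T)"
proof -
  interpret T: pair_graph T by fact
  define \<psi> where "\<psi> = inv_into (pverts T) \<phi>"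
  have \<psi>: "bij_betw \<psi> W (pverts T)" unfolding \<psi>_def by (rule bij_betw_inv_into[OF bij])
  have \<phi>\<psi>: "\<phi> (\<psi> w) = w" "\<psi> w \<in> pverts T" if "w \<in> W" for w
    using bij_betw_inv_into_right[OF bij that] \<psi> that unfolding \<psi>_def by (auto simp: bij_betw_def)
  have \<psi>\<phi>: "\<psi> (\<phi> u) = u" "\<phi> u \<in> W" if "u \<in> pverts T" for u
    using bij_betw_inv_into_left[OF bij that] bij that unfolding \<psi>_def by (auto simp: bij_betw_def)
  have inj: "inj_on \<psi> W" using \<psi> by (simp add: bij_betw_def)
  let ?f = "\<lparr> iso_verts = \<psi>, iso_arcs = map_prod \<psi> \<psi>, iso_head = snd, iso_tail = fst \<rparr>"
  have sub: "parcs (graph_on W F) \<subseteq> W \<times> W" unfolding graph_on_def by auto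
  have "map_prod \<psi> \<psi> ` parcs (graph_on W F) = parcs T"
  proof (rule subset_antisym; rule subsetI)
    fix e assume "e \<in> map_prod \<psi> \<psi> ` parcs (graph_on W F)"
    then obtain x y where "x \<in> W" "y \<in> W" "F x y" "e = (\<psi> x, \<psi> y)" unfolding graph_on_def by auto
    then show "e \<in> parcs T" using edges \<phi>\<psi> by auto
  next
    fix e assume e: "e \<in> parcs T"
    obtain u v where uv: "e = (u, v)" by (cases e)
    have m: "u \<in> pverts T" "v \<in> pverts T" using e T.in_arcsD1 T.in_arcsD2 unfolding uv by blast+
    then have "(\<phi> u, \<phi> v) \<in> parcs (graph_on W F)" using edges e \<psi>\<phi> unfolding uv by auto
    moreover have "map_prod \<psi> \<psi> (\<phi> u, \<phi> v) = e" using \<psi>\<phi> m uv by simp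
    ultimately show "e \<in> map_prod \<psi> \<psi> ` parcs (graph_on W F)" by (metis image_eqI)
  qed
  moreover have "\<psi> ` W = pverts T" using \<psi> by (simp add: bij_betw_def)
  ultimately have "with_proj T = app_iso ?f (with_proj (graph_on W F))"
    unfolding app_iso_def with_proj_def by simp
  moreover have "pre_digraph.digraph_isomorphism (with_proj (graph_on W F)) ?f"
    unfolding pre_digraph.digraph_isomorphism_def
    using inj inj_on_subset[OF map_prod_inj_on[OF inj inj] sub] pair_wf_digraph_graph_on[of W F] wf_digraph_wp_iff
    by auto
  ultimately show ?thesis unfolding digraph_iso_def by blast
qed

section \<open>Linear rank-width and splits in terms of relations\<close>

lemma cut_rank_le_cong:
  assumes "cut_rank_le E X Y k" "\<And>x y. x \<in> X \<Longrightarrow> y \<in> Y \<Longrightarrow> E x y = F x y"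
  shows "cut_rank_le F X Y k"
proof -
  obtain f g :: "nat \<Rightarrow> 'a \<Rightarrow> bit"
    where fg: "\<forall>x\<in>X. \<forall>y\<in>Y. (if E x y then 1 else 0) = (\<Sum>i<k. f i x * g i y)"
    using assms(1) by (rule cut_rank_leE)
  show ?thesis
  proof (rule cut_rank_leI[where f = f and g = g])
    fix x y assume xy: "x \<in> X" "y \<in> Y"
    show "(if F x y then 1 else 0) = (\<Sum>i<k. f i x * g i y)"
      using fg xy unfolding assms(2)[OF xy, symmetric] by blast
  qed
qed

lemma adj_rank_graph_on:
  assumes "finite V" "X \<subseteq> V" "Y \<subseteq> V"
  shows "adj_rank (graph_on V E) X Y \<le> k \<longleftrightarrow> cut_rank_le E X Y k"
proof -
  have "adj_rank (graph_on V E) X Y \<le> k \<longleftrightarrow>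
      cut_rank_le (\<lambda>u v. (u, v) \<in> parcs (graph_on V E)) X Y k"
    using assms finite_subset by (intro adj_rank_le_iff) blast+
  also have "\<dots> \<longleftrightarrow> cut_rank_le E X Y k"
  proof
    assume "cut_rank_le (\<lambda>u v. (u, v) \<in> parcs (graph_on V E)) X Y k"
    then show "cut_rank_le E X Y k" by (rule cut_rank_le_cong) (use assms in auto)
  next
    assume "cut_rank_le E X Y k"
    then show "cut_rank_le (\<lambda>u v. (u, v) \<in> parcs (graph_on V E)) X Y k"
      by (rule cut_rank_le_cong) (use assms in auto)
  qed
  finally show ?thesis .
qed

text \<open>A binary product is 1 only if both factors are, so a factorisation of length 1 describes
  a complete bipartite graph. Connectedness excludes rank 0.\<close>

lemma rank1_setI_adj_rank:
  assumes fin: "finite V" and con: "connected_on E V" and X: "X \<subseteq> V" "X \<noteq> {}" "X \<noteq> V"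
    and rank: "adj_rank (graph_on V E) X (V - X) \<le> 1"
  shows "rank1_set E V X"
proof -
  have "cut_rank_le E X (V - X) 1" using rank adj_rank_graph_on[OF fin X(1)] by blast
  then obtain f g :: "nat \<Rightarrow> 'a \<Rightarrow> bit"
    where "\<forall>x\<in>X. \<forall>y\<in>V - X. (if E x y then 1 else 0) = (\<Sum>i<1. f i x * g i y)"
    by (rule cut_rank_leE)
  then have fg: "(if E x y then 1 else 0) = f 0 x * g 0 y" if "x \<in> X" "y \<in> V - X" for x y
    using that by simp
  have E: "E x y \<longleftrightarrow> f 0 x = 1 \<and> g 0 y = 1" if "x \<in> X" "y \<in> V - X" for x y
    using fg[OF that] by (cases "f 0 x"; cases "g 0 y") (auto split: if_splits)
  have "\<exists>u\<in>X. \<exists>v\<in>V - X. E u v" using connected_onD[OF con X] by metis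
  then show ?thesis unfolding rank1_set_def using X(1) E by blast
qed

text \<open>\<open>has_layout\<close> also looks at the empty and the full prefix, which
  \<open>layout_width\<close> omits; both have cut-rank 0. With at least two vertices the maximum is
  taken over a nonempty set.\<close>

lemma lrw_le_iff_has_layout:
  assumes fin: "finite V" and card: "card V \<ge> 2"
  shows "lrw (graph_on V E) \<le> w \<longleftrightarrow> has_layout E V V w"
proof -
  let ?H = "graph_on V E"
  have cut: "cutrk ?H X \<le> w \<longleftrightarrow> cut_rank_le E X (V - X) w" if "X \<subseteq> V" for X
    unfolding cutrk_def using adj_rank_graph_on[OF fin that] by simp
  have width: "layout_width ?H xs \<le> w \<longleftrightarrow>
      (\<forall>i\<le>length xs. cut_rank_le E (set (take i xs)) (V - set (take i xs)) w)"
    if xs: "xs \<in> permutations_of_set V" for xs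
  proof -
    have len: "length xs = card V" and sxs: "set xs = V"
      using xs by (auto simp: permutations_of_set_def distinct_card)
    have c: "cutrk ?H (set (take i xs)) \<le> w \<longleftrightarrow> cut_rank_le E (set (take i xs)) (V - set (take i xs)) w" for i
      using sxs set_take_subset[of i xs] by (intro cut) simp
    have e: "cut_rank_le E {} Q w" "cut_rank_le E Q {} w" for Q by (auto intro: cut_rank_leI)
    have "layout_width ?H xs \<le> w \<longleftrightarrow> (\<forall>i\<in>{1..length xs - 1}. cutrk ?H (set (take i xs)) \<le> w)"
      unfolding layout_width_def using card len by (subst Max_le_iff) auto
    also have "\<dots> \<longleftrightarrow> (\<forall>i\<le>length xs. cut_rank_le E (set (take i xs)) (V - set (take i xs)) w)"
      unfolding c
    proof (intro iffI allI impI ballI)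
      fix i assume h: "\<forall>i\<in>{1..length xs - 1}. cut_rank_le E (set (take i xs)) (V - set (take i xs)) w"
        and i: "i \<le> length xs"
      consider "i = 0" | "i = length xs" | "i \<in> {1..length xs - 1}" using i by fastforce
      then show "cut_rank_le E (set (take i xs)) (V - set (take i xs)) w"
      proof cases
        case 1 then show ?thesis using e(1) by simp
      next
        case 2 then show ?thesis using e(2) sxs by simp
      next
        case 3 then show ?thesis using h by blast
      qed
    qed auto
    finally show ?thesis .
  qed
  have ne: "permutations_of_set V \<noteq> {}" using fin by simp
  have "lrw ?H \<le> w \<longleftrightarrow> (\<exists>xs\<in>permutations_of_set V. layout_width ?H xs \<le> w)"
    unfolding lrw_def using card ne by (simp add: Min_le_iff)
  also have "\<dots> \<longleftrightarrow> has_layout E V V w"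
    unfolding has_layout_def using width by (auto simp: permutations_of_set_def)
  finally show ?thesis .
qed

lemma prime_on_has_layout:
  fixes E :: "'a \<Rightarrow> 'a \<Rightarrow> bool"
  assumes sym: "symp E" and fin: "finite V" and W: "W \<subseteq> V" "prime_on E W" and p: "p \<ge> 1"
    and hyp: "\<And>H :: 'a pair_pre_digraph. induced_subgraph (with_proj H) (with_proj (graph_on V E)) \<Longrightarrow>
      prime_graph H \<Longrightarrow> lrw H \<le> p"
  shows "has_layout E W W p"
proof -
  let ?H = "graph_on W E"
  have con: "connected_on E W" and ns: "\<And>S. S \<subseteq> W \<Longrightarrow> card S \<ge> 2 \<Longrightarrow> card (W - S) \<ge> 2 \<Longrightarrow> \<not> rank1_set E W S"
    using W(2) unfolding prime_on_def by blast+
  have finW: "finite W" using W(1) fin finite_subset by blast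
  show ?thesis
  proof (cases "card W \<ge> 2")
    case False
    have "W \<noteq> {}" using con by (simp add: connected_on_def)
    then have "card W = 1" using False finW card_gt_0_iff[of W] by simp
    then obtain x where x: "W = {x}" by (rule card_1_singletonE)
    show ?thesis unfolding x by (rule has_layout_mono[OF has_layout_single p])
  next
    case True
    have "\<not> is_split ?H X Y" for X Y
    proof
      assume "is_split ?H X Y"
      then have s: "X \<union> Y = W" "X \<inter> Y = {}" "card X \<ge> 2" "card Y \<ge> 2" "adj_rank ?H X Y = 1"
        unfolding is_split_def by auto
      have Y: "Y = W - X" "X \<subseteq> W" using s(1,2) by blast+
      have "X \<noteq> {}" "X \<noteq> W" using s(3,4) Y(1) by auto
      then have "rank1_set E W X" using rank1_setI_adj_rank[OF finW con Y(2)] s(5) Y(1) by simp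
      then show False using ns[OF Y(2) s(3)] s(4) Y(1) by simp
    qed
    then have "prime_graph ?H" unfolding prime_graph_def using connected_graph_on_iff[OF sym] con by blast
    moreover have "induced_subgraph (with_proj ?H) (with_proj (graph_on V E))"
      unfolding induced_subgraph_def subgraph_def
      using W(1) pair_wf_digraph_graph_on wf_digraph_wp_iff[symmetric]
      by (auto simp: compatible_def graph_on_def)
    ultimately show ?thesis using hyp lrw_le_iff_has_layout[OF finW True] by blast
  qed
qed

theorem theorem4p1:
  fixes p :: nat and T :: "'b pair_pre_digraph" and G :: "'a pair_pre_digraph"
  assumes "p \<ge> 1"
    and "tree_graph T"
    and "pair_graph G"
    and "\<And>H :: 'a pair_pre_digraph.
           induced_subgraph (with_proj H) (with_proj G) \<Longrightarrow> prime_graph H \<Longrightarrow> lrw H \<le> p"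
    and "lrw G \<ge> 40 * (p + 2) * card (pverts T)"
  shows "\<exists>H. has_vertex_minor G H \<and> digraph_iso (with_proj H) (with_proj T)"
proof (rule ccontr)
  assume no_minor: "\<not> ?thesis"
  define V where "V = pverts G"
  define E where "E = (\<lambda>u v. (u, v) \<in> parcs G)"
  let ?n = "card (pverts T)" and ?E\<^sub>T = "\<lambda>u v. (u, v) \<in> parcs T"
  have G: "graph_on V E = G" and sym: "symp E" and irr: "irreflp E" and fin: "finite V"
    using pair_graph_graph_on[OF assms(3)] unfolding V_def E_def by auto
  have pT: "pair_graph T" using assms(2) by (simp add: tree_graph_def)
  note T = pair_graph_graph_on[OF pT]
  have "pverts T \<noteq> {}"
    using assms(2) connected_graph_on_iff[OF T(2), of "pverts T"] T(1) by (auto simp: tree_graph_def connected_on_def)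
  then obtain t where t: "t \<in> pverts T" by blast
  then have n: "?n \<ge> 1" using T(4) card_gt_0_iff[of "pverts T"] by fastforce
  have primes: "\<forall>W\<subseteq>V. prime_on E W \<longrightarrow> has_layout E W W p"
    using prime_on_has_layout[OF sym fin _ _ assms(1)] assms(4) unfolding G by blast
  \<comment> \<open>\<open>G\<close> may be disconnected, so branching is considered in connected
    induced subgraphs \<open>C\<close>, which arise by deletions. The root \<open>t\<close> of
    \<open>T\<close> is sent to \<open>r\<close>.\<close>
  have "\<not> branching (4 * ?n) E C (C - {r})" if C: "C \<subseteq> V" "r \<in> C" "connected_on E C" for C r
  proof
    assume "branching (4 * ?n) E C (C - {r})"
    moreover have i: "insert r (C - {r}) = C" using C(2) by blast
    ultimately have "realizes ?E\<^sub>T (pverts T) t E r (C - {r})"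
      using branching_realizes[OF tree_graph_rooted_tree[OF assms(2) t] T(2,3) sym irr, of "C - {r}" r]
        fin C finite_subset by auto
    then obtain W F \<phi> where W: "vmin (C - {r}) C E W F" "bij_betw \<phi> (pverts T) W"
      "\<forall>u\<in>pverts T. \<forall>v\<in>pverts T. (u, v) \<in> parcs T \<longleftrightarrow> F (\<phi> u) (\<phi> v)"
      unfolding realizes_def i by blast
    have "vmin V V E (V - (V - C)) E" using fin by (intro vmin_delete_set vmin.refl) auto
    moreover have "V - (V - C) = C" using C(1) by blast
    ultimately have "vmin V V E W F" using vmin_trans[OF _ W(1), of V V E] C(1) by auto
    then have "has_vertex_minor G (graph_on W F)" using vmin_has_vertex_minor G by metis
    moreover have "digraph_iso (with_proj (graph_on W F)) (with_proj T)"
      by (rule digraph_iso_graph_on[OF pT W(2,3)])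
    ultimately show False using no_minor by blast
  qed
  then have layout: "has_layout E V V (2 * (p + 2) * (4 * ?n))"
    using layout_all[OF sym fin primes, of "4 * ?n"] n by auto
  have "lrw G \<le> 2 * (p + 2) * (4 * ?n)"
  proof (cases "card V \<ge> 2")
    case True
    then show ?thesis using lrw_le_iff_has_layout[OF fin True, of E] layout unfolding G by blast
  next
    case False
    then show ?thesis by (simp add: lrw_def V_def)
  qed
  moreover have "2 * (p + 2) * (4 * ?n) = 8 * ((p + 2) * ?n)" by (simp add: algebra_simps)
  moreover have "40 * (p + 2) * ?n = 40 * ((p + 2) * ?n)" by (simp only: mult.assoc)
  \<comment> \<open>This makes 8 times the product strictly smaller than 40 times the
    product.\<close>
  moreover have "(p + 2) * ?n \<ge> 1" using n by simp
  ultimately show False using assms(5) by linarith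
qed

end
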